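(* Let $c>0$, $E\in\mathbb{R}$ and $z\in\mathbb{C}$ with $\operatorname{Im}z>0$, and for $\ell\ge0$ put $z_\ell=E+2^{-\ell}z$. There exist $C_z<\infty$ and $\delta>0$ such that \[\mathbb{E}\,\big|\nu_n(P_{z_\ell})-\nu_{n,m}(P_{z_\ell})\big|\le C_z\,2^{3(\ell-(1+\delta)m)}\] for all integers $0\le m\le n$ and all $\ell\ge n$.
   Context: Let $B_n=\{1,\dots,2^n\}$. For $0\le r\le n$ let $\mathcal{P}_r$ be the partition of $B_n$ into the $2^{n-r}$ consecutive blocks $\{1,\dots,2^r\},\{2^r+1,\dots,2\cdot2^r\},\dots$, and $d(x,y)=\min\{r\ge0: x,y\text{ lie in a common block of }\mathcal{P}_r\}$. $\Phi_{n,r}$ is a real symmetric random matrix on $\ell^2(B_n)$ with independent (up to symmetry) centered Gaussian entries, $\mathbb{E}|\langle\delta_y,\Phi_{n,r}\delta_x\rangle|^2=2^{-r}\cdot2$ if $x=y$, $=2^{-r}$ if $1\le d(x,y)\le r$, $=0$ otherwise; the $\Phi_{n,r}$ for different $r$ are independent. Here (without normalizing constant) $H_n=\sum_{r=0}^n2^{-(1+c)r/2}\Phi_{n,r}$ and $H_{n,m}=\sum_{r=0}^m2^{-(1+c)r/2}\Phi_{n,r}$. Define $\nu_n(f)=2^{-n}\operatorname{Tr}f(H_n)$, $\nu_{n,m}(f)=2^{-n}\operatorname{Tr}f(H_{n,m})$, and the Poisson kernel $P_w(\lambda)=\operatorname{Im}\frac{1}{\lambda-w}=\frac{\operatorname{Im}w}{(\lambda-\operatorname{Re}w)^2+(\operatorname{Im}w)^2}$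 for $\operatorname{Im}w>0$. *)

theory Defs
  imports "HOL-Probability.Probability"
begin

text \<open>Hierarchical distance on B_n = {1..2^n}: least r such that x and y lie in a
 common block of the partition P_r (blocks {k 2^r + 1, ..., (k+1) 2^r}).\<close>
definition hdist :: "nat \<Rightarrow> nat \<Rightarrow> nat" where
  "hdist x y = (LEAST r. (x - 1) div 2 ^ r = (y - 1) div 2 ^ r)"

definition phi_var :: "nat \<Rightarrow> nat \<Rightarrow> nat \<Rightarrow> real" where
  "phi_var r x y =
     (if x = y then 2 * 2 powr (- real r)
      else if 1 \<le> hdist x y \<and> hdist x y \<le> r then 2 powr (- real r) else 0)"

text \<open>Index set of the independent standard Gaussians: one for each level r \<le> n and
 each unordered pair x \<le> y in B_n.\<close>
definition gidx :: "nat \<Rightarrow> (nat \<times> nat \<times> nat) set" where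
  "gidx n = {(r, x, y). r \<le> n \<and> 1 \<le> x \<and> x \<le> y \<and> y \<le> 2 ^ n}"

definition gspace :: "nat \<Rightarrow> (nat \<times> nat \<times> nat \<Rightarrow> real) measure" where
  "gspace n = PiM (gidx n) (\<lambda>_. density lborel std_normal_density)"

definition Phi :: "(nat \<times> nat \<times> nat \<Rightarrow> real) \<Rightarrow> nat \<Rightarrow> nat \<Rightarrow> nat \<Rightarrow> real" where
  "Phi \<omega> r x y = sqrt (phi_var r x y) * \<omega> (r, min x y, max x y)"

definition Hnm :: "real \<Rightarrow> nat \<Rightarrow> (nat \<times> nat \<times> nat \<Rightarrow> real) \<Rightarrow> nat \<Rightarrow> nat \<Rightarrow> real" where
  "Hnm c m \<omega> x y = (\<Sum>r\<in>{0..m}. 2 powr (- (1 + c) * real r / 2) * Phi \<omega> r x y)"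

definition orth_on :: "nat \<Rightarrow> (nat \<Rightarrow> nat \<Rightarrow> real) \<Rightarrow> bool" where
  "orth_on N U \<longleftrightarrow> (\<forall>i\<in>{1..N}. \<forall>j\<in>{1..N}.
      (\<Sum>k\<in>{1..N}. U k i * U k j) = (if i = j then 1 else 0))"

definition spec_decomp :: "nat \<Rightarrow> (nat \<Rightarrow> nat \<Rightarrow> real) \<Rightarrow> (nat \<Rightarrow> nat \<Rightarrow> real) \<times> (nat \<Rightarrow> real) \<Rightarrow> bool" where
  "spec_decomp N A Ul \<longleftrightarrow> orth_on N (fst Ul) \<and>
     (\<forall>i\<in>{1..N}. \<forall>j\<in>{1..N}. A i j = (\<Sum>k\<in>{1..N}. fst Ul i k * snd Ul k * fst Ul j k))"

definition matfun :: "(real \<Rightarrow> real) \<Rightarrow> nat \<Rightarrow> (nat \<Rightarrow> nat \<Rightarrow> real) \<Rightarrow> nat \<Rightarrow> nat \<Rightarrow> real" where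
  "matfun f N A i j = (let Ul = (SOME Ul. spec_decomp N A Ul) in
      (\<Sum>k\<in>{1..N}. fst Ul i k * f (snd Ul k) * fst Ul j k))"

definition mtrace :: "nat \<Rightarrow> (nat \<Rightarrow> nat \<Rightarrow> real) \<Rightarrow> real" where
  "mtrace N A = (\<Sum>i\<in>{1..N}. A i i)"

definition nu_nm :: "real \<Rightarrow> nat \<Rightarrow> nat \<Rightarrow> (nat \<times> nat \<times> nat \<Rightarrow> real) \<Rightarrow> (real \<Rightarrow> real) \<Rightarrow> real" where
  "nu_nm c n m \<omega> f = 2 powr (- real n) * mtrace (2 ^ n) (matfun f (2 ^ n) (Hnm c m \<omega>))"

definition nu_n :: "real \<Rightarrow> nat \<Rightarrow> (nat \<times> nat \<times> nat \<Rightarrow> real) \<Rightarrow> (real \<Rightarrow> real) \<Rightarrow> real" where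
  "nu_n c n \<omega> f = nu_nm c n n \<omega> f"

definition poisson :: "complex \<Rightarrow> real \<Rightarrow> real" where
  "poisson w t = Im (1 / (complex_of_real t - w))"

end

theory Submission
  imports Defs "HOL-Real_Asymp.Real_Asymp"
begin

text \<open>
  Let R be the resolvent of the matrix at w, with e = Im w, so that nu(P_w) = tr Im R / N. Conditionally
  on the levels up to m, the remaining levels enter as a Gaussian perturbation with independent entries of
  variance at most of order t = 2^(-(2 + c) m). The displacement of nu(P_w) splits into a fluctuation and a
  drift.

  The fluctuation around the conditional mean is bounded in mean square by t / N^2 times the expectation
  of the sum of the |(R^2)_xy|^2, hence by t E(tr Im R) / (N^2 e^3); this is a Poincare inequality,
  obtained by rotating the Gaussian vector into an independent copy of itself.

  The drift is half the Laplacian by Gaussian integration by parts, which is dominated by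
  t / (N e) times the sum of E |R_xx R_yy|. Here R_xx R_yy is R_xy^2 plus a 2 by 2 minor. By the Ward
  identity the sum over y of |R_xy|^2 is Im R_xx / e. The minor and R_xx are explicit fractions in the
  Gaussian diagonal entries of level 0 at x and y, so averaging over these bounds E |R_xx| by a logarithm
  of 1 / e and the expected modulus of the minor by its square. Altogether the drift is at most of order
  2^(2 l - (2 + c) m) and the fluctuation at most of order 2^((3/2) (l - m) - c m / 2), up to powers of l,
  and both suffice since l is at least m.
\<close>

section \<open>The spectral theorem for real symmetric matrices\<close>

text \<open>The obstacle is the drift. With the deterministic bound |R_xx| <= 1 / e, where e = Im w,
  it would only be of order 2^(n + 3 l - (2 + c) m), which at fixed m exceeds the claim by an
  unbounded factor. What saves it is that the diagonal Gaussians of level 0 belong to every H_{n,m}: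
  they stay available for averaging after all levels above m are frozen. The two halves therefore
  condition in opposite ways, the displacement bound integrating the high levels at fixed low ones
  and the logarithmic bounds the low levels at fixed high ones. Tonelli's theorem joins them, which
  is why most estimates concern nonnegative integrals.

  The eigenbasis behind \<open>matfun\<close> comes from \<open>SOME\<close> and has no regularity
  in the matrix. Measurability, continuity and derivatives are all derived from the second resolvent
  identity instead.

  Cauchy-Schwarz is replaced by |x| <= (a + x^2 / a) / 2 with a free a > 0, finally set equal to the
  target bound, so that no square root of an integral appears.\<close>

definition sym_on :: "nat \<Rightarrow> (nat \<Rightarrow> nat \<Rightarrow> real) \<Rightarrow> bool" where
  "sym_on N A \<longleftrightarrow> (\<forall>i\<in>{1..N}. \<forall>j\<in>{1..N}. A i j = A j i)"

definition ip :: "'i set \<Rightarrow> ('i \<Rightarrow> real) \<Rightarrow> ('i \<Rightarrow> real) \<Rightarrow> real" where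
  "ip S x y = (\<Sum>i\<in>S. x i * y i)"

lemma ip_commute: "ip S x y = ip S y x"
  by (simp add: ip_def mult.commute)

lemma ip_add_right: "ip S x (\<lambda>i. y i + z i) = ip S x y + ip S x z"
  by (simp add: ip_def sum.distrib algebra_simps)

lemma ip_diff_right: "ip S x (\<lambda>i. y i - z i) = ip S x y - ip S x z"
  by (simp add: ip_def sum_subtractf algebra_simps)

lemma ip_scale_right: "ip S x (\<lambda>i. t * y i) = t * ip S x y"
  by (simp add: ip_def sum_distrib_left algebra_simps)

lemma ip_sum_right: "ip S x (\<lambda>i. \<Sum>j\<in>J. c j * u j i) = (\<Sum>j\<in>J. c j * ip S x (u j))"
  unfolding ip_def sum_distrib_left
  by (subst sum.swap) (simp add: algebra_simps)

lemma ip_self_ge: "0 \<le> ip S x x"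
  by (auto simp: ip_def intro: sum_nonneg)

lemma ip_self_eq_0: "finite S \<Longrightarrow> ip S x x = 0 \<Longrightarrow> i \<in> S \<Longrightarrow> x i = 0"
  by (auto simp: ip_def sum_nonneg_eq_0_iff)

text \<open>First-order condition at a maximum. The test value t = - a / (|b| + 1) makes the linear
  term outweigh the quadratic one.\<close>

lemma quadratic_ge_0_imp_linear_0:
  fixes a b :: real
  assumes "\<And>t. 0 \<le> 2 * t * a + t\<^sup>2 * b"
  shows "a = 0"
proof (rule ccontr)
  assume "a \<noteq> 0"
  define B where "B = \<bar>b\<bar> + 1"
  have B: "B > 0" "b \<le> B" by (auto simp: B_def)
  have "0 \<le> 2 * (- a / B) * a + (- a / B)\<^sup>2 * b" by (rule assms)
  also have "\<dots> \<le> 2 * (- a / B) * a + (- a / B)\<^sup>2 * B"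
    using B by (intro add_left_mono mult_left_mono) auto
  also have "\<dots> = - a\<^sup>2 / B"
    using B by (simp add: field_simps power2_eq_square)
  also have "\<dots> < 0" using B \<open>a \<noteq> 0\<close> by simp
  finally show False by simp
qed

text \<open>Compactness yields a maximizer on the unit sphere of the orthogonal complement of
  \<open>Us\<close>; homogeneity then extends the inequality to all vectors of that
  complement.\<close>

lemma ex_rayleigh_maximizer:
  fixes A :: "nat \<Rightarrow> nat \<Rightarrow> real"
  assumes S: "finite S" and x0: "ip S x0 x0 = 1" "\<And>u. u \<in> Us \<Longrightarrow> ip S x0 u = 0"
  obtains x l where "ip S x x = 1" "\<forall>u\<in>Us. ip S x u = 0"
    "\<forall>y. (\<forall>u\<in>Us. ip S y u = 0) \<longrightarrow> ip S y (\<lambda>i. ip S (A i) y) \<le> l * ip S y y"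
    "ip S x (\<lambda>i. ip S (A i) x) = l"
proof -
  \<comment> \<open>Coordinates outside S are pinned to 0, so that Tychonoff's theorem makes K
    compact in the space of all functions. Unit vectors have entries in [-1, 1].\<close>
  define K where "K = PiE UNIV (\<lambda>i::nat. if i \<in> S then {-1..1::real} else {0})"
  define C where "C = {x. ip S x x = 1} \<inter> (\<Inter>u\<in>Us. {x. ip S x u = 0})"
  define q where "q x = ip S x (\<lambda>i. ip S (A i) x)" for x
  have "compactin (product_topology (\<lambda>i. euclidean) UNIV) K"
    unfolding K_def compactin_PiE by auto
  then have K: "compact K" by (simp add: euclidean_product_topology)
  have cont: "continuous_on UNIV (\<lambda>x. ip S x u)" "continuous_on UNIV (\<lambda>x. ip S x x)"
    "continuous_on UNIV q" for u
    unfolding ip_def q_def by (intro continuous_intros continuous_on_product_coordinates)+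
  have "closed C" unfolding C_def
    by (intro closed_Int closed_INT ballI closed_Collect_eq cont continuous_on_const)
  with K have comp: "compact (K \<inter> C)" by (rule compact_Int_closed)
  have restr: "ip S (\<lambda>i. if i \<in> S then y i else 0) z = ip S y z"
    "ip S z (\<lambda>i. if i \<in> S then y i else 0) = ip S z y" for y z
    by (auto simp: ip_def intro!: sum.cong)
  have inK: "(\<lambda>i. if i \<in> S then y i else 0) \<in> K \<inter> C"
    if "ip S y y = 1" "\<And>u. u \<in> Us \<Longrightarrow> ip S y u = 0" for y
  proof
    have "\<bar>y i\<bar> \<le> 1" if "i \<in> S" for i
    proof -
      have "y i * y i \<le> ip S y y"
        unfolding ip_def using S \<open>i \<in> S\<close> by (intro member_le_sum) auto
      then show ?thesis using \<open>ip S y y = 1\<close>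
        by (simp add: abs_square_le_1 power2_eq_square[symmetric])
    qed
    then show "(\<lambda>i. if i \<in> S then y i else 0) \<in> K" by (auto simp: K_def PiE_iff abs_le_iff)
    show "(\<lambda>i. if i \<in> S then y i else 0) \<in> C" using that by (simp add: C_def restr)
  qed
  have "continuous_on (K \<inter> C) q" using cont(3) continuous_on_subset by blast
  moreover have "K \<inter> C \<noteq> {}" using inK[OF x0] by blast
  ultimately obtain x where x: "x \<in> K \<inter> C" and mx: "\<And>y. y \<in> K \<inter> C \<Longrightarrow> q y \<le> q x"
    using continuous_attains_sup[OF comp] by metis
  show thesis
  proof (rule that[of x "q x"])
    show "ip S x x = 1" "\<forall>u\<in>Us. ip S x u = 0" using x by (auto simp: C_def)
    show "\<forall>y. (\<forall>u\<in>Us. ip S y u = 0) \<longrightarrow> ip S y (\<lambda>i. ip S (A i) y) \<le> q x * ip S y y"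
    proof (intro allI impI)
      fix y assume y: "\<forall>u\<in>Us. ip S y u = 0"
      show "ip S y (\<lambda>i. ip S (A i) y) \<le> q x * ip S y y"
      proof (cases "ip S y y = 0")
        case True
        then have "ip S y (\<lambda>i. ip S (A i) y) = 0"
          using ip_self_eq_0[OF S True] by (simp add: ip_def)
        with True show ?thesis by simp
      next
        case False
        define s where "s = sqrt (ip S y y)"
        have s: "s > 0" "s * s = ip S y y" using False ip_self_ge[of S y] by (auto simp: s_def)
        define y' where "y' = (\<lambda>i. (1 / s) * y i)"
        have 1: "ip S y' y' = 1"
          unfolding y'_def ip_scale_right ip_commute[of S "\<lambda>i. 1 / s * y i"] using s False by simp
        have "ip S y' u = 0" if "u \<in> Us" for u
          unfolding y'_def ip_commute[of S _ u] ip_scale_right using y that by (simp add: ip_commute)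
        from mx[OF inK[OF 1 this]] have "q y' \<le> q x"
          by (simp add: q_def restr)
        moreover have "q y' = ip S y (\<lambda>i. ip S (A i) y) / ip S y y"
          unfolding q_def y'_def ip_scale_right ip_commute[of S "\<lambda>i. 1 / s * y i"] s(2)[symmetric]
          by (simp add: ip_commute)
        moreover have "ip S y y > 0" using False ip_self_ge[of S y] by simp
        ultimately show ?thesis by (simp add: divide_le_eq)
      qed
    qed
  qed (simp add: q_def)
qed

lemma ip_matrix_sym:
  assumes "\<And>i j. i \<in> S \<Longrightarrow> j \<in> S \<Longrightarrow> A i j = A j i"
  shows "ip S y (\<lambda>i. ip S (A i) x) = ip S (\<lambda>i. ip S (A i) y) x"
  unfolding ip_def sum_distrib_left sum_distrib_right
  by (subst sum.swap, intro sum.cong refl) (simp add: assms mult_ac)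

text \<open>Induction on the number of eigenvectors. After k < card S of them, the residuals
  \<open>v i\<close> of the standard basis vectors have total squared length card S - k > 0, so the
  orthogonal complement contains a unit vector and the Rayleigh quotient has a maximizer x there.
  Its defect y = A x - m x lies in the complement again, and moving x along y forces y = 0.\<close>

lemma ex_orthonormal_eigenvectors:
  fixes A :: "nat \<Rightarrow> nat \<Rightarrow> real"
  assumes S: "finite S" and sym: "\<And>i j. i \<in> S \<Longrightarrow> j \<in> S \<Longrightarrow> A i j = A j i"
  shows "k \<le> card S \<Longrightarrow> \<exists>u l. (\<forall>i\<in>{1..k}. \<forall>j\<in>{1..k}. ip S (u i) (u j) = (if i = j then 1 else 0)) \<and>
    (\<forall>j\<in>{1..k}. \<forall>i\<in>S. ip S (A i) (u j) = l j * u j i)"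
proof (induction k)
  case 0
  then show ?case by auto
next
  case (Suc k)
  then obtain u l where on: "\<And>i j. i \<in> {1..k} \<Longrightarrow> j \<in> {1..k} \<Longrightarrow> ip S (u i) (u j) = (if i = j then 1 else 0)"
    and ev: "\<And>i j. j \<in> {1..k} \<Longrightarrow> i \<in> S \<Longrightarrow> ip S (A i) (u j) = l j * u j i"
    by (force simp: Suc_le_eq)
  define e where "e i = (\<lambda>j. if j = i then 1 else (0::real))" for i :: nat
  define v where "v i = (\<lambda>j. e i j - (\<Sum>p\<in>{1..k}. u p i * u p j))" for i
  have ipe: "ip S (u p) (e i) = u p i" if "i \<in> S" for i p
    using that S by (simp add: ip_def e_def if_distrib[of "\<lambda>t. _ * t"] cong: if_cong)
  have ve: "ip S (u p) (v i) = 0" if "i \<in> S" "p \<in> {1..k}" for i p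
  proof -
    have "ip S (u p) (v i) = u p i - (\<Sum>q\<in>{1..k}. u q i * ip S (u p) (u q))"
      unfolding v_def ip_diff_right ip_sum_right ipe[OF that(1)] ..
    also have "(\<Sum>q\<in>{1..k}. u q i * ip S (u p) (u q)) = (\<Sum>q\<in>{1..k}. if p = q then u q i else 0)"
      using on that by (intro sum.cong) auto
    finally show ?thesis using that by simp
  qed
  have vv: "ip S (v i) (v i) = 1 - (\<Sum>p\<in>{1..k}. u p i * u p i)" if i: "i \<in> S" for i
  proof -
    have "ip S (v i) (v i) = ip S (v i) (e i) - (\<Sum>p\<in>{1..k}. u p i * ip S (v i) (u p))"
      by (subst (2) v_def) (simp add: ip_diff_right ip_sum_right)
    also have "(\<Sum>p\<in>{1..k}. u p i * ip S (v i) (u p)) = 0"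
      using ve[OF i] by (simp add: ip_commute)
    also have "ip S (v i) (e i) = v i i" using i S
      by (simp add: ip_def e_def if_distrib[of "\<lambda>t. _ * t"] cong: if_cong)
    finally show ?thesis by (simp add: v_def e_def)
  qed
  have "(\<Sum>i\<in>S. ip S (v i) (v i)) = card S - (\<Sum>p\<in>{1..k}. ip S (u p) (u p))"
    using vv by (simp add: sum_subtractf ip_def) (subst sum.swap, simp)
  also have "\<dots> = real (card S) - real k" using on by simp
  finally have "(\<Sum>i\<in>S. ip S (v i) (v i)) \<noteq> 0" using Suc.prems by simp
  then obtain i where i: "i \<in> S" "ip S (v i) (v i) \<noteq> 0" by (meson sum.neutral)
  define s where "s = sqrt (ip S (v i) (v i))"
  have s: "s > 0" "s * s = ip S (v i) (v i)" using i(2) ip_self_ge[of S "v i"] by (auto simp: s_def)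
  define x0 where "x0 = (\<lambda>j. (1 / s) * v i j)"
  have x0: "ip S x0 x0 = 1"
    unfolding x0_def ip_scale_right ip_commute[of S "\<lambda>j. 1 / s * v i j"] using s i(2) by simp
  have x0u: "ip S x0 w = 0" if "w \<in> u ` {1..k}" for w
    unfolding x0_def ip_commute[of S _ w] ip_scale_right using ve[OF i(1)] that by auto
  obtain x m where x: "ip S x x = 1" "\<forall>w\<in>u ` {1..k}. ip S x w = 0"
    and mx: "\<forall>y. (\<forall>w\<in>u ` {1..k}. ip S y w = 0) \<longrightarrow> ip S y (\<lambda>i. ip S (A i) y) \<le> m * ip S y y"
    and xm: "ip S x (\<lambda>i. ip S (A i) x) = m"
    by (rule ex_rayleigh_maximizer[OF S x0 x0u, where A = A]) blast
  define y where "y = (\<lambda>i. ip S (A i) x - m * x i)"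
  have yW: "ip S y w = 0" if "w \<in> u ` {1..k}" for w
  proof -
    from that obtain p where p: "p \<in> {1..k}" "w = u p" by auto
    have "ip S (u p) (\<lambda>i. ip S (A i) x) = ip S (\<lambda>i. ip S (A i) (u p)) x"
      by (rule ip_matrix_sym[OF sym])
    also have "\<dots> = l p * ip S (u p) x"
      using ev[OF p(1)] by (simp add: ip_def sum_distrib_left mult.assoc)
    finally show ?thesis
      using x(2)[rule_format, OF that]
      unfolding y_def p(2) ip_commute[of S "\<lambda>i. ip S (A i) x - m * x i"] ip_diff_right ip_scale_right
      by (simp add: ip_commute[of S "u p" x])
  qed
  \<comment> \<open>The Rayleigh inequality at x + t y, expanded in t: the constant terms cancel and
    the linear coefficient is twice - |y|^2.\<close>
  have "0 \<le> 2 * t * (- ip S y y) + t\<^sup>2 * (m * ip S y y - ip S y (\<lambda>i. ip S (A i) y))" for t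
  proof -
    define z where "z = (\<lambda>i. x i + t * y i)"
    have Az: "ip S (A i) z = ip S (A i) x + t * ip S (A i) y" for i
      by (simp add: z_def ip_add_right ip_scale_right)
    have "ip S z w = 0" if "w \<in> u ` {1..k}" for w
      using x(2)[rule_format, OF that] yW[OF that]
      unfolding z_def ip_commute[of S "\<lambda>i. x i + t * y i"] ip_add_right ip_scale_right
      by (simp add: ip_commute[of S w])
    from mx[rule_format, OF this] have "ip S z (\<lambda>i. ip S (A i) z) \<le> m * ip S z z" .
    moreover have "ip S z z = 1 + 2 * t * ip S x y + t\<^sup>2 * ip S y y"
      by (simp add: z_def ip_add_right ip_scale_right ip_commute[of S "\<lambda>i. x i + t * y i"] x
          ip_commute[of S y x] power2_eq_square algebra_simps)
    moreover have "ip S z (\<lambda>i. ip S (A i) z) =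
        m + 2 * t * ip S y (\<lambda>i. ip S (A i) x) + t\<^sup>2 * ip S y (\<lambda>i. ip S (A i) y)"
    proof -
      have "ip S x (\<lambda>i. ip S (A i) y) = ip S y (\<lambda>i. ip S (A i) x)"
        using ip_matrix_sym[where S = S and A = A and x = y and y = x, OF sym] by (simp add: ip_commute)
      then show ?thesis unfolding Az ip_add_right ip_scale_right ip_commute[of S z]
        unfolding z_def ip_add_right ip_scale_right
        by (simp add: xm ip_commute[of S "\<lambda>i. ip S (A i) x"] ip_commute[of S "\<lambda>i. ip S (A i) y"]
            power2_eq_square algebra_simps)
    qed
    moreover have "ip S y (\<lambda>i. ip S (A i) x) = ip S y y + m * ip S x y"
    proof -
      have "ip S y y = ip S y (\<lambda>i. ip S (A i) x) - m * ip S x y"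
        by (subst (2) y_def) (simp add: ip_diff_right ip_scale_right ip_commute)
      then show ?thesis by simp
    qed
    ultimately show ?thesis by (simp add: algebra_simps)
  qed
  from quadratic_ge_0_imp_linear_0[OF this] have "ip S y y = 0" by simp
  then have Ax: "ip S (A i) x = m * x i" if "i \<in> S" for i
    using ip_self_eq_0[OF S _ that, of y] by (simp add: y_def)
  show ?case
  proof (intro exI[of _ "u(Suc k := x)"] exI[of _ "l(Suc k := m)"] conjI ballI)
    fix i j assume "i \<in> {1..Suc k}" "j \<in> {1..Suc k}"
    then show "ip S ((u(Suc k := x)) i) ((u(Suc k := x)) j) = (if i = j then 1 else 0)"
      using on x by (auto simp: ip_commute le_Suc_eq)
  next
    fix j i assume "j \<in> {1..Suc k}" "i \<in> S"
    then show "ip S (A i) ((u(Suc k := x)) j) = (l(Suc k := m)) j * (u(Suc k := x)) j i"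
      using ev Ax by (auto simp: le_Suc_eq)
  qed
qed

text \<open>The residuals of the standard basis vectors have total squared length N - N = 0.\<close>

lemma orth_on_transpose:
  assumes "orth_on N U" and i: "i \<in> {1..N}" and j: "j \<in> {1..N}"
  shows "(\<Sum>k=1..N. U i k * U j k) = (if i = j then 1 else 0)"
proof -
  let ?S = "{1..N}"
  have on: "(\<Sum>k\<in>?S. U k p * U k q) = (if p = q then 1 else 0)" if "p \<in> ?S" "q \<in> ?S" for p q
    using assms(1) that by (auto simp: orth_on_def)
  define P where "P a b = (\<Sum>k\<in>?S. U a k * U b k)" for a b
  have PP: "(\<Sum>b\<in>?S. P a b * P a b) = P a a" if "a \<in> ?S" for a
  proof -
    have "(\<Sum>b\<in>?S. P a b * P a b) = (\<Sum>b\<in>?S. \<Sum>k\<in>?S. \<Sum>q\<in>?S. U a k * U a q * (U b k * U b q))"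
      unfolding P_def sum_product by (intro sum.cong refl) (simp add: mult_ac)
    also have "\<dots> = (\<Sum>k\<in>?S. \<Sum>q\<in>?S. U a k * U a q * (\<Sum>b\<in>?S. U b k * U b q))"
      by (subst sum.swap, rule sum.cong[OF refl], subst sum.swap) (simp add: sum_distrib_left)
    also have "\<dots> = (\<Sum>k\<in>?S. \<Sum>q\<in>?S. if k = q then U a k * U a q else 0)"
      using on by (intro sum.cong refl) auto
    also have "\<dots> = P a a" by (simp add: P_def)
    finally show ?thesis .
  qed
  define r where "r a = (\<Sum>b\<in>?S. ((if a = b then 1 else 0) - P a b)\<^sup>2)" for a
  have r: "r a = 1 - P a a" if "a \<in> ?S" for a
  proof -
    have "r a = (\<Sum>b\<in>?S. (if a = b then 1 - 2 * P a b else 0) + P a b * P a b)"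
      unfolding r_def by (intro sum.cong refl) (auto simp: power2_eq_square algebra_simps)
    also have "\<dots> = 1 - 2 * P a a + P a a"
      using that unfolding sum.distrib PP[OF that] by simp
    finally show ?thesis by simp
  qed
  have "(\<Sum>a\<in>?S. P a a) = (\<Sum>k\<in>?S. \<Sum>a\<in>?S. U a k * U a k)"
    unfolding P_def by (rule sum.swap)
  also have "\<dots> = real N" using on by simp
  finally have "(\<Sum>a\<in>?S. r a) = 0" using r by (simp add: sum_subtractf)
  moreover have "0 \<le> r a" for a by (auto simp: r_def intro: sum_nonneg)
  ultimately have "r i = 0" using i by (simp add: sum_nonneg_eq_0_iff)
  then show ?thesis using j by (auto simp: r_def sum_nonneg_eq_0_iff P_def)
qed

text \<open>Ensures that the \<open>SOME\<close> in \<open>matfun\<close> and in \<open>res\<close>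
  picks a genuine decomposition.\<close>

lemma ex_spec_decomp:
  assumes "sym_on N A"
  shows "\<exists>Ul. spec_decomp N A Ul"
proof -
  let ?S = "{1..N}"
  have "\<And>i j. i \<in> ?S \<Longrightarrow> j \<in> ?S \<Longrightarrow> A i j = A j i" using assms by (auto simp: sym_on_def)
  from ex_orthonormal_eigenvectors[where S = ?S and A = A and k = N, OF finite_atLeastAtMost this, simplified]
  obtain u l
    where on: "\<And>i j. i \<in> ?S \<Longrightarrow> j \<in> ?S \<Longrightarrow> ip ?S (u i) (u j) = (if i = j then 1 else 0)"
      and ev: "\<And>i j. i \<in> ?S \<Longrightarrow> j \<in> ?S \<Longrightarrow> ip ?S (A i) (u j) = l j * u j i"
    unfolding One_nat_def by blast
  define U where "U i k = u k i" for i k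
  have U: "orth_on N U" using on by (auto simp: orth_on_def U_def ip_def)
  have "A i j = (\<Sum>k\<in>?S. U i k * l k * U j k)" if "i \<in> ?S" "j \<in> ?S" for i j
  proof -
    have "(\<Sum>k\<in>?S. U i k * l k * U j k) = (\<Sum>k\<in>?S. (\<Sum>p\<in>?S. A i p * U p k) * U j k)"
      using ev[OF that(1)] by (intro sum.cong refl) (simp add: U_def ip_def mult_ac)
    also have "\<dots> = (\<Sum>p\<in>?S. A i p * (\<Sum>k\<in>?S. U p k * U j k))"
      unfolding sum_distrib_left sum_distrib_right by (subst sum.swap) (simp add: mult_ac)
    also have "\<dots> = (\<Sum>p\<in>?S. if p = j then A i p else 0)"
      using orth_on_transpose[OF U] that by (intro sum.cong refl) auto
    finally show ?thesis using that by simp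
  qed
  with U show ?thesis by (intro exI[of _ "(U, l)"]) (simp add: spec_decomp_def)
qed

section \<open>Resolvents\<close>

text \<open>Functional calculus U diag(g) U^T in a fixed eigenbasis, with complex g, so that
  products of resolvents become pointwise products.\<close>

definition specsum :: "nat \<Rightarrow> (nat \<Rightarrow> nat \<Rightarrow> real) \<Rightarrow> (nat \<Rightarrow> complex) \<Rightarrow> nat \<Rightarrow> nat \<Rightarrow> complex" where
  "specsum N U g x y = (\<Sum>k=1..N. of_real (U x k) * of_real (U y k) * g k)"

lemma specsum_sym: "specsum N U g x y = specsum N U g y x"
  by (simp add: specsum_def mult_ac)

lemma specsum_1:
  assumes "orth_on N U" "x \<in> {1..N}" "y \<in> {1..N}"
  shows "specsum N U (\<lambda>_. 1) x y = (if x = y then 1 else 0)"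
proof -
  have "specsum N U (\<lambda>_. 1) x y = of_real (\<Sum>k=1..N. U x k * U y k)"
    by (simp add: specsum_def)
  then show ?thesis unfolding orth_on_transpose[OF assms] by simp
qed

lemma specsum_mult:
  assumes "orth_on N U"
  shows "(\<Sum>y=1..N. specsum N U g x y * specsum N U h y z) = specsum N U (\<lambda>k. g k * h k) x z"
proof -
  let ?S = "{1..N}"
  have "(\<Sum>y\<in>?S. specsum N U g x y * specsum N U h y z)
      = (\<Sum>y\<in>?S. \<Sum>k\<in>?S. \<Sum>q\<in>?S. of_real (U x k) * g k * of_real (U z q) * h q * of_real (U y k * U y q))"
    unfolding specsum_def sum_product by (intro sum.cong refl) (simp add: mult_ac)
  also have "\<dots> = (\<Sum>k\<in>?S. \<Sum>q\<in>?S. of_real (U x k) * g k * of_real (U z q) * h q *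
      of_real (\<Sum>y\<in>?S. U y k * U y q))"
    unfolding of_real_sum sum_distrib_left
    by (subst sum.swap, rule sum.cong[OF refl], subst sum.swap, rule refl)
  also have "\<dots> = (\<Sum>k\<in>?S. \<Sum>q\<in>?S. if k = q then of_real (U x k) * g k * of_real (U z q) * h q else 0)"
    using assms by (intro sum.cong refl) (auto simp: orth_on_def)
  also have "\<dots> = specsum N U (\<lambda>k. g k * h k) x z"
    by (auto simp: specsum_def mult_ac intro!: sum.cong)
  finally show ?thesis .
qed

lemma cnj_specsum: "cnj (specsum N U g x y) = specsum N U (\<lambda>k. cnj (g k)) x y"
  by (simp add: specsum_def)

lemma specsum_norm_sum:
  assumes "orth_on N U"
  shows "(\<Sum>y=1..N. (cmod (specsum N U g x y))\<^sup>2) = (\<Sum>k=1..N. (U x k)\<^sup>2 * (cmod (g k))\<^sup>2)"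
proof -
  have "complex_of_real (\<Sum>y=1..N. (cmod (specsum N U g x y))\<^sup>2)
      = (\<Sum>y=1..N. specsum N U g x y * specsum N U (\<lambda>k. cnj (g k)) y x)"
    unfolding of_real_sum complex_norm_square cnj_specsum
    by (intro sum.cong refl) (simp add: specsum_sym)
  also have "\<dots> = complex_of_real (\<Sum>k=1..N. (U x k)\<^sup>2 * (cmod (g k))\<^sup>2)"
    unfolding specsum_mult[OF assms] of_real_sum of_real_mult complex_norm_square
    by (simp add: specsum_def power2_eq_square)
  finally show ?thesis using of_real_eq_iff by blast
qed

text \<open>The choice term is the same as in \<open>matfun\<close>, so a single decomposition
  serves both.\<close>

definition res :: "nat \<Rightarrow> complex \<Rightarrow> (nat \<Rightarrow> nat \<Rightarrow> real) \<Rightarrow> nat \<Rightarrow> nat \<Rightarrow> complex" where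
  "res N w A = (let Ul = (SOME Ul. spec_decomp N A Ul) in
     specsum N (fst Ul) (\<lambda>k. 1 / (of_real (snd Ul k) - w)))"

text \<open>The matrix R^2. It enters because the derivative of the trace of R in a direction X is -
  Tr (X R^2).\<close>

definition res2 :: "nat \<Rightarrow> complex \<Rightarrow> (nat \<Rightarrow> nat \<Rightarrow> real) \<Rightarrow> nat \<Rightarrow> nat \<Rightarrow> complex" where
  "res2 N w A x y = (\<Sum>z=1..N. res N w A x z * res N w A z y)"

lemma res_decomp:
  assumes "sym_on N A"
  obtains U l where "orth_on N U"
    "\<And>i j. i \<in> {1..N} \<Longrightarrow> j \<in> {1..N} \<Longrightarrow> A i j = (\<Sum>k=1..N. U i k * l k * U j k)"
    "\<And>w. res N w A = specsum N U (\<lambda>k. 1 / (of_real (l k) - w))"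
    "\<And>f i j. matfun f N A i j = (\<Sum>k=1..N. U i k * f (l k) * U j k)"
proof -
  define Ul where "Ul = (SOME Ul. spec_decomp N A Ul)"
  have sd: "spec_decomp N A Ul" unfolding Ul_def by (rule someI_ex[OF ex_spec_decomp[OF assms]])
  show thesis
  proof (rule that[of "fst Ul" "snd Ul"])
    show "orth_on N (fst Ul)" using sd by (simp add: spec_decomp_def)
    show "A i j = (\<Sum>k=1..N. fst Ul i k * snd Ul k * fst Ul j k)" if "i \<in> {1..N}" "j \<in> {1..N}" for i j
      using sd that by (simp add: spec_decomp_def)
    show "res N w A = specsum N (fst Ul) (\<lambda>k. 1 / (of_real (snd Ul k) - w))" for w
      unfolding res_def Let_def Ul_def ..
    show "matfun f N A i j = (\<Sum>k=1..N. fst Ul i k * f (snd Ul k) * fst Ul j k)" for f i j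
      unfolding matfun_def Let_def Ul_def ..
  qed
qed

lemma res_cong:
  assumes "\<And>i j. i \<in> {1..N} \<Longrightarrow> j \<in> {1..N} \<Longrightarrow> A i j = B i j"
  shows "res N w A = res N w B"
proof -
  have "spec_decomp N A = spec_decomp N B" using assms by (auto simp: spec_decomp_def fun_eq_iff)
  then show ?thesis by (simp add: res_def)
qed

lemma of_real_minus_nonzero: "Im w > 0 \<Longrightarrow> complex_of_real t - w \<noteq> 0"
  by (auto simp: complex_eq_iff)

lemma res_sym: "res N w A x y = res N w A y x"
  by (simp add: res_def Let_def specsum_sym)

lemma res2_sym: "res2 N w A x y = res2 N w A y x"
  by (auto simp: res2_def res_sym mult.commute intro!: sum.cong)

lemma mtrace_matfun_poisson:
  assumes "sym_on N A"
  shows "mtrace N (matfun (poisson w) N A) = Im (\<Sum>x=1..N. res N w A x x)"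
proof -
  obtain U l where R: "\<And>w. res N w A = specsum N U (\<lambda>k. 1 / (of_real (l k) - w))"
    and m: "\<And>f i j. matfun f N A i j = (\<Sum>k=1..N. U i k * f (l k) * U j k)"
    by (rule res_decomp[OF assms]) blast
  have "Im (res N w A x x) = matfun (poisson w) N A x x" for x
    unfolding R m specsum_def Im_sum
  proof (intro sum.cong refl)
    fix k
    have "Im (complex_of_real a * complex_of_real a * b) = a * Im b * a" for a b
      by (simp add: of_real_mult[symmetric] del: of_real_mult)
    then show "Im (complex_of_real (U x k) * complex_of_real (U x k) * (1 / (complex_of_real (l k) - w)))
        = U x k * poisson w (l k) * U x k" by (simp only: poisson_def)
  qed
  then show ?thesis by (simp add: mtrace_def)
qed

context
  fixes N :: nat and w :: complex
  assumes w: "Im w > 0"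
begin

lemma res_left_inverse:
  assumes "sym_on N A" "x \<in> {1..N}" "z \<in> {1..N}"
  shows "(\<Sum>y=1..N. (of_real (A x y) - (if x = y then w else 0)) * res N w A y z) = (if x = z then 1 else 0)"
proof -
  obtain U l where U: "orth_on N U"
    and A: "\<And>i j. i \<in> {1..N} \<Longrightarrow> j \<in> {1..N} \<Longrightarrow> A i j = (\<Sum>k=1..N. U i k * l k * U j k)"
    and R: "\<And>w. res N w A = specsum N U (\<lambda>k. 1 / (of_real (l k) - w))"
    by (rule res_decomp[OF assms(1)]) blast
  have "of_real (A x y) - (if x = y then w else 0) = specsum N U (\<lambda>k. of_real (l k) - w) x y"
    if "y \<in> {1..N}" for y
  proof -
    have "(if x = y then w else 0) = w * specsum N U (\<lambda>_. 1) x y"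
      using specsum_1[OF U assms(2) that] by simp
    then show ?thesis
      unfolding A[OF assms(2) that] specsum_def
      by (simp add: sum_subtractf sum_distrib_left algebra_simps)
  qed
  then have "(\<Sum>y=1..N. (of_real (A x y) - (if x = y then w else 0)) * res N w A y z)
      = (\<Sum>y=1..N. specsum N U (\<lambda>k. of_real (l k) - w) x y * res N w A y z)"
    by simp
  also have "\<dots> = specsum N U (\<lambda>_. 1) x z"
    unfolding R specsum_mult[OF U] using of_real_minus_nonzero[OF w] by simp
  also have "\<dots> = (if x = z then 1 else 0)" by (rule specsum_1[OF U assms(2,3)])
  finally show ?thesis .
qed

lemma res_right_inverse:
  assumes "sym_on N A" "x \<in> {1..N}" "z \<in> {1..N}"
  shows "(\<Sum>y=1..N. res N w A x y * (of_real (A y z) - (if y = z then w else 0))) = (if x = z then 1 else 0)"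
proof -
  have "(\<Sum>y=1..N. res N w A x y * (of_real (A y z) - (if y = z then w else 0)))
      = (\<Sum>y=1..N. (of_real (A z y) - (if z = y then w else 0)) * res N w A y x)"
    using assms(1,3) by (intro sum.cong refl) (simp add: sym_on_def res_sym[of N w A x] mult.commute)
  then show ?thesis using res_left_inverse[OF assms(1,3,2)] by simp
qed

text \<open>Pointwise this is Im (1 / (t - w)) = Im w |1 / (t - w)|^2, weighted with the squared
  eigenvector entries at x.\<close>

lemma res_ward:
  assumes "sym_on N A"
  shows "(\<Sum>y=1..N. (cmod (res N w A x y))\<^sup>2) = Im (res N w A x x) / Im w"
proof -
  obtain U l where U: "orth_on N U"
    and R: "\<And>w. res N w A = specsum N U (\<lambda>k. 1 / (of_real (l k) - w))"
    by (rule res_decomp[OF assms(1)]) blast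
  have Im1: "Im (complex_of_real a * complex_of_real a * b) = a\<^sup>2 * Im b" for a b
    by (simp add: of_real_mult[symmetric] power2_eq_square del: of_real_mult)
  have "Im (1 / (of_real t - w)) = Im w * (cmod (1 / (of_real t - w)))\<^sup>2" for t
    by (simp add: Im_divide norm_divide power_divide cmod_power2)
  then have "Im (res N w A x x) = Im w * (\<Sum>k=1..N. (U x k)\<^sup>2 * (cmod (1 / (of_real (l k) - w)))\<^sup>2)"
    unfolding R specsum_def Im_sum Im1 by (simp add: sum_distrib_left mult_ac)
  then show ?thesis unfolding R specsum_norm_sum[OF U] using w by simp
qed

lemma res2_norm_sum_le:
  assumes "sym_on N A"
  shows "(\<Sum>y=1..N. (cmod (res2 N w A x y))\<^sup>2) \<le> (\<Sum>y=1..N. (cmod (res N w A x y))\<^sup>2) / (Im w)\<^sup>2"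
proof -
  obtain U l where U: "orth_on N U"
    and R: "\<And>w. res N w A = specsum N U (\<lambda>k. 1 / (of_real (l k) - w))"
    by (rule res_decomp[OF assms(1)]) blast
  have R2: "res2 N w A x y = specsum N U (\<lambda>k. 1 / (of_real (l k) - w) * (1 / (of_real (l k) - w))) x y" for y
    unfolding res2_def R specsum_mult[OF U] ..
  have "(cmod (1 / (of_real t - w)))\<^sup>2 \<le> 1 / (Im w)\<^sup>2" for t
  proof -
    have "\<bar>Im w\<bar> \<le> cmod (of_real t - w)" using abs_Im_le_cmod[of "of_real t - w"] by simp
    then have "(Im w)\<^sup>2 \<le> (cmod (of_real t - w))\<^sup>2" by (metis abs_le_square_iff abs_norm_cancel)
    then show ?thesis using w by (simp add: norm_divide power_divide frac_le)
  qed
  then have "(cmod (1 / (of_real t - w) * (1 / (of_real t - w))))\<^sup>2 \<le> (cmod (1 / (of_real t - w)))\<^sup>2 * (1 / (Im w)\<^sup>2)" for t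
    unfolding norm_mult power_mult_distrib by (intro mult_left_mono) auto
  then show ?thesis
    unfolding R2 unfolding R specsum_norm_sum[OF U] sum_divide_distrib
    by (intro sum_mono) (metis mult.right_neutral mult_left_mono times_divide_eq_right zero_le_power2)
qed

lemma norm_res_sq_le:
  assumes "sym_on N A" "y \<in> {1..N}"
  shows "(cmod (res N w A x y))\<^sup>2 \<le> Im (res N w A x x) / Im w"
  unfolding res_ward[OF assms(1), symmetric] using assms(2) by (intro member_le_sum) auto

text \<open>For q = R_xx this says Im (-1 / q) >= Im w, which keeps s + 1 / q away from 0 for real
  s; \<open>gauss_average_fraction\<close> expects it in this form.\<close>

lemma Im_res_ge:
  assumes "sym_on N A" "x \<in> {1..N}"
  shows "Im w * (cmod (res N w A x x))\<^sup>2 \<le> Im (res N w A x x)"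
  using norm_res_sq_le[OF assms, of x] w by (simp add: field_simps)

lemma norm_res_diag_le:
  assumes "sym_on N A" "x \<in> {1..N}"
  shows "cmod (res N w A x x) \<le> 1 / Im w"
proof (cases "res N w A x x = 0")
  case False
  have "Im w * (cmod (res N w A x x))\<^sup>2 \<le> cmod (res N w A x x)"
    using Im_res_ge[OF assms] abs_Im_le_cmod[of "res N w A x x"] by linarith
  then show ?thesis using False w by (simp add: power2_eq_square field_simps)
qed (use w in auto)

lemma norm_res_le:
  assumes "sym_on N A" "x \<in> {1..N}" "y \<in> {1..N}"
  shows "cmod (res N w A x y) \<le> 1 / Im w"
proof -
  have "(cmod (res N w A x y))\<^sup>2 \<le> Im (res N w A x x) / Im w" by (rule norm_res_sq_le[OF assms(1,3)])
  also have "\<dots> \<le> (1 / Im w) / Im w"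
    using abs_Im_le_cmod[of "res N w A x x"] norm_res_diag_le[OF assms(1,2)] w
    by (intro divide_right_mono) auto
  also have "\<dots> = (1 / Im w)\<^sup>2" by (simp add: power2_eq_square)
  finally show ?thesis using w by (simp add: power2_le_iff_abs_le)
qed

text \<open>Otherwise the Ward identity would annihilate the whole column at x, against the
  invertibility of R.\<close>

lemma Im_res_pos:
  assumes "sym_on N A" "x \<in> {1..N}"
  shows "Im (res N w A x x) > 0"
proof (rule ccontr)
  assume "\<not> ?thesis"
  then have "Im (res N w A x x) / Im w \<le> 0" using w by (simp add: divide_le_0_iff)
  then have "res N w A y x = 0" if "y \<in> {1..N}" for y
    using norm_res_sq_le[OF assms(1) that, of x] res_sym[of N w A x y]
    by (metis norm_eq_zero order_trans power2_less_eq_zero_iff)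
  then show False using res_left_inverse[OF assms assms(2)] by simp
qed

text \<open>Second resolvent identity R_B - R_A = - R_B (B - A) R_A, obtained by inserting B - w and
  A - w. Continuity, derivatives and the rank-one formulas all rest on it.\<close>

lemma res_identity:
  assumes A: "sym_on N A" and B: "sym_on N B" and x: "x \<in> {1..N}" and y: "y \<in> {1..N}"
  shows "res N w B x y - res N w A x y =
    - (\<Sum>u=1..N. \<Sum>v=1..N. res N w B x u * of_real (B u v - A u v) * res N w A v y)"
proof -
  let ?S = "{1..N}"
  let ?M = "\<lambda>C u v. complex_of_real (C u v) - (if u = v then w else 0)"
  have "(\<Sum>u\<in>?S. \<Sum>v\<in>?S. res N w B x u * of_real (B u v - A u v) * res N w A v y)
     = (\<Sum>u\<in>?S. \<Sum>v\<in>?S. res N w B x u * ?M B u v * res N w A v y)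
     - (\<Sum>u\<in>?S. \<Sum>v\<in>?S. res N w B x u * ?M A u v * res N w A v y)"
    unfolding sum_subtractf[symmetric] by (intro sum.cong refl) (simp add: algebra_simps)
  also have "(\<Sum>u\<in>?S. \<Sum>v\<in>?S. res N w B x u * ?M B u v * res N w A v y)
     = (\<Sum>v\<in>?S. (\<Sum>u\<in>?S. res N w B x u * ?M B u v) * res N w A v y)"
    by (subst sum.swap) (simp only: sum_distrib_right)
  also have "\<dots> = (\<Sum>v\<in>?S. if x = v then res N w A v y else 0)"
    by (intro sum.cong refl) (use res_right_inverse[OF B x] in simp)
  also have "\<dots> = res N w A x y" using x by simp
  also have "(\<Sum>u\<in>?S. \<Sum>v\<in>?S. res N w B x u * ?M A u v * res N w A v y)
     = (\<Sum>u\<in>?S. res N w B x u * (\<Sum>v\<in>?S. ?M A u v * res N w A v y))"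
    by (simp only: sum_distrib_left mult.assoc)
  also have "\<dots> = (\<Sum>u\<in>?S. if u = y then res N w B x u else 0)"
    by (intro sum.cong refl) (use res_left_inverse[OF A _ y] in simp)
  also have "\<dots> = res N w B x y" using y by simp
  finally show ?thesis by simp
qed

text \<open>Continuity without a continuous choice of eigenvectors: both resolvents in the identity
  are bounded by 1 / Im w, and only B - A remains.\<close>

lemma res_lipschitz:
  assumes A: "sym_on N A" and B: "sym_on N B" and x: "x \<in> {1..N}" and y: "y \<in> {1..N}"
  shows "cmod (res N w B x y - res N w A x y) \<le> (\<Sum>u=1..N. \<Sum>v=1..N. \<bar>B u v - A u v\<bar>) / (Im w)\<^sup>2"
proof -
  have "cmod (res N w B x y - res N w A x y)
     \<le> (\<Sum>u=1..N. \<Sum>v=1..N. cmod (res N w B x u) * \<bar>B u v - A u v\<bar> * cmod (res N w A v y))"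
    unfolding res_identity[OF assms] norm_minus_cancel
    by (intro order_trans[OF norm_sum] sum_mono order_trans[OF norm_sum])
      (simp add: norm_mult flip: of_real_diff)
  also have "\<dots> \<le> (\<Sum>u=1..N. \<Sum>v=1..N. 1 / Im w * \<bar>B u v - A u v\<bar> * (1 / Im w))"
    using norm_res_le[OF A _ y] norm_res_le[OF B x] w
    by (intro sum_mono mult_mono mult_right_mono) auto
  also have "\<dots> = (\<Sum>u=1..N. \<Sum>v=1..N. \<bar>B u v - A u v\<bar>) / (Im w)\<^sup>2"
    by (simp add: sum_divide_distrib power2_eq_square)
  finally show ?thesis .
qed

text \<open>The resolvent entry is a continuous function on the product space of all entries, hence
  Borel there, and it is composed with the coordinatewise measurable map that sends p to its
  matrix.\<close>

lemma borel_measurable_res: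
  assumes A: "\<And>p. sym_on N (A p)"
    and meas: "\<And>u v. u \<in> {1..N} \<Longrightarrow> v \<in> {1..N} \<Longrightarrow> (\<lambda>p. A p u v) \<in> borel_measurable M"
    and x: "x \<in> {1..N}" and y: "y \<in> {1..N}"
  shows "(\<lambda>p. res N w (A p) x y) \<in> borel_measurable M"
proof -
  let ?S = "{1..N}"
  \<comment> \<open>Only the upper triangle of q is read, so every q, symmetric or not, gives a
    symmetric matrix and the Lipschitz bound applies on the whole space.\<close>
  define B where "B q = (\<lambda>u v. q (min u v, max u v))" for q :: "nat \<times> nat \<Rightarrow> real"
  have B: "sym_on N (B q)" for q by (auto simp: sym_on_def B_def min.commute max.commute)
  have "((\<lambda>q'. res N w (B q') x y) \<longlongrightarrow> res N w (B q) x y) (at q)" for q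
  proof -
    have c: "((\<lambda>q'. q' i) \<longlongrightarrow> q i) (at q)" for i
    proof -
      have "continuous_on UNIV (\<lambda>q'::nat \<times> nat \<Rightarrow> real. q' i)"
        by (rule continuous_on_product_coordinates)
      then show ?thesis unfolding continuous_on_def by blast
    qed
    have "((\<lambda>q'. (\<Sum>u\<in>?S. \<Sum>v\<in>?S. \<bar>B q' u v - B q u v\<bar>) / (Im w)\<^sup>2) \<longlongrightarrow>
         (\<Sum>u\<in>?S. \<Sum>v\<in>?S. \<bar>B q u v - B q u v\<bar>) / (Im w)\<^sup>2) (at q)"
      unfolding B_def using w by (intro tendsto_intros c) auto
    then have "((\<lambda>q'. (\<Sum>u\<in>?S. \<Sum>v\<in>?S. \<bar>B q' u v - B q u v\<bar>) / (Im w)\<^sup>2) \<longlongrightarrow> 0) (at q)"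
      by simp
    then have "((\<lambda>q'. res N w (B q') x y - res N w (B q) x y) \<longlongrightarrow> 0) (at q)"
      by (rule Lim_null_comparison[rotated]) (intro always_eventually allI res_lipschitz[OF B B x y])
    then show ?thesis by (rule LIM_zero_cancel)
  qed
  then have m: "(\<lambda>q. res N w (B q) x y) \<in> borel_measurable borel"
    by (intro borel_measurable_continuous_onI) (simp add: continuous_on_def)
  define Q where "Q p = (\<lambda>(u, v). if u \<in> {1..N} \<and> v \<in> {1..N} then A p u v else 0)" for p
  have "Q \<in> measurable M borel"
  proof (rule measurable_coordinatewise_then_product)
    fix i :: "nat \<times> nat"
    show "(\<lambda>p. Q p i) \<in> borel_measurable M"
      using meas by (cases i; cases "fst i \<in> {1..N} \<and> snd i \<in> {1..N}") (auto simp: Q_def)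
  qed
  from measurable_compose[OF this m] have "(\<lambda>p. res N w (B (Q p)) x y) \<in> borel_measurable M" .
  also have "(\<lambda>p. res N w (B (Q p)) x y) = (\<lambda>p. res N w (A p) x y)"
  proof
    fix p
    show "res N w (B (Q p)) x y = res N w (A p) x y"
      using A[of p] by (subst res_cong[where B = "A p"]) (auto simp: B_def Q_def sym_on_def min_def max_def)
  qed
  finally show ?thesis .
qed

lemma borel_measurable_res2:
  assumes "\<And>p. sym_on N (A p)"
    and "\<And>u v. u \<in> {1..N} \<Longrightarrow> v \<in> {1..N} \<Longrightarrow> (\<lambda>p. A p u v) \<in> borel_measurable M"
    and "x \<in> {1..N}" and "y \<in> {1..N}"
  shows "(\<lambda>p. res2 N w (A p) x y) \<in> borel_measurable M"
  unfolding res2_def by (intro borel_measurable_sum borel_measurable_times borel_measurable_res assms)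

lemma isCont_res:
  assumes A: "\<And>t. sym_on N (A t)"
    and cA: "\<And>u v. u \<in> {1..N} \<Longrightarrow> v \<in> {1..N} \<Longrightarrow> isCont (\<lambda>t. A t u v) t0"
    and x: "x \<in> {1..N}" and y: "y \<in> {1..N}"
  shows "isCont (\<lambda>t::real. res N w (A t) x y) t0"
proof -
  let ?S = "{1..N}"
  have "((\<lambda>t. (\<Sum>u\<in>?S. \<Sum>v\<in>?S. \<bar>A t u v - A t0 u v\<bar>) / (Im w)\<^sup>2) \<longlongrightarrow>
      (\<Sum>u\<in>?S. \<Sum>v\<in>?S. \<bar>A t0 u v - A t0 u v\<bar>) / (Im w)\<^sup>2) (at t0)"
    using w cA by (intro tendsto_intros) (auto simp: isCont_def)
  then have "((\<lambda>t. (\<Sum>u\<in>?S. \<Sum>v\<in>?S. \<bar>A t u v - A t0 u v\<bar>) / (Im w)\<^sup>2) \<longlongrightarrow> 0) (at t0)"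
    by simp
  then have "((\<lambda>t. res N w (A t) x y - res N w (A t0) x y) \<longlongrightarrow> 0) (at t0)"
    by (rule Lim_null_comparison[rotated]) (intro always_eventually allI res_lipschitz[OF A A x y])
  then show ?thesis unfolding isCont_def by (rule LIM_zero_cancel)
qed

text \<open>The resolvent identity divided by the increment; the perturbed resolvent in it converges
  by continuity.\<close>

lemma has_vector_derivative_res:
  assumes A: "\<And>t. sym_on N (A t)"
    and dA: "\<And>u v. u \<in> {1..N} \<Longrightarrow> v \<in> {1..N} \<Longrightarrow> ((\<lambda>t. A t u v) has_real_derivative A' u v) (at t0)"
    and x: "x \<in> {1..N}" and y: "y \<in> {1..N}"
  shows "((\<lambda>t. res N w (A t) x y) has_vector_derivative
    - (\<Sum>u=1..N. \<Sum>v=1..N. res N w (A t0) x u * of_real (A' u v) * res N w (A t0) v y)) (at t0)"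
proof -
  let ?S = "{1..N}"
  let ?D = "\<Sum>u\<in>?S. \<Sum>v\<in>?S. res N w (A t0) x u * of_real (A' u v) * res N w (A t0) v y"
  have dq: "((\<lambda>h. (A (t0 + h) u v - A t0 u v) / h) \<longlongrightarrow> A' u v) (at 0)" if "u \<in> ?S" "v \<in> ?S" for u v
    using dA[OF that] by (simp add: DERIV_def)
  have cR: "((\<lambda>h. res N w (A (t0 + h)) x u) \<longlongrightarrow> res N w (A t0) x u) (at 0)" if "u \<in> ?S" for u
    using LIM_offset_zero[OF isCont_res[where A = A, OF A DERIV_isCont[OF dA] x that, unfolded isCont_def]] .
  have "((\<lambda>h. - (\<Sum>u\<in>?S. \<Sum>v\<in>?S. res N w (A (t0 + h)) x u *
      of_real ((A (t0 + h) u v - A t0 u v) / h) * res N w (A t0) v y)) \<longlongrightarrow> - ?D) (at 0)"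
    by (intro tendsto_intros cR dq) auto
  then have "((\<lambda>h. (1 / h) *\<^sub>R (res N w (A (t0 + h)) x y - res N w (A t0) x y)) \<longlongrightarrow> - ?D) (at 0)"
  proof (rule Lim_transform_eventually)
    show "\<forall>\<^sub>F h in at 0. - (\<Sum>u\<in>?S. \<Sum>v\<in>?S. res N w (A (t0 + h)) x u *
      of_real ((A (t0 + h) u v - A t0 u v) / h) * res N w (A t0) v y) =
       (1 / h) *\<^sub>R (res N w (A (t0 + h)) x y - res N w (A t0) x y)"
      unfolding res_identity[OF A A x y] scaleR_conv_of_real
      by (auto simp: sum_distrib_left intro!: always_eventually sum.cong)
  qed
  then have "((\<lambda>h. norm ((1 / h) *\<^sub>R (res N w (A (t0 + h)) x y - res N w (A t0) x y) - (- ?D))) \<longlongrightarrow> 0) (at 0)"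
    by (simp only: LIM_zero_iff tendsto_norm_zero_iff)
  then have "((\<lambda>h. norm (res N w (A (t0 + h)) x y - res N w (A t0) x y - h *\<^sub>R (- ?D)) / norm h) \<longlongrightarrow> 0) (at 0)"
  proof (rule Lim_transform_eventually)
    have "norm ((1 / h) *\<^sub>R a - b) = norm (a - h *\<^sub>R b) / norm h" if "h \<noteq> 0" for h :: real and a b :: complex
    proof -
      have "(1 / h) *\<^sub>R a - b = (1 / h) *\<^sub>R (a - h *\<^sub>R b)" using that by (simp add: scaleR_diff_right)
      then show ?thesis by (simp add: divide_inverse)
    qed
    then show "\<forall>\<^sub>F h in at 0. norm ((1 / h) *\<^sub>R (res N w (A (t0 + h)) x y - res N w (A t0) x y) - (- ?D)) =
      norm (res N w (A (t0 + h)) x y - res N w (A t0) x y - h *\<^sub>R (- ?D)) / norm h"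
      unfolding eventually_at_filter by (intro always_eventually allI impI)
  qed
  then show ?thesis
    unfolding has_vector_derivative_def has_derivative_at
    by (intro conjI bounded_linear_scaleR_left)
qed

end

section \<open>Averaging over the diagonal\<close>

text \<open>The rank-one perturbation A + s e_x e_x^T, through which a diagonal Gaussian
  enters.\<close>

definition bump :: "(nat \<Rightarrow> nat \<Rightarrow> real) \<Rightarrow> nat \<Rightarrow> real \<Rightarrow> nat \<Rightarrow> nat \<Rightarrow> real" where
  "bump A x s = (\<lambda>u v. A u v + (if u = x \<and> v = x then s else 0))"

lemma sym_on_bump: "sym_on N A \<Longrightarrow> sym_on N (bump A x s)"
  by (auto simp: sym_on_def bump_def)

definition minor2 :: "nat \<Rightarrow> complex \<Rightarrow> (nat \<Rightarrow> nat \<Rightarrow> real) \<Rightarrow> nat \<Rightarrow> nat \<Rightarrow> complex" where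
  "minor2 N w A x y = res N w A x x * res N w A y y - (res N w A x y)\<^sup>2"

lemma minor2_sym: "minor2 N w A x y = minor2 N w A y x"
  by (simp add: minor2_def res_sym[of N w A x y] mult.commute)

context
  fixes N :: nat and w :: complex and A :: "nat \<Rightarrow> nat \<Rightarrow> real" and x :: nat
  assumes w: "Im w > 0" and A: "sym_on N A" and x: "x \<in> {1..N}"
begin

text \<open>Resolvent identity for a rank-one difference. Solving it for the perturbed entries gives
  the Sherman-Morrison formulas that follow.\<close>

lemma res_bump_diff:
  assumes i: "i \<in> {1..N}" and j: "j \<in> {1..N}"
  shows "res N w (bump A x s) i j - res N w A i j = - of_real s * res N w (bump A x s) i x * res N w A x j"
proof -
  have "(\<Sum>u=1..N. \<Sum>v=1..N. res N w (bump A x s) i u * of_real (bump A x s u v - A u v) * res N w A v j)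
     = (\<Sum>u=1..N. \<Sum>v=1..N. if v = x then if u = x then
          of_real s * res N w (bump A x s) i x * res N w A x j else 0 else 0)"
    by (intro sum.cong refl) (auto simp: bump_def)
  also have "\<dots> = of_real s * res N w (bump A x s) i x * res N w A x j" using x by simp
  finally show ?thesis
    unfolding res_identity[OF w A sym_on_bump[OF A] i j] by simp
qed

lemma res_diag_nonzero: "res N w A x x \<noteq> 0"
  using Im_res_pos[OF w A x] by auto

lemma res_bump_column:
  assumes i: "i \<in> {1..N}"
  shows "res N w (bump A x s) i x * (1 + of_real s * res N w A x x) = res N w A i x"
  using res_bump_diff[OF i x, of s] by (simp add: algebra_simps)

lemma bump_denom_nonzero: "1 + of_real s * res N w A x x \<noteq> 0"
  using res_bump_column[OF x, of s] res_diag_nonzero by auto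

lemma res_bump_diag: "res N w (bump A x s) x x = res N w A x x / (1 + of_real s * res N w A x x)"
  using res_bump_column[OF x, of s] bump_denom_nonzero[of s] by (simp add: field_simps)

lemma res_bump_offdiag:
  assumes y: "y \<in> {1..N}"
  shows "res N w (bump A x s) x y = res N w A x y / (1 + of_real s * res N w A x x)"
  using res_bump_column[OF y, of s] bump_denom_nonzero[of s] by (simp add: field_simps res_sym)

lemma res_bump_other:
  assumes y: "y \<in> {1..N}"
  shows "res N w (bump A x s) y y = (res N w A y y + of_real s * minor2 N w A x y) / (1 + of_real s * res N w A x x)"
proof -
  have "res N w (bump A x s) y y = res N w A y y - of_real s * res N w (bump A x s) x y * res N w A x y"
    using res_bump_diff[OF y y, of s] by (simp add: algebra_simps res_sym[of N w _ y x])
  then show ?thesis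
    unfolding res_bump_offdiag[OF y] minor2_def using bump_denom_nonzero[of s]
    by (simp add: field_simps power2_eq_square)
qed

text \<open>The squared denominator loses one factor. Behind this is Jacobi's formula: for distinct
  x and y the minor is det(A - w without rows and columns x, y) / det(A - w), and a change of the
  entry at x affects only the lower determinant.\<close>

lemma minor2_bump:
  assumes y: "y \<in> {1..N}"
  shows "minor2 N w (bump A x s) x y = minor2 N w A x y / (1 + of_real s * res N w A x x)"
proof -
  let ?d = "1 + of_real s * res N w A x x"
  have "minor2 N w (bump A x s) x y =
    (res N w A x x * (res N w A y y + of_real s * minor2 N w A x y) - (res N w A x y)\<^sup>2) / ?d\<^sup>2"
    unfolding minor2_def[of N w "bump A x s"] res_bump_diag res_bump_offdiag[OF y] res_bump_other[OF y]
    by (simp add: power2_eq_square diff_divide_distrib)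
  also have "res N w A x x * (res N w A y y + of_real s * minor2 N w A x y) - (res N w A x y)\<^sup>2
      = minor2 N w A x y * ?d"
    by (simp add: minor2_def algebra_simps power2_eq_square)
  finally show ?thesis using bump_denom_nonzero[of s] by (simp add: power2_eq_square)
qed

text \<open>This quotient is the entry at y of the resolvent of A with row and column x removed.\<close>

lemma Im_minor2_div_ge:
  assumes y: "y \<in> {1..N}" and xy: "x \<noteq> y"
  shows "Im w * (cmod (minor2 N w A x y / res N w A x x))\<^sup>2 \<le> Im (minor2 N w A x y / res N w A x x)"
proof -
  let ?S = "{1..N}"
  let ?M = "\<lambda>u v. complex_of_real (A u v) - (if u = v then w else 0)"
  define r where "r = res N w A x y / res N w A x x"
  \<comment> \<open>Column y of R, cleared of its entry at x by a multiple of column x. Outside x it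
    solves (A - w) u = e_y, and its entry at y is the quotient in question.\<close>
  define u where "u z = res N w A z y - r * res N w A z x" for z
  have ux: "u x = 0" using res_diag_nonzero by (simp add: u_def r_def)
  have uy: "u y = minor2 N w A x y / res N w A x x"
    using res_diag_nonzero by (simp add: u_def r_def minor2_def field_simps power2_eq_square res_sym[of N w A y x])
  have Mu: "(\<Sum>z\<in>?S. ?M i z * u z) = (if i = y then 1 else 0) - r * (if i = x then 1 else 0)" if "i \<in> ?S" for i
  proof -
    have "(\<Sum>z\<in>?S. ?M i z * u z) = (\<Sum>z\<in>?S. ?M i z * res N w A z y) - r * (\<Sum>z\<in>?S. ?M i z * res N w A z x)"
      unfolding u_def sum_distrib_left sum_subtractf[symmetric]
      by (intro sum.cong refl) (simp add: algebra_simps)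
    then show ?thesis unfolding res_left_inverse[OF w A that y] res_left_inverse[OF w A that x] .
  qed
  define E where "E = (\<Sum>i\<in>?S. \<Sum>z\<in>?S. cnj (u i) * of_real (A i z) * u z)"
  have "cnj E = (\<Sum>i\<in>?S. \<Sum>z\<in>?S. cnj (u z) * of_real (A i z) * u i)"
    unfolding E_def by (simp add: mult_ac)
  also have "\<dots> = E"
    unfolding E_def by (subst sum.swap) (use A in \<open>auto simp: sym_on_def intro!: sum.cong\<close>)
  finally have E: "Im E = 0" by (simp add: complex_eq_iff)
  \<comment> \<open>Pairing (A - w) u = e_y - r e_x with the conjugate of u: the term with r drops
    because u vanishes at x. Since E is real, the imaginary part leaves only Im w times the squared
    norm of u.\<close>
  have "(\<Sum>i\<in>?S. cnj (u i) * (\<Sum>z\<in>?S. ?M i z * u z)) = (\<Sum>i\<in>?S. if i = y then cnj (u i) else 0)"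
    by (intro sum.cong refl) (use Mu ux in auto)
  also have "\<dots> = cnj (u y)" using y by simp
  finally have "cnj (u y) = (\<Sum>i\<in>?S. cnj (u i) * (\<Sum>z\<in>?S. ?M i z * u z))" by simp
  also have "\<dots> = E - (\<Sum>i\<in>?S. \<Sum>z\<in>?S. if i = z then cnj (u i) * w * u z else 0)"
    unfolding E_def sum_subtractf[symmetric] sum_distrib_left
    by (intro sum.cong refl) (auto simp: algebra_simps)
  also have "(\<Sum>i\<in>?S. \<Sum>z\<in>?S. if i = z then cnj (u i) * w * u z else 0) = w * of_real (\<Sum>i\<in>?S. (cmod (u i))\<^sup>2)"
    unfolding of_real_sum complex_norm_square sum_distrib_left
    by (auto intro!: sum.cong)
  finally have "cnj (u y) = E - w * of_real (\<Sum>i\<in>?S. (cmod (u i))\<^sup>2)" .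
  then have "Im (cnj (u y)) = - (Im w * (\<Sum>i\<in>?S. (cmod (u i))\<^sup>2))" using E by simp
  then have "Im (u y) = Im w * (\<Sum>i\<in>?S. (cmod (u i))\<^sup>2)" by simp
  moreover have "(cmod (u y))\<^sup>2 \<le> (\<Sum>i\<in>?S. (cmod (u i))\<^sup>2)" using y by (intro member_le_sum) auto
  ultimately have "Im w * (cmod (u y))\<^sup>2 \<le> Im (u y)" using w by simp
  then show ?thesis by (simp only: uy)
qed

end

section \<open>Averages over a single Gaussian coordinate\<close>

abbreviation gauss :: "real measure" where
  "gauss \<equiv> density lborel std_normal_density"

abbreviation gaussP :: "'k set \<Rightarrow> ('k \<Rightarrow> real) measure" where
  "gaussP D \<equiv> PiM D (\<lambda>_. gauss)"

lemma std_normal_density_le_1: "std_normal_density x \<le> 1"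
proof -
  have "1 \<le> sqrt (2 * pi)" using pi_gt3 by simp
  then show ?thesis by (auto simp: std_normal_density_def divide_le_eq intro: order_trans[of _ 1])
qed

lemma nn_integral_inverse_near_0:
  assumes "0 < e"
  shows "(\<integral>\<^sup>+ s. ennreal (2 / (e + \<bar>s\<bar>)) * indicator {-1..1} s \<partial>lborel) \<le> ennreal (4 * ln (1 + 1 / e))"
proof -
  have ft: "(\<integral>\<^sup>+ s. ennreal (2 / (e + s)) * indicator {0..1} s \<partial>lborel) = ennreal (2 * ln (e + 1) - 2 * ln (e + 0))"
    by (rule nn_integral_FTC_Icc)
      (use assms in \<open>auto intro!: derivative_eq_intros simp: has_real_derivative_iff_has_vector_derivative[symmetric]\<close>)
  have mirror: "(\<integral>\<^sup>+ s. ennreal (2 / (e - s)) * indicator {-1..0} s \<partial>lborel)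
      = (\<integral>\<^sup>+ s. ennreal (2 / (e + s)) * indicator {0..1} s \<partial>lborel)"
    by (subst nn_integral_real_affine[of _ "-1" 0]) (auto simp: indicator_def intro!: nn_integral_cong)
  have "(\<integral>\<^sup>+ s. ennreal (2 / (e + \<bar>s\<bar>)) * indicator {-1..1} s \<partial>lborel)
      \<le> (\<integral>\<^sup>+ s. ennreal (2 / (e - s)) * indicator {-1..0} s + ennreal (2 / (e + s)) * indicator {0..1} s \<partial>lborel)"
    by (intro nn_integral_mono) (auto simp: indicator_def)
  also have "\<dots> = (\<integral>\<^sup>+ s. ennreal (2 / (e - s)) * indicator {-1..0} s \<partial>lborel)
      + (\<integral>\<^sup>+ s. ennreal (2 / (e + s)) * indicator {0..1} s \<partial>lborel)"
    by (rule nn_integral_add) measurable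
  also have "\<dots> = ennreal (2 * ln (e + 1) - 2 * ln (e + 0)) + ennreal (2 * ln (e + 1) - 2 * ln (e + 0))"
    unfolding mirror ft ..
  also have "\<dots> = ennreal (4 * ln (1 + 1 / e))"
  proof -
    have "1 + 1 / e = (e + 1) / e" using assms by (simp add: field_simps)
    then have "4 * ln (1 + 1 / e) = (2 * ln (e + 1) - 2 * ln (e + 0)) + (2 * ln (e + 1) - 2 * ln (e + 0))"
      using assms by (simp add: ln_div)
    moreover have "0 \<le> 2 * ln (e + 1) - 2 * ln (e + 0)" using assms by simp
    ultimately show ?thesis by (simp only: ennreal_plus)
  qed
  finally show ?thesis .
qed

text \<open>The fraction is 1 / (s + 1/q), and |s + 1/q| is at least both |s + Re (1/q)| and e.
  Where |s + Re (1/q)| > 1 it is at most 1; elsewhere it is at most 2 / (e + |s + Re (1/q)|), whose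
  integral is logarithmic because the density is at most 1.\<close>

lemma gauss_average_fraction:
  assumes e: "0 < e" and q: "e * (cmod q)\<^sup>2 \<le> Im q"
  shows "(\<integral>\<^sup>+ s. ennreal (cmod (q / (1 + of_real s * q))) \<partial>gauss) \<le> ennreal (1 + 4 * ln (1 + 1 / e))"
proof (cases "q = 0")
  case True
  then show ?thesis by simp
next
  case False
  define b where "b = Re (1 / q)"
  have "\<bar>Im (1 / q)\<bar> = \<bar>Im q\<bar> / (cmod q)\<^sup>2" by (simp add: Im_divide cmod_power2)
  moreover have "e \<le> \<bar>Im q\<bar> / (cmod q)\<^sup>2"
    using q False by (simp add: le_divide_eq) 
  ultimately have Im: "e \<le> \<bar>Im (1 / q)\<bar>" by simp
  have pt: "cmod (q / (1 + of_real s * q)) \<le> 1 + 2 / (e + \<bar>b + s\<bar>) * indicator {-1..1} (b + s)" for s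
  proof -
    have "q / (1 + of_real s * q) = 1 / (of_real s + 1 / q)" using False by (simp add: field_simps)
    then have c: "cmod (q / (1 + of_real s * q)) = 1 / cmod (of_real s + 1 / q)" by (simp add: norm_divide)
    have 1: "\<bar>b + s\<bar> \<le> cmod (of_real s + 1 / q)"
      using abs_Re_le_cmod[of "of_real s + 1 / q"] by (simp add: b_def add.commute)
    have 2: "e \<le> cmod (of_real s + 1 / q)"
      using abs_Im_le_cmod[of "of_real s + 1 / q"] Im by simp
    show ?thesis
    proof (cases "\<bar>b + s\<bar> \<le> 1")
      case True
      have "1 / cmod (of_real s + 1 / q) \<le> 2 / (e + \<bar>b + s\<bar>)"
        using frac_le[of 2 2 "e + \<bar>b + s\<bar>" "2 * cmod (of_real s + 1 / q)"] 1 2 e by simp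
      with True show ?thesis unfolding c by (simp add: indicator_def abs_le_iff)
    next
      case False
      then have "1 / cmod (of_real s + 1 / q) \<le> 1" using 1 by (simp add: divide_le_eq)
      then show ?thesis unfolding c using e by (intro add_increasing2) (auto simp: indicator_def)
    qed
  qed
  have "(\<integral>\<^sup>+ s. ennreal (cmod (q / (1 + of_real s * q))) \<partial>gauss)
      = (\<integral>\<^sup>+ s. ennreal (std_normal_density s) * ennreal (cmod (q / (1 + of_real s * q))) \<partial>lborel)"
    by (subst nn_integral_density) auto
  also have "\<dots> \<le> (\<integral>\<^sup>+ s. ennreal (std_normal_density s) + ennreal (2 / (e + \<bar>b + s\<bar>)) * indicator {-1..1} (b + s) \<partial>lborel)"
  proof (intro nn_integral_mono)
    fix s :: real
    have "ennreal (std_normal_density s) * ennreal (cmod (q / (1 + of_real s * q)))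
       \<le> ennreal (std_normal_density s) * ennreal (1 + 2 / (e + \<bar>b + s\<bar>) * indicator {-1..1} (b + s))"
      using pt by (intro mult_left_mono ennreal_leI) auto
    also have "\<dots> = ennreal (std_normal_density s) +
        ennreal (std_normal_density s * (2 / (e + \<bar>b + s\<bar>) * indicator {-1..1} (b + s)))"
      using e by (simp add: ennreal_mult'[symmetric] ennreal_plus[symmetric] algebra_simps del: ennreal_plus)
    also have "\<dots> \<le> ennreal (std_normal_density s) + ennreal (1 * (2 / (e + \<bar>b + s\<bar>) * indicator {-1..1} (b + s)))"
      using e by (intro add_left_mono ennreal_leI mult_right_mono std_normal_density_le_1) auto
    also have "\<dots> = ennreal (std_normal_density s) + ennreal (2 / (e + \<bar>b + s\<bar>)) * indicator {-1..1} (b + s)"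
      by (auto simp: indicator_def)
    finally show "ennreal (std_normal_density s) * ennreal (cmod (q / (1 + of_real s * q)))
      \<le> ennreal (std_normal_density s) + ennreal (2 / (e + \<bar>b + s\<bar>)) * indicator {-1..1} (b + s)" .
  qed
  also have "\<dots> = (\<integral>\<^sup>+ s. ennreal (std_normal_density s) \<partial>lborel)
      + (\<integral>\<^sup>+ s. ennreal (2 / (e + \<bar>b + s\<bar>)) * indicator {-1..1} (b + s) \<partial>lborel)"
    by (rule nn_integral_add) auto
  also have "(\<integral>\<^sup>+ s. ennreal (std_normal_density s) \<partial>lborel) = 1"
    using prob_space.emeasure_space_1[OF prob_space_normal_density[of 1 0]] by (simp add: emeasure_density)
  also have "(\<integral>\<^sup>+ s. ennreal (2 / (e + \<bar>b + s\<bar>)) * indicator {-1..1} (b + s) \<partial>lborel)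
     = (\<integral>\<^sup>+ s. ennreal (2 / (e + \<bar>s\<bar>)) * indicator {-1..1} s \<partial>lborel)"
    using nn_integral_real_affine[of "\<lambda>s. ennreal (2 / (e + \<bar>s\<bar>)) * indicator {-1..1} s" 1 b] by simp
  also have "1 + \<dots> \<le> 1 + ennreal (4 * ln (1 + 1 / e))"
    by (intro add_left_mono nn_integral_inverse_near_0 e)
  also have "\<dots> = ennreal (1 + 4 * ln (1 + 1 / e))" using e by (simp add: ennreal_plus)
  finally show ?thesis .
qed

text \<open>Reduction to k q, which satisfies the hypothesis with e / k. In the application k is
  \<open>sqrt 2\<close>, the coefficient of a diagonal Gaussian of level 0.\<close>

lemma gauss_average_scaled_fraction:
  assumes k: "1 \<le> k" and e: "0 < e" and q: "e * (cmod q)\<^sup>2 \<le> Im q"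
  shows "(\<integral>\<^sup>+ s. ennreal (cmod (q / (1 + of_real (k * s) * q))) \<partial>gauss) \<le> ennreal (1 + 4 * ln (1 + k / e))"
proof -
  let ?q = "of_real k * q"
  have "(\<integral>\<^sup>+ s. ennreal (cmod (q / (1 + of_real (k * s) * q))) \<partial>gauss)
     \<le> (\<integral>\<^sup>+ s. ennreal (cmod (?q / (1 + of_real s * ?q))) \<partial>gauss)"
  proof (intro nn_integral_mono ennreal_leI)
    fix s
    have "cmod (q / (1 + of_real (k * s) * q)) \<le> k * cmod (q / (1 + of_real (k * s) * q))"
      using k by (simp add: mult_le_cancel_right1)
    also have "\<dots> = cmod (?q / (1 + of_real s * ?q))"
      using k by (simp add: norm_mult norm_divide mult_ac)
    finally show "cmod (q / (1 + of_real (k * s) * q)) \<le> cmod (?q / (1 + of_real s * ?q))" .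
  qed
  also have "\<dots> \<le> ennreal (1 + 4 * ln (1 + 1 / (e / k)))"
  proof (rule gauss_average_fraction)
    have "k * (e * (cmod q)\<^sup>2) \<le> k * Im q" using k q by (intro mult_left_mono) auto
    then show "e / k * (cmod ?q)\<^sup>2 \<le> Im ?q"
      using k by (simp add: norm_mult power_mult_distrib power2_eq_square field_simps)
  qed (use k e in auto)
  finally show ?thesis by simp
qed

interpretation gauss: prob_space gauss
  by (rule prob_space_normal_density) simp

interpretation gauss_prod: product_prob_space "\<lambda>_. gauss" I for I
  by standard

lemma nn_integral_PiM_coordinate:
  assumes "finite I" "i \<in> I" "f \<in> borel_measurable (gaussP I)"
  shows "(\<integral>\<^sup>+ a. f a \<partial>gaussP I)
    = (\<integral>\<^sup>+ a. (\<integral>\<^sup>+ s. f (a(i := s)) \<partial>gauss) \<partial>gaussP (I - {i}))"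
  using gauss_prod.product_nn_integral_insert[of "I - {i}" i f] assms by (simp add: insert_absorb)

lemma nn_integral_PiM_coordinate_le:
  assumes "finite I" "i \<in> I" "f \<in> borel_measurable (gaussP I)"
    and "\<And>a. (\<integral>\<^sup>+ s. f (a(i := s)) \<partial>gauss) \<le> C"
  shows "(\<integral>\<^sup>+ a. f a \<partial>gaussP I) \<le> C"
proof -
  have "(\<integral>\<^sup>+ a. f a \<partial>gaussP I) \<le> (\<integral>\<^sup>+ a. C \<partial>gaussP (I - {i}))"
    unfolding nn_integral_PiM_coordinate[OF assms(1-3)] by (intro nn_integral_mono assms(4))
  also have "\<dots> = C" 
    by (simp add: gauss_prod.emeasure_space_1)
  finally show ?thesis .
qed

section \<open>Averaged diagonal entries and minors of the resolvent\<close>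

context
  fixes N :: nat and w :: complex and A :: "('k \<Rightarrow> real) \<Rightarrow> nat \<Rightarrow> nat \<Rightarrow> real"
    and I :: "'k set" and k :: real and i :: 'k and x :: nat
  assumes w: "Im w > 0" and k: "1 \<le> k" and A: "\<And>a. sym_on N (A a)"
    and meas: "\<And>u v. u \<in> {1..N} \<Longrightarrow> v \<in> {1..N} \<Longrightarrow> (\<lambda>a. A a u v) \<in> borel_measurable (gaussP I)"
    and I: "finite I" "i \<in> I" and x: "x \<in> {1..N}"
    and bump_i: "\<And>a s. A (a(i := s)) = bump (A (a(i := 0))) x (k * s)"
begin

lemma measurable_res_A:
  assumes "u \<in> {1..N}" "v \<in> {1..N}"
  shows "(\<lambda>a. res N w (A a) u v) \<in> borel_measurable (gaussP I)"
  by (intro borel_measurable_res w A meas assms)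

lemma average_res_diag:
  "(\<integral>\<^sup>+ a. ennreal (cmod (res N w (A a) x x)) \<partial>gaussP I) \<le> ennreal (1 + 4 * ln (1 + k / Im w))"
proof (rule nn_integral_PiM_coordinate_le[OF I])
  show "(\<lambda>a. ennreal (cmod (res N w (A a) x x))) \<in> borel_measurable (gaussP I)"
    using measurable_res_A[OF x x] by measurable
  show "(\<integral>\<^sup>+ s. ennreal (cmod (res N w (A (a(i := s))) x x)) \<partial>gauss) \<le> ennreal (1 + 4 * ln (1 + k / Im w))" for a
  proof -
    define q where "q = res N w (A (a(i := 0))) x x"
    have "res N w (A (a(i := s))) x x = q / (1 + of_real (k * s) * q)" for s
      unfolding q_def by (subst bump_i) (rule res_bump_diag[OF w A x])
    then show ?thesis
      using gauss_average_scaled_fraction[OF k w Im_res_ge[OF w A x, of "a(i := 0)"], folded q_def] by simp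
  qed
qed

text \<open>A Minami-type bound: integrating first over the diagonal entry at x leaves the resolvent
  with x removed, to which the entry at y can be applied in turn.\<close>

lemma average_minor2:
  assumes j: "j \<in> I" "j \<noteq> i" and y: "y \<in> {1..N}" "x \<noteq> y"
    and bump_j: "\<And>a s. A (a(j := s)) = bump (A (a(j := 0))) y (k * s)"
  shows "(\<integral>\<^sup>+ a. ennreal (cmod (minor2 N w (A a) x y)) \<partial>gaussP I) \<le> ennreal ((1 + 4 * ln (1 + k / Im w))\<^sup>2)"
proof -
  let ?L = "1 + 4 * ln (1 + k / Im w)"
  have L: "0 \<le> ?L" using k w by simp
  define g where "g a = cmod (minor2 N w (A (a(i := 0))) x y / res N w (A (a(i := 0))) x x)" for a
  have g: "0 \<le> g a" for a by (simp add: g_def)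
  have m: "(\<lambda>a. ennreal (cmod (minor2 N w (A a) x y))) \<in> borel_measurable (gaussP I)"
    unfolding minor2_def
    using measurable_res_A[OF x x] measurable_res_A[OF x y(1)] measurable_res_A[OF y(1) y(1)] by measurable
  have upd: "(\<lambda>a. a(i := 0)) \<in> measurable (gaussP (I - {i})) (gaussP I)"
    using I(2) measurable_add_dim[of i "I - {i}" "\<lambda>_. gauss"]
    by (intro measurable_fun_upd[where J = "I - {i}"]) auto
  have mg: "(\<lambda>a. ennreal (g a)) \<in> borel_measurable (gaussP (I - {i}))"
    unfolding minor2_def g_def
    using measurable_compose[OF upd measurable_res_A[OF x x]] measurable_compose[OF upd measurable_res_A[OF x y(1)]]
      measurable_compose[OF upd measurable_res_A[OF y(1) y(1)]] by measurable
  have "(\<integral>\<^sup>+ a. ennreal (cmod (minor2 N w (A a) x y)) \<partial>gaussP I)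
     = (\<integral>\<^sup>+ a. (\<integral>\<^sup>+ s. ennreal (cmod (minor2 N w (A (a(i := s))) x y)) \<partial>gauss) \<partial>gaussP (I - {i}))"
    by (rule nn_integral_PiM_coordinate[OF I m])
  also have "\<dots> \<le> (\<integral>\<^sup>+ a. ennreal ?L * ennreal (g a) \<partial>gaussP (I - {i}))"
  proof (intro nn_integral_mono)
    fix a
    let ?B = "A (a(i := 0))" and ?r = "res N w (A (a(i := 0))) x x"
    have "cmod (minor2 N w (A (a(i := s))) x y) = g a * cmod (?r / (1 + of_real (k * s) * ?r))" for s
      by (subst bump_i, subst minor2_bump[OF w A x y(1)], unfold g_def)
        (simp add: norm_mult norm_divide res_diag_nonzero[OF w A x])
    then have "(\<integral>\<^sup>+ s. ennreal (cmod (minor2 N w (A (a(i := s))) x y)) \<partial>gauss)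
        = (\<integral>\<^sup>+ s. ennreal (g a) * ennreal (cmod (?r / (1 + of_real (k * s) * ?r))) \<partial>gauss)"
      by (simp only: ennreal_mult'[OF g])
    also have "\<dots> = ennreal (g a) * (\<integral>\<^sup>+ s. ennreal (cmod (?r / (1 + of_real (k * s) * ?r))) \<partial>gauss)"
      by (rule nn_integral_cmult) auto
    also have "\<dots> \<le> ennreal (g a) * ennreal ?L"
      by (intro mult_left_mono gauss_average_scaled_fraction[OF k w Im_res_ge[OF w A x]]) auto
    finally show "(\<integral>\<^sup>+ s. ennreal (cmod (minor2 N w (A (a(i := s))) x y)) \<partial>gauss) \<le> ennreal ?L * ennreal (g a)"
      by (simp add: mult.commute)
  qed
  also have "\<dots> = ennreal ?L * (\<integral>\<^sup>+ a. ennreal (g a) \<partial>gaussP (I - {i}))"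
    by (rule nn_integral_cmult) (rule mg)
  also have "\<dots> \<le> ennreal ?L * ennreal ?L"
  proof (intro mult_left_mono nn_integral_PiM_coordinate_le[where i = j] mg)
    fix a
    let ?B = "A (a(i := 0, j := 0))"
    let ?q = "minor2 N w ?B x y / res N w ?B x x"
    \<comment> \<open>Bumping the entry at y divides the minor and R_xx by the same denominator,
      which cancels. What remains is again a fraction q / (1 + k s q), now with q the resolvent
      entry after removal of x.\<close>
    have "g (a(j := s)) = cmod (?q / (1 + of_real (k * s) * ?q))" for s
    proof -
      have "(a(j := s))(i := 0) = (a(i := 0))(j := s)" using j(2) by auto
      then have "A ((a(j := s))(i := 0)) = bump ?B y (k * s)" using bump_j by metis
      then have "g (a(j := s)) = cmod (minor2 N w (bump ?B y (k * s)) y x / res N w (bump ?B y (k * s)) x x)"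
        by (simp add: g_def minor2_sym)
      also have "\<dots> = cmod (minor2 N w ?B x y / (res N w ?B x x + of_real (k * s) * minor2 N w ?B x y))"
        unfolding minor2_bump[OF w A y(1) x] res_bump_other[OF w A y(1) x]
        using bump_denom_nonzero[OF w A y(1), of "k * s" "a(i := 0, j := 0)"]
        by (simp add: minor2_sym[of N w _ y x])
      also have "\<dots> = cmod (?q / (1 + of_real (k * s) * ?q))"
        using res_diag_nonzero[OF w A x] by (simp add: divide_simps) 
      finally show ?thesis .
    qed
    then show "(\<integral>\<^sup>+ s. ennreal (g (a(j := s))) \<partial>gauss) \<le> ennreal ?L"
      using gauss_average_scaled_fraction[OF k w Im_minor2_div_ge[OF w A x y]] by simp
  qed (use I j in auto)
  also have "\<dots> = ennreal (?L\<^sup>2)" using L by (simp add: ennreal_mult'' power2_eq_square)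
  finally show ?thesis .
qed

end

section \<open>Gaussian interpolation\<close>

lemma nn_integral_shear:
  fixes f :: "real \<times> real \<Rightarrow> ennreal" and t :: real
  assumes [measurable]: "f \<in> borel_measurable (borel \<Otimes>\<^sub>M borel)"
  shows "(\<integral>\<^sup>+ x. (\<integral>\<^sup>+ y. f (x + t * y, y) \<partial>lborel) \<partial>lborel) = (\<integral>\<^sup>+ x. (\<integral>\<^sup>+ y. f (x, y) \<partial>lborel) \<partial>lborel)"
    (is ?fst)
    and "(\<integral>\<^sup>+ x. (\<integral>\<^sup>+ y. f (x, y + t * x) \<partial>lborel) \<partial>lborel) = (\<integral>\<^sup>+ x. (\<integral>\<^sup>+ y. f (x, y) \<partial>lborel) \<partial>lborel)"
    (is ?snd)
proof -
  have shift: "(\<integral>\<^sup>+ x. h (x + c) \<partial>lborel) = (\<integral>\<^sup>+ x. h x \<partial>lborel)"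
    if [measurable]: "h \<in> borel_measurable borel" for h :: "real \<Rightarrow> ennreal" and c
    using nn_integral_real_affine[of h 1 c] by (simp add: add.commute)
  have "(\<integral>\<^sup>+ x. (\<integral>\<^sup>+ y. f (x + t * y, y) \<partial>lborel) \<partial>lborel) = (\<integral>\<^sup>+ y. (\<integral>\<^sup>+ x. f (x + t * y, y) \<partial>lborel) \<partial>lborel)"
    by (rule lborel_pair.Fubini'[symmetric]) measurable
  also have "\<dots> = (\<integral>\<^sup>+ y. (\<integral>\<^sup>+ x. f (x, y) \<partial>lborel) \<partial>lborel)"
    by (intro nn_integral_cong shift[of "\<lambda>x. f (x, _)"]) measurable
  also have "\<dots> = (\<integral>\<^sup>+ x. (\<integral>\<^sup>+ y. f (x, y) \<partial>lborel) \<partial>lborel)"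
    by (rule lborel_pair.Fubini') measurable
  finally show ?fst .
  show ?snd
    by (intro nn_integral_cong shift[of "\<lambda>y. f (_, y)"]) measurable
qed

text \<open>A rotation other than by a half turn is a product of three shears.\<close>

lemma nn_integral_lborel_rotate:
  assumes cs: "c\<^sup>2 + s\<^sup>2 = (1::real)" and c: "c \<noteq> - 1"
    and [measurable]: "f \<in> borel_measurable (borel \<Otimes>\<^sub>M borel)"
  shows "(\<integral>\<^sup>+ x. (\<integral>\<^sup>+ y. f (c * x + s * y, - s * x + c * y) \<partial>lborel) \<partial>lborel)
    = (\<integral>\<^sup>+ x. (\<integral>\<^sup>+ y. f (x, y) \<partial>lborel) \<partial>lborel)"
proof -
  \<comment> \<open>The tangent of half the angle. The shears are by t, - s and t; the excluded
    value c = -1 is exactly where t is undefined.\<close>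
  define t where "t = s / (1 + c)"
  have c1: "1 + c \<noteq> 0" using c by (metis add.inverse_inverse add_eq_0_iff)
  have "s * s = (1 - c) * (1 + c)" using cs by (simp add: power2_eq_square algebra_simps)
  then have ts: "t * s = 1 - c" using c1 by (simp add: t_def)
  have tc: "t * (1 + c) = s" using c1 by (simp add: t_def)
  define f1 where "f1 = (\<lambda>(x, y). f (x + t * y, y))"
  define f2 where "f2 = (\<lambda>(x, y). f1 (x, y + (- s) * x))"
  have [measurable]: "f1 \<in> borel_measurable (borel \<Otimes>\<^sub>M borel)" "f2 \<in> borel_measurable (borel \<Otimes>\<^sub>M borel)"
    unfolding f1_def f2_def by measurable
  have "f2 (x + t * y, y) = f (c * x + s * y, - s * x + c * y)" for x y
  proof -
    have "x + t * y + t * (y + - s * (x + t * y)) = x * (1 - t * s) + y * (t * (1 + (1 - t * s)))"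
      by (simp add: algebra_simps)
    also have "\<dots> = c * x + s * y" unfolding ts using tc by (simp add: algebra_simps)
    finally have 1: "x + t * y + t * (y + - s * (x + t * y)) = c * x + s * y" .
    have "y + - s * (x + t * y) = - s * x + (1 - t * s) * y" by (simp add: algebra_simps)
    also have "\<dots> = - s * x + c * y" unfolding ts by simp
    finally have 2: "y + - s * (x + t * y) = - s * x + c * y" .
    show ?thesis unfolding f2_def f1_def case_prod_conv 1 unfolding 2 ..
  qed
  then have "(\<integral>\<^sup>+ x. (\<integral>\<^sup>+ y. f (c * x + s * y, - s * x + c * y) \<partial>lborel) \<partial>lborel)
      = (\<integral>\<^sup>+ x. (\<integral>\<^sup>+ y. f2 (x + t * y, y) \<partial>lborel) \<partial>lborel)" by simp
  also have "\<dots> = (\<integral>\<^sup>+ x. (\<integral>\<^sup>+ y. f2 (x, y) \<partial>lborel) \<partial>lborel)" by (rule nn_integral_shear) measurable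
  also have "\<dots> = (\<integral>\<^sup>+ x. (\<integral>\<^sup>+ y. f1 (x, y + (- s) * x) \<partial>lborel) \<partial>lborel)" by (simp add: f2_def)
  also have "\<dots> = (\<integral>\<^sup>+ x. (\<integral>\<^sup>+ y. f1 (x, y) \<partial>lborel) \<partial>lborel)" by (rule nn_integral_shear) measurable
  also have "\<dots> = (\<integral>\<^sup>+ x. (\<integral>\<^sup>+ y. f (x + t * y, y) \<partial>lborel) \<partial>lborel)" by (simp add: f1_def)
  also have "\<dots> = (\<integral>\<^sup>+ x. (\<integral>\<^sup>+ y. f (x, y) \<partial>lborel) \<partial>lborel)" by (rule nn_integral_shear) measurable
  finally show ?thesis .
qed

lemma nn_integral_gauss_rotate:
  assumes cs: "c\<^sup>2 + s\<^sup>2 = (1::real)" and c: "c \<noteq> - 1"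
    and [measurable]: "f \<in> borel_measurable (borel \<Otimes>\<^sub>M borel)"
  shows "(\<integral>\<^sup>+ x. (\<integral>\<^sup>+ y. f (c * x + s * y, - s * x + c * y) \<partial>gauss) \<partial>gauss)
    = (\<integral>\<^sup>+ x. (\<integral>\<^sup>+ y. f (x, y) \<partial>gauss) \<partial>gauss)"
proof -
  define F where "F = (\<lambda>(x, y). ennreal (std_normal_density x * std_normal_density y) * f (x, y))"
  have [measurable]: "F \<in> borel_measurable (borel \<Otimes>\<^sub>M borel)" unfolding F_def by measurable
  have dens: "(\<integral>\<^sup>+ x. (\<integral>\<^sup>+ y. h (x, y) \<partial>gauss) \<partial>gauss)
     = (\<integral>\<^sup>+ x. (\<integral>\<^sup>+ y. ennreal (std_normal_density x * std_normal_density y) * h (x, y) \<partial>lborel) \<partial>lborel)"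
    if [measurable]: "h \<in> borel_measurable (borel \<Otimes>\<^sub>M borel)" for h
    by (simp add: nn_integral_density nn_integral_cmult[symmetric] ennreal_mult mult.assoc)
  have "std_normal_density (c * x + s * y) * std_normal_density (- s * x + c * y)
      = std_normal_density x * std_normal_density y" for x y
  proof -
    have "(c * x + s * y)\<^sup>2 + (- s * x + c * y)\<^sup>2 = (c\<^sup>2 + s\<^sup>2) * (x\<^sup>2 + y\<^sup>2)"
      by (simp add: power2_eq_square algebra_simps)
    then have sq: "(c * x + s * y)\<^sup>2 + (- s * x + c * y)\<^sup>2 = x\<^sup>2 + y\<^sup>2" by (simp add: cs)
    have "std_normal_density a * std_normal_density b = 1 / (2 * pi) * exp (- (a\<^sup>2 + b\<^sup>2) / 2)" for a b
      by (simp add: std_normal_density_def exp_add[symmetric] add_divide_distrib diff_divide_distrib)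
    then show ?thesis by (simp only: sq)
  qed
  then have "(\<integral>\<^sup>+ x. (\<integral>\<^sup>+ y. f (c * x + s * y, - s * x + c * y) \<partial>gauss) \<partial>gauss)
      = (\<integral>\<^sup>+ x. (\<integral>\<^sup>+ y. F (c * x + s * y, - s * x + c * y) \<partial>lborel) \<partial>lborel)"
    using dens[of "\<lambda>(x, y). f (c * x + s * y, - s * x + c * y)"] by (simp add: F_def)
  also have "\<dots> = (\<integral>\<^sup>+ x. (\<integral>\<^sup>+ y. F (x, y) \<partial>lborel) \<partial>lborel)"
    by (rule nn_integral_lborel_rotate[OF cs c]) measurable
  also have "\<dots> = (\<integral>\<^sup>+ x. (\<integral>\<^sup>+ y. f (x, y) \<partial>gauss) \<partial>gauss)"
    by (simp add: dens F_def)
  finally show ?thesis .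
qed

lemma sigma_finite_gaussP: "sigma_finite_measure (gaussP D)"
  by (rule prob_space_imp_sigma_finite) (rule gauss_prod.prob_space_axioms)

lemma measurable_gaussP_update:
  assumes "k \<in> D" "F \<in> measurable M (gaussP (D - {k}))" "y \<in> borel_measurable M"
  shows "(\<lambda>p. (F p)(k := y p)) \<in> measurable M (gaussP D)"
proof (rule measurable_fun_upd[where J = "D - {k}"])
  show "y \<in> measurable M gauss" using assms(3) by simp
qed (use assms in auto)

text \<open>Moves both copies of coordinate k into the two innermost integrals, where a planar
  rotation can act on them.\<close>

lemma nn_integral_pair_coordinate:
  assumes D: "finite D" "k \<in> D" and f[measurable]: "f \<in> borel_measurable (gaussP D \<Otimes>\<^sub>M gaussP D)"
  shows "(\<integral>\<^sup>+ b. (\<integral>\<^sup>+ b'. f (b, b') \<partial>gaussP D) \<partial>gaussP D)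
    = (\<integral>\<^sup>+ b. (\<integral>\<^sup>+ b'. (\<integral>\<^sup>+ y. (\<integral>\<^sup>+ y'. f (b(k := y), b'(k := y')) \<partial>gauss) \<partial>gauss) \<partial>gaussP (D - {k})) \<partial>gaussP (D - {k}))"
proof -
  let ?P = "gaussP (D - {k})"
  interpret P: sigma_finite_measure ?P by (rule sigma_finite_gaussP)
  interpret Q: sigma_finite_measure "gaussP D" by (rule sigma_finite_gaussP)
  interpret pair_sigma_finite gauss ?P ..
  have "(\<integral>\<^sup>+ b. (\<integral>\<^sup>+ b'. f (b, b') \<partial>gaussP D) \<partial>gaussP D)
     = (\<integral>\<^sup>+ b. (\<integral>\<^sup>+ y. (\<integral>\<^sup>+ b'. f (b(k := y), b') \<partial>gaussP D) \<partial>gauss) \<partial>?P)"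
    by (rule nn_integral_PiM_coordinate[OF D]) measurable
  also have "\<dots> = (\<integral>\<^sup>+ b. (\<integral>\<^sup>+ y. (\<integral>\<^sup>+ b'. (\<integral>\<^sup>+ y'. f (b(k := y), b'(k := y')) \<partial>gauss) \<partial>?P) \<partial>gauss) \<partial>?P)"
  proof (intro nn_integral_cong nn_integral_PiM_coordinate[OF D])
    fix b :: "'a \<Rightarrow> real" and y :: real
    assume "b \<in> space ?P" "y \<in> space gauss"
    then have "b(k := y) \<in> space (gaussP D)" using D by (auto simp: space_PiM PiE_iff extensional_def)
    then show "(\<lambda>b'. f (b(k := y), b')) \<in> borel_measurable (gaussP D)"
      by (rule measurable_Pair2[OF f])
  qed
  also have "\<dots> = (\<integral>\<^sup>+ b. (\<integral>\<^sup>+ b'. (\<integral>\<^sup>+ y. (\<integral>\<^sup>+ y'. f (b(k := y), b'(k := y')) \<partial>gauss) \<partial>gauss) \<partial>?P) \<partial>?P)"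
  proof (intro nn_integral_cong Fubini'[symmetric])
    fix b assume b: "b \<in> space ?P"
    have "(\<lambda>q. ((b(k := fst (fst q))), ((snd (fst q))(k := snd q)))) \<in> measurable ((gauss \<Otimes>\<^sub>M ?P) \<Otimes>\<^sub>M gauss) (gaussP D \<Otimes>\<^sub>M gaussP D)"
      using b D by (intro measurable_Pair measurable_gaussP_update) auto
    from measurable_compose[OF this f]
    have "(\<lambda>(q, y'). f (b(k := fst q), (snd q)(k := y'))) \<in> borel_measurable ((gauss \<Otimes>\<^sub>M ?P) \<Otimes>\<^sub>M gauss)"
      by (simp add: case_prod_beta)
    then have "(\<lambda>q. \<integral>\<^sup>+ y'. f (b(k := fst q), (snd q)(k := y')) \<partial>gauss) \<in> borel_measurable (gauss \<Otimes>\<^sub>M ?P)"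
      by (rule gauss.borel_measurable_nn_integral)
    then show "(\<lambda>(y, b'). \<integral>\<^sup>+ y'. f (b(k := y), b'(k := y')) \<partial>gauss) \<in> borel_measurable (gauss \<Otimes>\<^sub>M ?P)"
      by (simp add: case_prod_beta)
  qed
  finally show ?thesis .
qed

text \<open>Rotating only the coordinates in K allows an induction on K. Values off K are kept, so
  points of the product space stay \<open>undefined\<close> outside D.\<close>

definition rotate_on :: "'k set \<Rightarrow> real \<Rightarrow> real \<Rightarrow> ('k \<Rightarrow> real) \<times> ('k \<Rightarrow> real) \<Rightarrow> ('k \<Rightarrow> real) \<times> ('k \<Rightarrow> real)" where
  "rotate_on K c s = (\<lambda>(b, b'). (\<lambda>k. if k \<in> K then c * b k + s * b' k else b k,
                                 \<lambda>k. if k \<in> K then - s * b k + c * b' k else b' k))"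

text \<open>The coefficients c and s may vary with p: the exchange of integrals in
  \<open>fluctuation_le\<close> requires measurability jointly in the angle and the two
  vectors.\<close>

lemma measurable_rotate_on_gen:
  assumes K: "K \<subseteq> D" and c: "c \<in> borel_measurable M" "s \<in> borel_measurable M"
    and b: "b \<in> measurable M (gaussP D)" "b' \<in> measurable M (gaussP D)"
  shows "(\<lambda>p. rotate_on K (c p) (s p) (b p, b' p)) \<in> measurable M (gaussP D \<Otimes>\<^sub>M gaussP D)"
proof -
  have bk: "(\<lambda>p. b p k) \<in> borel_measurable M" "(\<lambda>p. b' p k) \<in> borel_measurable M" if "k \<in> D" for k
    using measurable_compose[OF b(1) measurable_component_singleton[OF that]]
      measurable_compose[OF b(2) measurable_component_singleton[OF that]] by simp_all
  have ext: "b p k = undefined" "b' p k = undefined" if "p \<in> space M" "k \<notin> D" for p k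
    using measurable_space[OF b(1) that(1)] measurable_space[OF b(2) that(1)] that(2)
    by (auto simp: space_PiM PiE_iff extensional_def)
  show ?thesis
    unfolding rotate_on_def case_prod_conv
  proof (intro measurable_Pair measurable_PiM_single')
    fix k assume k: "k \<in> D"
    show "(\<lambda>p. if k \<in> K then c p * b p k + s p * b' p k else b p k) \<in> measurable M gauss"
      "(\<lambda>p. if k \<in> K then - s p * b p k + c p * b' p k else b' p k) \<in> measurable M gauss"
      using bk[OF k] c by (cases "k \<in> K"; simp)+
  qed (use K ext in \<open>auto simp: PiE_iff extensional_def\<close>)
qed

lemma nn_integral_rotate_on:
  assumes D: "finite D" and cs: "c\<^sup>2 + s\<^sup>2 = 1" "c \<noteq> - 1" and K: "K \<subseteq> D"
    and f: "f \<in> borel_measurable (gaussP D \<Otimes>\<^sub>M gaussP D)"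
  shows "(\<integral>\<^sup>+ b. (\<integral>\<^sup>+ b'. f (rotate_on K c s (b, b')) \<partial>gaussP D) \<partial>gaussP D)
    = (\<integral>\<^sup>+ b. (\<integral>\<^sup>+ b'. f (b, b') \<partial>gaussP D) \<partial>gaussP D)"
proof -
  let ?P = "gaussP D" and ?Q = "\<lambda>k. gaussP (D - {k})"
  have "finite K" using D K finite_subset by auto
  then show ?thesis using K f
  proof (induction K arbitrary: f rule: finite_induct)
    case empty
    then show ?case by (simp add: rotate_on_def)
  next
    case (insert k K)
    then have k: "k \<in> D" and K: "K \<subseteq> D" by auto
    note f[measurable] = insert.prems(2)
    have m: "(\<lambda>p. h (rotate_on K' c s p)) \<in> borel_measurable (?P \<Otimes>\<^sub>M ?P)"
      if "h \<in> borel_measurable (?P \<Otimes>\<^sub>M ?P)" "K' \<subseteq> D" for h :: "_ \<Rightarrow> ennreal" and K'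
      using measurable_compose[OF measurable_rotate_on_gen[OF that(2), of "\<lambda>_. c" _ "\<lambda>_. s" fst snd] that(1)]
      by simp
    have comp: "rotate_on (insert k K) c s p = rotate_on K c s (rotate_on {k} c s p)" for p
      using insert.hyps by (auto simp: rotate_on_def split: prod.splits)
    let ?f = "\<lambda>p. f (rotate_on K c s p)"
    have mf: "?f \<in> borel_measurable (?P \<Otimes>\<^sub>M ?P)" by (rule m[OF f K])
    have upd: "rotate_on {k} c s (b(k := y), b'(k := y')) = (b(k := c * y + s * y'), b'(k := - s * y + c * y'))" for b b' y y'
      by (auto simp: rotate_on_def)
    have "(\<integral>\<^sup>+ b. (\<integral>\<^sup>+ b'. f (rotate_on (insert k K) c s (b, b')) \<partial>?P) \<partial>?P)
      = (\<integral>\<^sup>+ b. (\<integral>\<^sup>+ b'. ?f (rotate_on {k} c s (b, b')) \<partial>?P) \<partial>?P)"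
      unfolding comp ..
    also have "\<dots> = (\<integral>\<^sup>+ b. (\<integral>\<^sup>+ b'. (\<integral>\<^sup>+ y. (\<integral>\<^sup>+ y'. ?f (b(k := c * y + s * y'), b'(k := - s * y + c * y'))
        \<partial>gauss) \<partial>gauss) \<partial>?Q k) \<partial>?Q k)"
      using nn_integral_pair_coordinate[OF D k m[OF mf, of "{k}"]] k unfolding upd by simp
    also have "\<dots> = (\<integral>\<^sup>+ b. (\<integral>\<^sup>+ b'. (\<integral>\<^sup>+ y. (\<integral>\<^sup>+ y'. ?f (b(k := y), b'(k := y'))
        \<partial>gauss) \<partial>gauss) \<partial>?Q k) \<partial>?Q k)"
    proof (rule nn_integral_cong, rule nn_integral_cong)
      fix b b' assume b: "b \<in> space (?Q k)" "b' \<in> space (?Q k)"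
      have "(\<lambda>q. (b(k := fst q), b'(k := snd q))) \<in> measurable (borel \<Otimes>\<^sub>M borel) (?P \<Otimes>\<^sub>M ?P)"
        using b k by (intro measurable_Pair measurable_gaussP_update) auto
      from measurable_compose[OF this mf]
      have "(\<lambda>(y, y'). ?f (b(k := y), b'(k := y'))) \<in> borel_measurable (borel \<Otimes>\<^sub>M borel)"
        by (simp add: case_prod_beta)
      from nn_integral_gauss_rotate[OF cs this]
      show "(\<integral>\<^sup>+ y. (\<integral>\<^sup>+ y'. ?f (b(k := c * y + s * y'), b'(k := - s * y + c * y')) \<partial>gauss) \<partial>gauss)
          = (\<integral>\<^sup>+ y. (\<integral>\<^sup>+ y'. ?f (b(k := y), b'(k := y')) \<partial>gauss) \<partial>gauss)"
        by (simp only: case_prod_conv)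
    qed
    also have "\<dots> = (\<integral>\<^sup>+ b. (\<integral>\<^sup>+ b'. ?f (b, b') \<partial>?P) \<partial>?P)"
      by (rule nn_integral_pair_coordinate[OF D k mf, symmetric])
    also have "\<dots> = (\<integral>\<^sup>+ b. (\<integral>\<^sup>+ b'. f (b, b') \<partial>?P) \<partial>?P)"
      by (rule insert.IH[OF K f])
    finally show ?case .
  qed
qed

section \<open>Gaussian moments and integration by parts\<close>

lemma gauss_moments:
  "has_bochner_integral gauss (\<lambda>y. y) 0" "has_bochner_integral gauss (\<lambda>y. y\<^sup>2) 1"
  using std_normal_moment_odd[of 0] std_normal_moment_even[of 1]
  by (simp_all add: has_bochner_integral_density)

lemma nn_integral_gauss_square: "(\<integral>\<^sup>+ y. ennreal ((a + g * y)\<^sup>2) \<partial>gauss) = ennreal (a\<^sup>2 + g\<^sup>2)"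
proof -
  have "has_bochner_integral gauss (\<lambda>y. a\<^sup>2 + 2 * a * g * y + g\<^sup>2 * y\<^sup>2) (a\<^sup>2 + 2 * a * g * 0 + g\<^sup>2 * 1)"
    using gauss.prob_space
    by (intro has_bochner_integral_add has_bochner_integral_mult_right gauss_moments)
      (simp add: has_bochner_integral_iff)
  then have "has_bochner_integral gauss (\<lambda>y. (a + g * y)\<^sup>2) (a\<^sup>2 + g\<^sup>2)"
    by (simp add: power2_sum power_mult_distrib mult_ac add_ac)
  then show ?thesis
    by (subst nn_integral_eq_integral) (auto simp: has_bochner_integral_iff)
qed

text \<open>The offset a makes the induction work: while one coordinate is integrated, the remaining
  ones are absorbed into it.\<close>

lemma nn_integral_gaussP_square:
  assumes "finite D"
  shows "(\<integral>\<^sup>+ b. ennreal ((a + (\<Sum>k\<in>D. g k * b k))\<^sup>2) \<partial>gaussP D) = ennreal (a\<^sup>2 + (\<Sum>k\<in>D. (g k)\<^sup>2))"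
  using assms
proof (induction D arbitrary: a rule: finite_induct)
  case empty
  show ?case by (simp add: gauss_prod.emeasure_space_1)
next
  case (insert i D)
  have m: "(\<lambda>b. ennreal ((a + (\<Sum>k\<in>insert i D. g k * b k))\<^sup>2)) \<in> borel_measurable (gaussP (insert i D))"
    by measurable
  have "(\<integral>\<^sup>+ b. ennreal ((a + (\<Sum>k\<in>insert i D. g k * b k))\<^sup>2) \<partial>gaussP (insert i D))
     = (\<integral>\<^sup>+ b. (\<integral>\<^sup>+ y. ennreal ((a + (\<Sum>k\<in>insert i D. g k * (b(i := y)) k))\<^sup>2) \<partial>gauss) \<partial>gaussP D)"
    by (rule gauss_prod.product_nn_integral_insert[OF insert.hyps m])
  also have "\<dots> = (\<integral>\<^sup>+ b. (\<integral>\<^sup>+ y. ennreal (((a + (\<Sum>k\<in>D. g k * b k)) + g i * y)\<^sup>2) \<partial>gauss) \<partial>gaussP D)"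
  proof -
    have "(\<Sum>k\<in>D. g k * (b(i := y)) k) = (\<Sum>k\<in>D. g k * b k)" for b y
      using insert.hyps by (intro sum.cong) auto
    then show ?thesis using insert.hyps by (simp add: add_ac)
  qed
  also have "\<dots> = (\<integral>\<^sup>+ b. ennreal ((a + (\<Sum>k\<in>D. g k * b k))\<^sup>2) + ennreal ((g i)\<^sup>2) \<partial>gaussP D)"
    unfolding nn_integral_gauss_square by (simp add: ennreal_plus)
  also have "\<dots> = (\<integral>\<^sup>+ b. ennreal ((a + (\<Sum>k\<in>D. g k * b k))\<^sup>2) \<partial>gaussP D) + ennreal ((g i)\<^sup>2)"
    by (subst nn_integral_add) (auto simp: gauss_prod.emeasure_space_1)
  also have "\<dots> = ennreal (a\<^sup>2 + (\<Sum>k\<in>insert i D. (g k)\<^sup>2))"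
    unfolding insert.IH using insert.hyps by (simp add: ennreal_plus[symmetric] sum_nonneg add_ac del: ennreal_plus)
  finally show ?case .
qed

text \<open>The density satisfies phi' = - y phi, so the difference of the two integrands is the
  derivative of phi f; the boundary terms vanish because f is bounded.\<close>

lemma gauss_stein:
  fixes f f' :: "real \<Rightarrow> real"
  assumes d: "\<And>y. (f has_real_derivative f' y) (at y)" and c: "\<And>y. isCont f' y"
    and B: "\<And>y. \<bar>f y\<bar> \<le> B" "\<And>y. \<bar>f' y\<bar> \<le> B"
  shows "(\<integral>y. y * f y \<partial>gauss) = (\<integral>y. f' y \<partial>gauss)"
proof -
  have B0: "0 \<le> B" using B(1)[of 0] by linarith
  have cf: "isCont f y" for y using d DERIV_isCont by blast
  have [measurable]: "f \<in> borel_measurable borel" "f' \<in> borel_measurable borel"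
    using c cf by (auto intro!: borel_measurable_continuous_onI simp: continuous_on_eq_continuous_at)
  let ?\<phi> = std_normal_density
  have dphi: "(?\<phi> has_real_derivative - y * ?\<phi> y) (at y)" for y
  proof -
    have "((\<lambda>y. a * exp (- y\<^sup>2 / 2)) has_real_derivative - y * (a * exp (- y\<^sup>2 / 2))) (at y)" for a
      by (auto intro!: derivative_eq_intros)
    from this[of "1 / sqrt (2 * pi)"] show ?thesis unfolding std_normal_density_def .
  qed
  have i1: "integrable gauss (\<lambda>y. y * f y)"
  proof (rule Bochner_Integration.integrable_bound)
    show "integrable gauss (\<lambda>y. B * \<bar>y\<bar>)"
      using gauss_moments(1) by (auto simp: has_bochner_integral_iff)
    show "AE y in gauss. norm (y * f y) \<le> norm (B * \<bar>y\<bar>)"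
      using B B0 by (auto simp: abs_mult mult.commute[of B] intro!: always_eventually mult_left_mono)
  qed simp
  have i2: "integrable gauss f'"
    by (rule gauss.integrable_const_bound[of _ B]) (use B in auto)
  have j1: "integrable lborel (\<lambda>y. ?\<phi> y * (y * f y))" and j2: "integrable lborel (\<lambda>y. ?\<phi> y * f' y)"
    using i1 i2 by (simp_all add: integrable_density)
  let ?D = "\<lambda>y. ?\<phi> y * f' y - ?\<phi> y * (y * f y)"
  have lim: "((\<lambda>y. ?\<phi> y * f y) \<longlongrightarrow> 0) F" if "(?\<phi> \<longlongrightarrow> 0) F" for F
  proof (rule Lim_null_comparison)
    show "\<forall>\<^sub>F y in F. norm (?\<phi> y * f y) \<le> ?\<phi> y * B"
      using B by (auto simp: abs_mult intro!: always_eventually mult_left_mono)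
    show "((\<lambda>y. ?\<phi> y * B) \<longlongrightarrow> 0) F" using tendsto_mult_right[OF that, of B] by simp
  qed
  have phi0: "(?\<phi> \<longlongrightarrow> 0) at_top" "(?\<phi> \<longlongrightarrow> 0) at_bot"
    unfolding std_normal_density_def by real_asymp+
  have "(LBINT y=-\<infinity>..\<infinity>. ?D y) = 0 - 0"
  proof (rule interval_integral_FTC_integrable[where F = "\<lambda>y. ?\<phi> y * f y"])
    show "((\<lambda>y. ?\<phi> y * f y) has_vector_derivative ?D y) (at y)" for y
      unfolding has_real_derivative_iff_has_vector_derivative[symmetric]
      by (rule DERIV_cong[OF DERIV_mult[OF dphi d]]) (simp add: algebra_simps)
    show "isCont ?D y" for y
      using DERIV_isCont[OF dphi] by (intro continuous_intros c cf)
    show "set_integrable lborel (einterval (- \<infinity>) \<infinity>) ?D"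
      using j1 j2 by (simp add: set_integrable_def)
    show "(((\<lambda>y. ?\<phi> y * f y) \<circ> real_of_ereal) \<longlongrightarrow> 0) (at_right (- \<infinity>))"
      "(((\<lambda>y. ?\<phi> y * f y) \<circ> real_of_ereal) \<longlongrightarrow> 0) (at_left \<infinity>)"
      using lim phi0 by (simp_all add: ereal_tendsto_simps)
  qed simp
  then have "(\<integral>y. ?D y \<partial>lborel) = 0"
    by (simp add: interval_lebesgue_integral_def set_lebesgue_integral_def)
  then have "(\<integral>y. ?\<phi> y * f' y \<partial>lborel) = (\<integral>y. ?\<phi> y * (y * f y) \<partial>lborel)"
    using j1 j2 by simp
  then show ?thesis by (simp add: integral_density)
qed

section \<open>Displacement of a smooth function of a Gaussian vector\<close>

lemma abs_diff_le_nn_integral_derivative: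
  fixes f f' :: "real \<Rightarrow> real"
  assumes "a \<le> b" and d: "\<And>t. (f has_real_derivative f' t) (at t)" and c: "\<And>t. isCont f' t"
  shows "ennreal \<bar>f b - f a\<bar> \<le> (\<integral>\<^sup>+ t. ennreal \<bar>f' t\<bar> * indicator {a..b} t \<partial>lborel)"
    and "has_bochner_integral lborel (\<lambda>t. indicator {a..b} t * f' t) (f b - f a)"
proof -
  have h: "has_bochner_integral lborel (\<lambda>t. indicator {a..b} t *\<^sub>R f' t) (f b - f a)"
    using d c by (intro has_bochner_integral_FTC_Icc[OF \<open>a \<le> b\<close>])
      (auto simp: has_real_derivative_iff_has_vector_derivative[symmetric] has_field_derivative_at_within
        continuous_on_eq_continuous_within continuous_at_imp_continuous_at_within)
  then show "has_bochner_integral lborel (\<lambda>t. indicator {a..b} t * f' t) (f b - f a)" by simp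
  from h have "ennreal (norm (f b - f a)) \<le> (\<integral>\<^sup>+ t. ennreal (norm (indicator {a..b} t *\<^sub>R f' t)) \<partial>lborel)"
    using integral_norm_bound_ennreal[of lborel "\<lambda>t. indicator {a..b} t *\<^sub>R f' t"]
    by (simp add: has_bochner_integral_iff)
  also have "\<dots> = (\<integral>\<^sup>+ t. ennreal \<bar>f' t\<bar> * indicator {a..b} t \<partial>lborel)"
    by (intro nn_integral_cong) (auto simp: indicator_def)
  finally show "ennreal \<bar>f b - f a\<bar> \<le> (\<integral>\<^sup>+ t. ennreal \<bar>f' t\<bar> * indicator {a..b} t \<partial>lborel)" by simp
qed

text \<open>The restriction to D keeps the result in the product space. At t = 0 it is the zero
  vector on D whatever b is, which encodes switching off the high levels.\<close>

definition scale_on :: "'k set \<Rightarrow> real \<Rightarrow> ('k \<Rightarrow> real) \<Rightarrow> 'k \<Rightarrow> real" where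
  "scale_on D t b = (\<lambda>k\<in>D. t * b k)"

lemma scale_on_update: "k \<in> D \<Longrightarrow> scale_on D t (b(k := y)) = (scale_on D t b)(k := t * y)"
  by (auto simp: scale_on_def restrict_def)

lemma measurable_scale_on:
  assumes [measurable]: "t \<in> borel_measurable M" and b: "b \<in> measurable M (gaussP D)"
  shows "(\<lambda>p. scale_on D (t p) (b p)) \<in> measurable M (gaussP D)"
  unfolding scale_on_def
proof (rule measurable_restrict)
  fix k assume "k \<in> D"
  then have [measurable]: "(\<lambda>p. b p k) \<in> borel_measurable M"
    using measurable_compose[OF b measurable_component_singleton[of k D]] by simp
  have "(\<lambda>p. t p * b p k) \<in> borel_measurable M" by measurable
  then show "(\<lambda>p. t p * b p k) \<in> measurable M gauss" by simp
qed

text \<open>Only finiteness matters for the integrability arguments; the value 2 comes from |y| <= 1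
  + y^2.\<close>

lemma nn_integral_gaussP_abs_le:
  assumes "finite D" "k \<in> D"
  shows "(\<integral>\<^sup>+ b. ennreal \<bar>b k\<bar> \<partial>gaussP D) \<le> 2"
proof (rule nn_integral_PiM_coordinate_le[OF assms])
  have [measurable]: "(\<lambda>b. b k) \<in> borel_measurable (gaussP D)"
    using measurable_component_singleton[OF assms(2), of "\<lambda>_. gauss"] by simp
  show "(\<lambda>b. ennreal \<bar>b k\<bar>) \<in> borel_measurable (gaussP D)" by measurable
  fix b :: "'a \<Rightarrow> real"
  have "(\<integral>\<^sup>+ y. ennreal \<bar>y\<bar> \<partial>gauss) \<le> (\<integral>\<^sup>+ y. 1 + ennreal ((0 + 1 * y)\<^sup>2) \<partial>gauss)"
  proof (intro nn_integral_mono)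
    fix y :: real
    have "\<bar>y\<bar> \<le> 1 + y\<^sup>2"
    proof (cases "\<bar>y\<bar> \<le> 1")
      case True
      then show ?thesis by (simp add: add_increasing2)
    next
      case False
      then have "\<bar>y\<bar> * 1 \<le> \<bar>y\<bar> * \<bar>y\<bar>" by (intro mult_left_mono) auto
      then show ?thesis by (simp add: power2_eq_square)
    qed
    then have "ennreal \<bar>y\<bar> \<le> ennreal (1 + y\<^sup>2)" by (rule ennreal_leI)
    then show "ennreal \<bar>y\<bar> \<le> 1 + ennreal ((0 + 1 * y)\<^sup>2)" by simp
  qed
  also have "\<dots> = (\<integral>\<^sup>+ y. 1 \<partial>gauss) + (\<integral>\<^sup>+ y. ennreal ((0 + 1 * y)\<^sup>2) \<partial>gauss)"
    by (rule nn_integral_add) auto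
  also have "\<dots> = 2" unfolding nn_integral_gauss_square using gauss.emeasure_space_1 by simp
  finally show "(\<integral>\<^sup>+ s. ennreal \<bar>(b(k := s)) k\<bar> \<partial>gauss) \<le> 2" by simp
qed

text \<open>Here \<open>g k\<close> and \<open>h k\<close> are the first and second partial
  derivatives of f in coordinate k. The chain rule is postulated along arbitrary differentiable
  paths because it serves both for arcs, in the fluctuation, and for rays, in the drift. The bound B
  secures integrability and does not enter the estimates.\<close>

locale gaussian_smooth =
  fixes D :: "'k set" and f :: "('k \<Rightarrow> real) \<Rightarrow> real" and g h :: "'k \<Rightarrow> ('k \<Rightarrow> real) \<Rightarrow> real" and B :: real
  assumes D: "finite D"
    and f_meas: "f \<in> borel_measurable (gaussP D)"
    and g_meas: "\<And>k. k \<in> D \<Longrightarrow> g k \<in> borel_measurable (gaussP D)"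
    and h_meas: "\<And>k. k \<in> D \<Longrightarrow> h k \<in> borel_measurable (gaussP D)"
    and f_bound: "\<And>b. \<bar>f b\<bar> \<le> B"
    and g_bound: "\<And>k b. k \<in> D \<Longrightarrow> \<bar>g k b\<bar> \<le> B"
    and h_bound: "\<And>k b. k \<in> D \<Longrightarrow> \<bar>h k b\<bar> \<le> B"
    and f_deriv: "\<And>p p' t. (\<And>k. k \<in> D \<Longrightarrow> ((\<lambda>t. p t k) has_real_derivative p' k) (at t)) \<Longrightarrow>
      ((\<lambda>t. f (p t)) has_real_derivative (\<Sum>k\<in>D. p' k * g k (p t))) (at t)"
    and g_deriv: "\<And>k b y. k \<in> D \<Longrightarrow> ((\<lambda>y. g k (b(k := y))) has_real_derivative h k (b(k := y))) (at y)"
    and g_cont: "\<And>k p t. k \<in> D \<Longrightarrow> (\<And>k. k \<in> D \<Longrightarrow> isCont (\<lambda>t. p t k) t) \<Longrightarrow> isCont (\<lambda>t::real. g k (p t)) t"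
    and h_cont: "\<And>k p t. k \<in> D \<Longrightarrow> (\<And>k. k \<in> D \<Longrightarrow> isCont (\<lambda>t. p t k) t) \<Longrightarrow> isCont (\<lambda>t::real. h k (p t)) t"
begin

lemma B_ge_0: "0 \<le> B"
  using f_bound[of undefined] by linarith

lemma coord_meas: "k \<in> D \<Longrightarrow> (\<lambda>b. b k) \<in> borel_measurable (gaussP D)"
  using measurable_component_singleton[of k D "\<lambda>_. gauss"] by simp

text \<open>Rotating an independent copy into the original variable moves along a path whose velocity is,
  at every time, an independent Gaussian vector.\<close>

lemma fluctuation_le:
  assumes a: "0 < a"
  shows "(\<integral>\<^sup>+ b. (\<integral>\<^sup>+ b'. ennreal \<bar>f b - f b'\<bar> \<partial>gaussP D) \<partial>gaussP D)
    \<le> ennreal (pi / 4) * (ennreal a + ennreal (1 / a) * (\<integral>\<^sup>+ b. ennreal (\<Sum>k\<in>D. (g k b)\<^sup>2) \<partial>gaussP D))"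
proof -
  let ?P = "gaussP D"
  let ?rot = "\<lambda>\<theta>. rotate_on D (cos \<theta>) (sin \<theta>)"
  interpret PL: pair_sigma_finite ?P lborel ..
  \<comment> \<open>The derivative of f at the first argument in the direction of the second.
    Rotating (b, b') by the angle gives a point of the path together with its velocity, so this
    function of the rotated pair is the derivative of f along the path.\<close>
  define \<Psi> where "\<Psi> = (\<lambda>(b, b'). \<Sum>k\<in>D. b' k * g k b)"
  define p where "p b b' \<theta> = fst (?rot \<theta> (b, b'))" for b b' :: "'k \<Rightarrow> real" and \<theta>
  have pk: "p b b' \<theta> k = cos \<theta> * b k + sin \<theta> * b' k" if "k \<in> D" for b b' \<theta> k
    using that by (simp add: p_def rotate_on_def)
  have Psi_meas[measurable]: "\<Psi> \<in> borel_measurable (?P \<Otimes>\<^sub>M ?P)"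
  proof -
    have "(\<lambda>q. \<Sum>k\<in>D. snd q k * g k (fst q)) \<in> borel_measurable (?P \<Otimes>\<^sub>M ?P)"
      by (intro borel_measurable_sum borel_measurable_times measurable_compose[OF measurable_snd coord_meas]
          measurable_compose[OF measurable_fst g_meas])
    then show ?thesis by (simp add: \<Psi>_def case_prod_beta)
  qed
  have Psi_rot: "\<Psi> (?rot \<theta> (b, b')) = (\<Sum>k\<in>D. (- sin \<theta> * b k + cos \<theta> * b' k) * g k (p b b' \<theta>))" for b b' \<theta>
    by (auto simp: \<Psi>_def p_def rotate_on_def intro!: sum.cong)
  have path: "ennreal \<bar>f b - f b'\<bar> \<le>
      (\<integral>\<^sup>+ \<theta>. ennreal \<bar>\<Psi> (?rot \<theta> (b, b'))\<bar> * indicator {0..pi/2} \<theta> \<partial>lborel)"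
    if b: "b \<in> space ?P" "b' \<in> space ?P" for b b'
  proof -
    have "p b b' 0 = b" "p b b' (pi / 2) = b'"
      using b by (auto simp: p_def rotate_on_def space_PiM PiE_iff extensional_def)
    moreover have "ennreal \<bar>f (p b b' (pi / 2)) - f (p b b' 0)\<bar> \<le>
       (\<integral>\<^sup>+ \<theta>. ennreal \<bar>\<Psi> (?rot \<theta> (b, b'))\<bar> * indicator {0..pi/2} \<theta> \<partial>lborel)"
    proof (rule abs_diff_le_nn_integral_derivative)
      fix \<theta> :: real
      show "((\<lambda>\<theta>. f (p b b' \<theta>)) has_real_derivative \<Psi> (?rot \<theta> (b, b'))) (at \<theta>)"
        unfolding Psi_rot
      proof (rule f_deriv)
        fix k assume "k \<in> D"
        then have "(\<lambda>\<theta>. p b b' \<theta> k) = (\<lambda>\<theta>. cos \<theta> * b k + sin \<theta> * b' k)" using pk by auto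
        then show "((\<lambda>\<theta>. p b b' \<theta> k) has_real_derivative - sin \<theta> * b k + cos \<theta> * b' k) (at \<theta>)"
          by (auto intro!: derivative_eq_intros)
      qed
      show "isCont (\<lambda>\<theta>. \<Psi> (?rot \<theta> (b, b'))) \<theta>"
        unfolding Psi_rot
      proof (intro continuous_intros g_cont)
        fix k assume "k \<in> D"
        then have "(\<lambda>\<theta>. p b b' \<theta> k) = (\<lambda>\<theta>. cos \<theta> * b k + sin \<theta> * b' k)" using pk by auto
        then show "isCont (\<lambda>\<theta>. p b b' \<theta> k) \<theta>" by (auto intro!: continuous_intros)
      qed
    qed simp
    ultimately show ?thesis by (simp add: abs_minus_commute)
  qed
  have m3: "(\<lambda>(q, \<theta>). ennreal \<bar>\<Psi> (?rot \<theta> (fst q, snd q))\<bar> * indicator {0..pi/2} \<theta>)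
      \<in> borel_measurable ((?P \<Otimes>\<^sub>M ?P) \<Otimes>\<^sub>M lborel)"
  proof -
    have "(\<lambda>q. ?rot (snd q) (fst (fst q), snd (fst q))) \<in> measurable ((?P \<Otimes>\<^sub>M ?P) \<Otimes>\<^sub>M lborel) (?P \<Otimes>\<^sub>M ?P)"
      by (rule measurable_rotate_on_gen) auto
    from measurable_compose[OF this Psi_meas]
    have [measurable]: "(\<lambda>q. \<Psi> (?rot (snd q) (fst q))) \<in> borel_measurable ((?P \<Otimes>\<^sub>M ?P) \<Otimes>\<^sub>M lborel)"
      by simp
    have "(\<lambda>q. ennreal \<bar>\<Psi> (?rot (snd q) (fst q))\<bar> * indicator {0..pi/2} (snd q)) \<in> borel_measurable ((?P \<Otimes>\<^sub>M ?P) \<Otimes>\<^sub>M lborel)"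
      by measurable
    then show ?thesis by (simp add: case_prod_beta)
  qed
  interpret PP: pair_prob_space ?P ?P ..
  interpret PPL: pair_sigma_finite "?P \<Otimes>\<^sub>M ?P" lborel ..
  let ?J = "\<lambda>b b' \<theta>. ennreal \<bar>\<Psi> (?rot \<theta> (b, b'))\<bar> * indicator {0..pi/2} \<theta>"
  have m2: "(\<lambda>q. \<integral>\<^sup>+ \<theta>. ?J (fst q) (snd q) \<theta> \<partial>lborel) \<in> borel_measurable (?P \<Otimes>\<^sub>M ?P)"
    by (rule lborel.borel_measurable_nn_integral[OF m3])
  have "(\<integral>\<^sup>+ b. (\<integral>\<^sup>+ b'. ennreal \<bar>f b - f b'\<bar> \<partial>?P) \<partial>?P)
      \<le> (\<integral>\<^sup>+ b. (\<integral>\<^sup>+ b'. (\<integral>\<^sup>+ \<theta>. ?J b b' \<theta> \<partial>lborel) \<partial>?P) \<partial>?P)"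
    by (intro nn_integral_mono path)
  also have "\<dots> = (\<integral>\<^sup>+ q. (\<integral>\<^sup>+ \<theta>. ?J (fst q) (snd q) \<theta> \<partial>lborel) \<partial>(?P \<Otimes>\<^sub>M ?P))"
    using gauss_prod.nn_integral_fst[OF m2] by simp
  also have "\<dots> = (\<integral>\<^sup>+ \<theta>. (\<integral>\<^sup>+ q. ?J (fst q) (snd q) \<theta> \<partial>(?P \<Otimes>\<^sub>M ?P)) \<partial>lborel)"
    by (rule PPL.Fubini'[symmetric, OF m3])
  \<comment> \<open>By rotation invariance the inner integral is the same at every angle, and the
    interval contributes its length pi / 2.\<close>
  also have "\<dots> = (\<integral>\<^sup>+ \<theta>. (\<integral>\<^sup>+ b. (\<integral>\<^sup>+ b'. ennreal \<bar>\<Psi> (b, b')\<bar> \<partial>?P) \<partial>?P) * indicator {0..pi/2} \<theta> \<partial>lborel)"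
  proof (intro nn_integral_cong)
    fix \<theta> :: real
    have mq: "(\<lambda>q. ennreal \<bar>\<Psi> (?rot \<theta> q)\<bar>) \<in> borel_measurable (?P \<Otimes>\<^sub>M ?P)"
    proof -
      have "(\<lambda>q. ?rot \<theta> (fst q, snd q)) \<in> measurable (?P \<Otimes>\<^sub>M ?P) (?P \<Otimes>\<^sub>M ?P)"
        by (rule measurable_rotate_on_gen) auto
      from measurable_compose[OF this Psi_meas]
      have [measurable]: "(\<lambda>q. \<Psi> (?rot \<theta> q)) \<in> borel_measurable (?P \<Otimes>\<^sub>M ?P)" by simp
      show ?thesis by measurable
    qed
    show "(\<integral>\<^sup>+ q. ?J (fst q) (snd q) \<theta> \<partial>(?P \<Otimes>\<^sub>M ?P))
      = (\<integral>\<^sup>+ b. (\<integral>\<^sup>+ b'. ennreal \<bar>\<Psi> (b, b')\<bar> \<partial>?P) \<partial>?P) * indicator {0..pi/2} \<theta>"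
    proof (cases "\<theta> \<in> {0..pi/2}")
      case True
      then have "cos \<theta> \<ge> 0" by (intro cos_ge_zero) auto
      then have c: "cos \<theta> \<noteq> - 1" by linarith
      have "(\<integral>\<^sup>+ q. ?J (fst q) (snd q) \<theta> \<partial>(?P \<Otimes>\<^sub>M ?P))
        = (\<integral>\<^sup>+ b. (\<integral>\<^sup>+ b'. ennreal \<bar>\<Psi> (?rot \<theta> (b, b'))\<bar> \<partial>?P) \<partial>?P)"
        using gauss_prod.nn_integral_fst[OF mq] True by simp
      also have "\<dots> = (\<integral>\<^sup>+ b. (\<integral>\<^sup>+ b'. ennreal \<bar>\<Psi> (b, b')\<bar> \<partial>?P) \<partial>?P)"
        by (rule nn_integral_rotate_on[OF D _ c order_refl, of _ "\<lambda>q. ennreal \<bar>\<Psi> q\<bar>"]) (simp, measurable)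
      finally show ?thesis using True by simp
    qed simp
  qed
  also have "\<dots> = (\<integral>\<^sup>+ b. (\<integral>\<^sup>+ b'. ennreal \<bar>\<Psi> (b, b')\<bar> \<partial>?P) \<partial>?P) * ennreal (pi / 2)"
    by (subst nn_integral_cmult) auto
  also have "(\<integral>\<^sup>+ b. (\<integral>\<^sup>+ b'. ennreal \<bar>\<Psi> (b, b')\<bar> \<partial>?P) \<partial>?P)
      \<le> ennreal (1 / 2) * (ennreal a + ennreal (1 / a) * (\<integral>\<^sup>+ b. ennreal (\<Sum>k\<in>D. (g k b)\<^sup>2) \<partial>?P))"
  proof -
    \<comment> \<open>This replaces Cauchy-Schwarz; its factor 1/2 and the length pi / 2 make up the
      constant pi / 4.\<close>
    have amgm: "\<bar>x\<bar> \<le> 1 / 2 * (a + 1 / a * x\<^sup>2)" for x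
    proof -
      have "0 \<le> (\<bar>x\<bar> - a)\<^sup>2" by simp
      then have "2 * a * \<bar>x\<bar> \<le> a\<^sup>2 + x\<^sup>2" by (simp add: power2_diff mult_ac)
      then show ?thesis using a by (simp add: field_simps power2_eq_square)
    qed
    have inner: "(\<integral>\<^sup>+ b'. ennreal \<bar>\<Psi> (b, b')\<bar> \<partial>?P) \<le> ennreal (1 / 2) * (ennreal a + ennreal (1 / a) * ennreal (\<Sum>k\<in>D. (g k b)\<^sup>2))" for b
    proof -
      have [measurable]: "(\<lambda>b'. b' k) \<in> borel_measurable ?P" if "k \<in> D" for k by (rule coord_meas[OF that])
      have [measurable]: "(\<lambda>b'. \<Sum>k\<in>D. g k b * b' k) \<in> borel_measurable ?P" by measurable
      have "(\<integral>\<^sup>+ b'. ennreal \<bar>\<Psi> (b, b')\<bar> \<partial>?P)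
        \<le> (\<integral>\<^sup>+ b'. ennreal (1 / 2) * (ennreal a + ennreal (1 / a) * ennreal ((0 + (\<Sum>k\<in>D. g k b * b' k))\<^sup>2)) \<partial>?P)"
      proof (intro nn_integral_mono)
        fix b'
        have "ennreal \<bar>\<Psi> (b, b')\<bar> \<le> ennreal (1 / 2 * (a + 1 / a * (\<Psi> (b, b'))\<^sup>2))" by (rule ennreal_leI[OF amgm])
        also have "\<dots> = ennreal (1 / 2) * (ennreal a + ennreal (1 / a) * ennreal ((\<Psi> (b, b'))\<^sup>2))"
          using a by (simp only: ennreal_mult' ennreal_plus zero_le_divide_1_iff less_imp_le zero_le_power2 mult_nonneg_nonneg zero_le_numeral)
        finally have "ennreal \<bar>\<Psi> (b, b')\<bar> \<le> ennreal (1 / 2) * (ennreal a + ennreal (1 / a) * ennreal ((\<Psi> (b, b'))\<^sup>2))" .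
        moreover have "\<Psi> (b, b') = 0 + (\<Sum>k\<in>D. g k b * b' k)" by (simp add: \<Psi>_def mult.commute)
        ultimately show "ennreal \<bar>\<Psi> (b, b')\<bar> \<le> ennreal (1 / 2) * (ennreal a + ennreal (1 / a) * ennreal ((0 + (\<Sum>k\<in>D. g k b * b' k))\<^sup>2))" by simp
      qed
      also have "\<dots> = ennreal (1 / 2) * (ennreal a + ennreal (1 / a) * (\<integral>\<^sup>+ b'. ennreal ((0 + (\<Sum>k\<in>D. g k b * b' k))\<^sup>2) \<partial>?P))"
        by (simp add: nn_integral_cmult nn_integral_add gauss_prod.emeasure_space_1)
      also have "\<dots> = ennreal (1 / 2) * (ennreal a + ennreal (1 / a) * ennreal (\<Sum>k\<in>D. (g k b)\<^sup>2))"
        unfolding nn_integral_gaussP_square[OF D] by simp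
      finally show ?thesis .
    qed
    have [measurable]: "(\<lambda>b. \<Sum>k\<in>D. (g k b)\<^sup>2) \<in> borel_measurable ?P"
      by (intro borel_measurable_sum borel_measurable_power g_meas)
    have "(\<integral>\<^sup>+ b. (\<integral>\<^sup>+ b'. ennreal \<bar>\<Psi> (b, b')\<bar> \<partial>?P) \<partial>?P)
      \<le> (\<integral>\<^sup>+ b. ennreal (1 / 2) * (ennreal a + ennreal (1 / a) * ennreal (\<Sum>k\<in>D. (g k b)\<^sup>2)) \<partial>?P)"
      by (intro nn_integral_mono inner)
    also have "\<dots> = ennreal (1 / 2) * (ennreal a + ennreal (1 / a) * (\<integral>\<^sup>+ b. ennreal (\<Sum>k\<in>D. (g k b)\<^sup>2) \<partial>?P))"
      by (simp add: nn_integral_cmult nn_integral_add gauss_prod.emeasure_space_1)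
    finally show ?thesis .
  qed
  finally have "(\<integral>\<^sup>+ b. (\<integral>\<^sup>+ b'. ennreal \<bar>f b - f b'\<bar> \<partial>?P) \<partial>?P)
    \<le> ennreal (1 / 2) * (ennreal a + ennreal (1 / a) * (\<integral>\<^sup>+ b. ennreal (\<Sum>k\<in>D. (g k b)\<^sup>2) \<partial>?P)) * ennreal (pi / 2)"
    by (blast intro: mult_right_mono[OF _ zero_le])
  also have "\<dots> = (ennreal (1 / 2) * ennreal (pi / 2)) * (ennreal a + ennreal (1 / a) * (\<integral>\<^sup>+ b. ennreal (\<Sum>k\<in>D. (g k b)\<^sup>2) \<partial>?P))"
    by (simp only: mult_ac)
  also have "ennreal (1 / 2) * ennreal (pi / 2) = ennreal (pi / 4)"
    by (subst ennreal_mult'[symmetric]) auto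
  finally show ?thesis .
qed

text \<open>One-dimensional integration by parts in coordinate k with the other coordinates frozen.
  The factor t is the inner derivative of the scaling.\<close>

lemma stein_coordinate:
  assumes k: "k \<in> D"
  shows "(\<integral>b. b k * g k (scale_on D t b) \<partial>gaussP D) = t * (\<integral>b. h k (scale_on D t b) \<partial>gaussP D)"
    and "integrable (gaussP D) (\<lambda>b. b k * g k (scale_on D t b))"
    and "integrable (gaussP D) (\<lambda>b. h k (scale_on D t b))"
proof -
  let ?P = "gaussP D" and ?Q = "gaussP (D - {k})"
  have sc: "(\<lambda>b. scale_on D t b) \<in> measurable ?P ?P" by (rule measurable_scale_on) auto
  have [measurable]: "(\<lambda>b. g k (scale_on D t b)) \<in> borel_measurable ?P" "(\<lambda>b. h k (scale_on D t b)) \<in> borel_measurable ?P"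
    "(\<lambda>b. b k) \<in> borel_measurable ?P"
    using measurable_compose[OF sc g_meas[OF k]] measurable_compose[OF sc h_meas[OF k]] coord_meas[OF k] by auto
  show i1: "integrable ?P (\<lambda>b. b k * g k (scale_on D t b))"
  proof (rule integrableI_bounded)
    have "(\<integral>\<^sup>+ b. ennreal (norm (b k * g k (scale_on D t b))) \<partial>?P) \<le> (\<integral>\<^sup>+ b. ennreal B * ennreal \<bar>b k\<bar> \<partial>?P)"
    proof (intro nn_integral_mono)
      fix b
      have "norm (b k * g k (scale_on D t b)) \<le> B * \<bar>b k\<bar>"
        using g_bound[OF k] by (simp add: abs_mult mult.commute[of B] mult_left_mono)
      then show "ennreal (norm (b k * g k (scale_on D t b))) \<le> ennreal B * ennreal \<bar>b k\<bar>"
        using B_ge_0 by (simp add: ennreal_mult'[symmetric] ennreal_leI)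
    qed
    also have "\<dots> = ennreal B * (\<integral>\<^sup>+ b. ennreal \<bar>b k\<bar> \<partial>?P)" by (rule nn_integral_cmult) measurable
    also have "\<dots> \<le> ennreal B * 2" by (intro mult_left_mono nn_integral_gaussP_abs_le D k) auto
    also have "\<dots> < \<infinity>" by (simp add: ennreal_mult_less_top)
    finally show "(\<integral>\<^sup>+ b. ennreal (norm (b k * g k (scale_on D t b))) \<partial>?P) < \<infinity>" .
  qed measurable
  show i2: "integrable ?P (\<lambda>b. h k (scale_on D t b))"
    by (rule gauss_prod.integrable_const_bound[of _ B]) (use h_bound[OF k] in auto)
  have ins: "insert k (D - {k}) = D" using k by auto
  have split: "(\<integral>b. F b \<partial>?P) = (\<integral>b. (\<integral>y. F (b(k := y)) \<partial>gauss) \<partial>?Q)"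
    if "integrable ?P F" for F :: "_ \<Rightarrow> real"
    using gauss_prod.product_integral_insert[of "D - {k}" k F] D that unfolding ins by simp
  have "(\<integral>b. b k * g k (scale_on D t b) \<partial>?P)
      = (\<integral>b. (\<integral>y. y * g k ((scale_on D t b)(k := t * y)) \<partial>gauss) \<partial>?Q)"
    unfolding split[OF i1] by (simp add: scale_on_update[OF k])
  also have "\<dots> = (\<integral>b. (\<integral>y. t * h k ((scale_on D t b)(k := t * y)) \<partial>gauss) \<partial>?Q)"
  proof (rule Bochner_Integration.integral_cong[OF refl], rule gauss_stein)
    fix b :: "'k \<Rightarrow> real" and y :: real
    show "((\<lambda>y. g k ((scale_on D t b)(k := t * y))) has_real_derivative t * h k ((scale_on D t b)(k := t * y))) (at y)"
      by (rule DERIV_cong[OF DERIV_chain'[where g = "\<lambda>y. g k ((scale_on D t b)(k := y))" and f = "\<lambda>y. t * y", OF _ g_deriv[OF k]]])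
        (auto intro!: derivative_eq_intros)
    show "isCont (\<lambda>y. t * h k ((scale_on D t b)(k := t * y))) y"
    proof (intro continuous_intros h_cont k)
      fix j assume "j \<in> D"
      show "isCont (\<lambda>y. ((scale_on D t b)(k := t * y)) j) y"
        by (cases "j = k") (auto intro!: continuous_intros)
    qed
    show "\<bar>g k ((scale_on D t b)(k := t * y))\<bar> \<le> B * (1 + \<bar>t\<bar>)"
      using B_ge_0 by (intro order_trans[OF g_bound[OF k]]) (simp add: algebra_simps)
    have "\<bar>t * h k ((scale_on D t b)(k := t * y))\<bar> \<le> \<bar>t\<bar> * B"
      using h_bound[OF k] by (simp add: abs_mult mult_left_mono)
    then show "\<bar>t * h k ((scale_on D t b)(k := t * y))\<bar> \<le> B * (1 + \<bar>t\<bar>)"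
      using B_ge_0 by (simp add: algebra_simps)
  qed
  also have "\<dots> = t * (\<integral>b. h k (scale_on D t b) \<partial>?P)"
    unfolding split[OF i2] by (simp add: scale_on_update[OF k])
  finally show "(\<integral>b. b k * g k (scale_on D t b) \<partial>?P) = t * (\<integral>b. h k (scale_on D t b) \<partial>?P)" .
qed

text \<open>Along the ray from 0 to b the derivative of f is the sum of b_k \<open>g k\<close> at t
  b, whose expectation is t times that of the Laplacian at t b. Bounding the weight t by 1 loses
  only the factor 1/2 that its integral would give.\<close>

lemma drift_le:
  "ennreal \<bar>(\<integral>b. f b \<partial>gaussP D) - f (scale_on D 0 b0)\<bar>
    \<le> (\<integral>\<^sup>+ t. (\<integral>\<^sup>+ b. ennreal \<bar>\<Sum>k\<in>D. h k (scale_on D t b)\<bar> \<partial>gaussP D) * indicator {0..1} t \<partial>lborel)"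
proof -
  let ?P = "gaussP D"
  interpret PL: pair_sigma_finite ?P lborel ..
  define q where "q t b = (\<Sum>k\<in>D. b k * g k (scale_on D t b))" for t b
  have q_meas: "(\<lambda>(b, t). indicator {0..1} t * q t b) \<in> borel_measurable (?P \<Otimes>\<^sub>M lborel)"
  proof -
    have sc: "(\<lambda>p. scale_on D (snd p) (fst p)) \<in> measurable (?P \<Otimes>\<^sub>M lborel) ?P"
      by (rule measurable_scale_on) auto
    have "(\<lambda>p. indicator {0..1} (snd p) * (\<Sum>k\<in>D. fst p k * g k (scale_on D (snd p) (fst p)))) \<in> borel_measurable (?P \<Otimes>\<^sub>M lborel)"
      by (intro borel_measurable_times borel_measurable_sum measurable_compose[OF sc g_meas]
          measurable_compose[OF measurable_fst coord_meas]) measurable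
    then show ?thesis by (simp add: case_prod_beta q_def)
  qed
  have path: "has_bochner_integral lborel (\<lambda>t. indicator {0..1} t * q t b) (f b - f (scale_on D 0 b0))"
    if b: "b \<in> space ?P" for b
  proof -
    have "scale_on D 1 b = b" using b by (auto simp: scale_on_def space_PiM PiE_iff extensional_def)
    moreover have "scale_on D 0 b = scale_on D 0 b0" by (auto simp: scale_on_def)
    moreover have "has_bochner_integral lborel (\<lambda>t. indicator {0..1} t * q t b) (f (scale_on D 1 b) - f (scale_on D 0 b))"
    proof (rule abs_diff_le_nn_integral_derivative(2))
      fix t :: real
      have sk: "(\<lambda>t. scale_on D t b k) = (\<lambda>t. t * b k)" if "k \<in> D" for k
        using that by (simp add: scale_on_def)
      show "((\<lambda>t. f (scale_on D t b)) has_real_derivative q t b) (at t)"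
        unfolding q_def by (rule f_deriv) (auto simp: sk intro!: derivative_eq_intros)
      show "isCont (\<lambda>t. q t b) t"
        unfolding q_def by (intro continuous_intros g_cont) (auto simp: sk intro!: continuous_intros)
    qed simp
    ultimately show ?thesis by simp
  qed
  have int: "integrable (?P \<Otimes>\<^sub>M lborel) (\<lambda>(b, t). indicator {0..1} t * q t b)"
  proof (rule integrableI_bounded[OF q_meas])
    have m: "(\<lambda>p. ennreal (norm (case p of (b, t) \<Rightarrow> indicator {0..1} t * q t b))) \<in> borel_measurable (?P \<Otimes>\<^sub>M lborel)"
      using q_meas by measurable
    have "(\<integral>\<^sup>+ p. ennreal (norm (case p of (b, t) \<Rightarrow> indicator {0..1} t * q t b)) \<partial>(?P \<Otimes>\<^sub>M lborel))
      = (\<integral>\<^sup>+ b. (\<integral>\<^sup>+ t. ennreal (norm (indicator {0..1} t * q t b)) \<partial>lborel) \<partial>?P)"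
      using lborel.nn_integral_fst[OF m] by simp
    also have "\<dots> \<le> (\<integral>\<^sup>+ b. (\<integral>\<^sup>+ t. ennreal B * (\<Sum>k\<in>D. ennreal \<bar>b k\<bar>) * indicator {0..1::real} t \<partial>lborel) \<partial>?P)"
    proof (intro nn_integral_mono)
      fix b t
      have "\<bar>q t b\<bar> \<le> (\<Sum>k\<in>D. B * \<bar>b k\<bar>)"
        unfolding q_def
        by (intro order_trans[OF sum_abs] sum_mono) (simp add: abs_mult mult.commute[of B] mult_left_mono g_bound)
      also have "\<dots> = B * (\<Sum>k\<in>D. \<bar>b k\<bar>)" by (simp add: sum_distrib_left)
      finally have "ennreal \<bar>q t b\<bar> \<le> ennreal B * (\<Sum>k\<in>D. ennreal \<bar>b k\<bar>)"
        using B_ge_0 by (simp add: ennreal_mult'[symmetric] ennreal_leI)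
      then show "ennreal (norm (indicator {0..1} t * q t b)) \<le> ennreal B * (\<Sum>k\<in>D. ennreal \<bar>b k\<bar>) * indicator {0..1} t"
        by (auto simp: indicator_def)
    qed
    also have "\<dots> = (\<integral>\<^sup>+ b. ennreal B * (\<Sum>k\<in>D. ennreal \<bar>b k\<bar>) \<partial>?P)"
      by (intro nn_integral_cong) (subst nn_integral_cmult, auto)
    also have "\<dots> = ennreal B * (\<Sum>k\<in>D. (\<integral>\<^sup>+ b. ennreal \<bar>b k\<bar> \<partial>?P))"
    proof -
      have [measurable]: "(\<lambda>b. ennreal \<bar>b k\<bar>) \<in> borel_measurable ?P" if "k \<in> D" for k
        using coord_meas[OF that] by measurable
      have "(\<integral>\<^sup>+ b. ennreal B * (\<Sum>k\<in>D. ennreal \<bar>b k\<bar>) \<partial>?P) = ennreal B * (\<integral>\<^sup>+ b. (\<Sum>k\<in>D. ennreal \<bar>b k\<bar>) \<partial>?P)"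
        by (rule nn_integral_cmult) measurable
      also have "(\<integral>\<^sup>+ b. (\<Sum>k\<in>D. ennreal \<bar>b k\<bar>) \<partial>?P) = (\<Sum>k\<in>D. (\<integral>\<^sup>+ b. ennreal \<bar>b k\<bar> \<partial>?P))"
        by (rule nn_integral_sum) measurable
      finally show ?thesis .
    qed
    also have "\<dots> \<le> ennreal B * (\<Sum>k\<in>D. 2)"
      by (intro mult_left_mono sum_mono nn_integral_gaussP_abs_le D) auto
    also have "\<dots> < \<infinity>" by (simp add: ennreal_mult_less_top of_nat_less_top)
    finally show "(\<integral>\<^sup>+ p. ennreal (norm (case p of (b, t) \<Rightarrow> indicator {0..1} t * q t b)) \<partial>(?P \<Otimes>\<^sub>M lborel)) < \<infinity>" .
  qed
  have f_int: "integrable ?P f"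
    by (rule gauss_prod.integrable_const_bound[of _ B]) (use f_bound f_meas in auto)
  have "(\<integral>b. f b \<partial>?P) - f (scale_on D 0 b0) = (\<integral>b. f b - f (scale_on D 0 b0) \<partial>?P)"
    using f_int by (simp add: prob_space.prob_space[OF gauss_prod.prob_space_axioms])
  also have "\<dots> = (\<integral>b. (\<integral>t. indicator {0..1} t * q t b \<partial>lborel) \<partial>?P)"
    by (intro Bochner_Integration.integral_cong refl) (use path in \<open>simp add: has_bochner_integral_iff\<close>)
  also have "\<dots> = (\<integral>t. (\<integral>b. indicator {0..1} t * q t b \<partial>?P) \<partial>lborel)"
    by (rule PL.Fubini_integral[symmetric, OF int])
  finally have eq: "(\<integral>b. f b \<partial>?P) - f (scale_on D 0 b0) = (\<integral>t. (\<integral>b. indicator {0..1} t * q t b \<partial>?P) \<partial>lborel)" .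
  have it: "integrable lborel (\<lambda>t. (\<integral>b. indicator {0..1} t * q t b \<partial>?P))"
    using PL.integrable_snd[OF int] by simp
  have "ennreal \<bar>(\<integral>b. f b \<partial>?P) - f (scale_on D 0 b0)\<bar>
      \<le> (\<integral>\<^sup>+ t. ennreal (norm (\<integral>b. indicator {0..1} t * q t b \<partial>?P)) \<partial>lborel)"
    unfolding eq using integral_norm_bound_ennreal[OF it] by simp
  also have "\<dots> \<le> (\<integral>\<^sup>+ t. (\<integral>\<^sup>+ b. ennreal \<bar>\<Sum>k\<in>D. h k (scale_on D t b)\<bar> \<partial>?P) * indicator {0..1} t \<partial>lborel)"
  proof (intro nn_integral_mono)
    fix t :: real
    show "ennreal (norm (\<integral>b. indicator {0..1} t * q t b \<partial>?P))
      \<le> (\<integral>\<^sup>+ b. ennreal \<bar>\<Sum>k\<in>D. h k (scale_on D t b)\<bar> \<partial>?P) * indicator {0..1} t"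
    proof (cases "t \<in> {0..1}")
      case True
      have "(\<integral>b. q t b \<partial>?P) = (\<Sum>k\<in>D. t * (\<integral>b. h k (scale_on D t b) \<partial>?P))"
        unfolding q_def by (subst Bochner_Integration.integral_sum) (simp_all add: stein_coordinate)
      also have "\<dots> = t * (\<integral>b. (\<Sum>k\<in>D. h k (scale_on D t b)) \<partial>?P)"
        by (subst Bochner_Integration.integral_sum) (simp_all add: stein_coordinate sum_distrib_left)
      finally have "norm (\<integral>b. q t b \<partial>?P) \<le> norm (\<integral>b. (\<Sum>k\<in>D. h k (scale_on D t b)) \<partial>?P)"
        using True by (simp add: abs_mult mult_left_le_one_le)
      then have "ennreal (norm (\<integral>b. q t b \<partial>?P)) \<le> ennreal (norm (\<integral>b. (\<Sum>k\<in>D. h k (scale_on D t b)) \<partial>?P))"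
        by (rule ennreal_leI)
      also have "\<dots> \<le> (\<integral>\<^sup>+ b. ennreal (norm (\<Sum>k\<in>D. h k (scale_on D t b))) \<partial>?P)"
        by (intro integral_norm_bound_ennreal Bochner_Integration.integrable_sum stein_coordinate)
      finally show ?thesis using True by simp
    qed simp
  qed
  finally show ?thesis .
qed

text \<open>The triangle inequality through the mean m of f: |f b - m| is at most the average of |f
  b - f b'| over an independent copy b', and |m - f 0| is the drift.\<close>

lemma expected_displacement_le:
  assumes a: "0 < a"
  shows "(\<integral>\<^sup>+ b. ennreal \<bar>f b - f (scale_on D 0 b0)\<bar> \<partial>gaussP D)
    \<le> ennreal (pi / 4) * (ennreal a + ennreal (1 / a) * (\<integral>\<^sup>+ b. ennreal (\<Sum>k\<in>D. (g k b)\<^sup>2) \<partial>gaussP D))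
     + (\<integral>\<^sup>+ t. (\<integral>\<^sup>+ b. ennreal \<bar>\<Sum>k\<in>D. h k (scale_on D t b)\<bar> \<partial>gaussP D) * indicator {0..1} t \<partial>lborel)"
proof -
  let ?P = "gaussP D"
  note [measurable] = f_meas
  have f_int: "integrable ?P f"
    by (rule gauss_prod.integrable_const_bound[of _ B]) (use f_bound in auto)
  define m where "m = (\<integral>b. f b \<partial>?P)"
  have "ennreal \<bar>f b - m\<bar> \<le> (\<integral>\<^sup>+ b'. ennreal \<bar>f b - f b'\<bar> \<partial>?P)" for b
  proof -
    have "f b - m = (\<integral>b'. f b - f b' \<partial>?P)" using f_int by (simp add: m_def prob_space.prob_space[OF gauss_prod.prob_space_axioms])
    then show ?thesis using integral_norm_bound_ennreal[of ?P "\<lambda>b'. f b - f b'"] f_int by simp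
  qed
  moreover have "ennreal \<bar>f b - f (scale_on D 0 b0)\<bar> \<le> ennreal \<bar>f b - m\<bar> + ennreal \<bar>m - f (scale_on D 0 b0)\<bar>" for b
    by (simp add: ennreal_plus[symmetric] ennreal_leI del: ennreal_plus)
  ultimately have "(\<integral>\<^sup>+ b. ennreal \<bar>f b - f (scale_on D 0 b0)\<bar> \<partial>?P)
     \<le> (\<integral>\<^sup>+ b. (\<integral>\<^sup>+ b'. ennreal \<bar>f b - f b'\<bar> \<partial>?P) + ennreal \<bar>m - f (scale_on D 0 b0)\<bar> \<partial>?P)"
    by (intro nn_integral_mono) (meson add_right_mono order_trans)
  also have "\<dots> = (\<integral>\<^sup>+ b. (\<integral>\<^sup>+ b'. ennreal \<bar>f b - f b'\<bar> \<partial>?P) \<partial>?P) + ennreal \<bar>m - f (scale_on D 0 b0)\<bar>"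
    by (subst nn_integral_add) (auto simp: gauss_prod.emeasure_space_1)
  also have "\<dots> \<le> ennreal (pi / 4) * (ennreal a + ennreal (1 / a) * (\<integral>\<^sup>+ b. ennreal (\<Sum>k\<in>D. (g k b)\<^sup>2) \<partial>?P))
     + (\<integral>\<^sup>+ t. (\<integral>\<^sup>+ b. ennreal \<bar>\<Sum>k\<in>D. h k (scale_on D t b)\<bar> \<partial>?P) * indicator {0..1} t \<partial>lborel)"
    unfolding m_def by (intro add_mono fluctuation_le[OF a] drift_le)
  finally show ?thesis .
qed

end

section \<open>Derivatives of the trace of the resolvent\<close>

context
  fixes N :: nat and w :: complex
  assumes w: "Im w > 0"
begin

lemma isCont_res2:
  assumes "\<And>t. sym_on N (A t)"
    and "\<And>u v. u \<in> {1..N} \<Longrightarrow> v \<in> {1..N} \<Longrightarrow> isCont (\<lambda>t. A t u v) t0"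
    and "x \<in> {1..N}" and "y \<in> {1..N}"
  shows "isCont (\<lambda>t::real. res2 N w (A t) x y) t0"
  unfolding res2_def by (intro continuous_intros isCont_res w assms)

lemma has_vector_derivative_trace_res:
  assumes A: "\<And>t. sym_on N (A t)"
    and dA: "\<And>u v. u \<in> {1..N} \<Longrightarrow> v \<in> {1..N} \<Longrightarrow> ((\<lambda>t. A t u v) has_real_derivative A' u v) (at t0)"
  shows "((\<lambda>t. \<Sum>x=1..N. res N w (A t) x x) has_vector_derivative
    - (\<Sum>u=1..N. \<Sum>v=1..N. of_real (A' u v) * res2 N w (A t0) v u)) (at t0)"
proof -
  let ?S = "{1..N}"
  let ?R = "res N w (A t0)"
  have "((\<lambda>t. \<Sum>x\<in>?S. res N w (A t) x x) has_vector_derivative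
      (\<Sum>x\<in>?S. - (\<Sum>u\<in>?S. \<Sum>v\<in>?S. ?R x u * of_real (A' u v) * ?R v x))) (at t0)"
    by (intro has_vector_derivative_sum has_vector_derivative_res w A dA)
  also have "(\<Sum>x\<in>?S. - (\<Sum>u\<in>?S. \<Sum>v\<in>?S. ?R x u * of_real (A' u v) * ?R v x))
     = - (\<Sum>x\<in>?S. \<Sum>u\<in>?S. \<Sum>v\<in>?S. of_real (A' u v) * (?R v x * ?R x u))"
    by (simp add: sum_negf mult_ac)
  also have "(\<Sum>x\<in>?S. \<Sum>u\<in>?S. \<Sum>v\<in>?S. of_real (A' u v) * (?R v x * ?R x u))
     = (\<Sum>u\<in>?S. \<Sum>v\<in>?S. of_real (A' u v) * res2 N w (A t0) v u)"
    unfolding res2_def sum_distrib_left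
    by (subst sum.swap, rule sum.cong[OF refl], rule sum.swap)
  finally show ?thesis .
qed

lemma has_vector_derivative_res2:
  assumes A: "\<And>t. sym_on N (A t)"
    and dA: "\<And>u v. u \<in> {1..N} \<Longrightarrow> v \<in> {1..N} \<Longrightarrow> ((\<lambda>t. A t u v) has_real_derivative A' u v) (at t0)"
    and x: "x \<in> {1..N}" and y: "y \<in> {1..N}"
  shows "((\<lambda>t. res2 N w (A t) x y) has_vector_derivative
    - (\<Sum>u=1..N. \<Sum>v=1..N. of_real (A' u v) *
        (res N w (A t0) x u * res2 N w (A t0) v y + res2 N w (A t0) x u * res N w (A t0) v y))) (at t0)"
proof -
  let ?S = "{1..N}"
  let ?R = "res N w (A t0)"
  let ?E = "\<lambda>i j. \<Sum>u\<in>?S. \<Sum>v\<in>?S. ?R i u * of_real (A' u v) * ?R v j"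
  have "((\<lambda>t. res2 N w (A t) x y) has_vector_derivative (\<Sum>z\<in>?S. ?R x z * (- ?E z y) + (- ?E x z) * ?R z y)) (at t0)"
    unfolding res2_def
    by (intro has_vector_derivative_sum has_vector_derivative_mult has_vector_derivative_res w A dA x y)
  also have "(\<Sum>z\<in>?S. ?R x z * (- ?E z y) + (- ?E x z) * ?R z y)
      = - ((\<Sum>z\<in>?S. ?R x z * ?E z y) + (\<Sum>z\<in>?S. ?E x z * ?R z y))"
    by (simp add: sum_negf sum.distrib sum_subtractf)
  also have "(\<Sum>z\<in>?S. ?R x z * ?E z y) = (\<Sum>u\<in>?S. \<Sum>v\<in>?S. of_real (A' u v) * (res2 N w (A t0) x u * ?R v y))"
    unfolding res2_def sum_distrib_left sum_distrib_right
    by (subst sum.swap, rule sum.cong[OF refl], subst sum.swap) (simp add: mult_ac)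
  also have "(\<Sum>z\<in>?S. ?E x z * ?R z y) = (\<Sum>u\<in>?S. \<Sum>v\<in>?S. of_real (A' u v) * (?R x u * res2 N w (A t0) v y))"
    unfolding res2_def sum_distrib_left sum_distrib_right
    by (subst sum.swap, rule sum.cong[OF refl], subst sum.swap) (simp add: mult_ac)
  finally show ?thesis by (simp add: sum.distrib algebra_simps)
qed

text \<open>Deliberately crude: it feeds the qualitative bound B of \<open>smooth\<close>, which
  never reaches the final estimate.\<close>

lemma norm_res2_le:
  assumes "sym_on N A" "x \<in> {1..N}" "y \<in> {1..N}"
  shows "cmod (res2 N w A x y) \<le> real N / (Im w)\<^sup>2"
proof -
  have "cmod (res2 N w A x y) \<le> (\<Sum>z=1..N. (1 / Im w) * (1 / Im w))"
    unfolding res2_def using norm_res_le[OF w assms(1)] assms(2,3) w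
    by (intro order_trans[OF norm_sum] sum_mono, unfold norm_mult, intro mult_mono) auto
  then show ?thesis by (simp add: power2_eq_square)
qed

end

section \<open>Affine matrix families and the derivatives of their resolvent trace\<close>

locale linear_pencil =
  fixes N :: nat and w :: complex and rho :: real and D :: "'k set"
    and A0 :: "nat \<Rightarrow> nat \<Rightarrow> real" and X :: "'k \<Rightarrow> nat \<Rightarrow> nat \<Rightarrow> real"
  assumes w: "Im w > 0" and D: "finite D" and A0: "sym_on N A0" and X: "\<And>k. k \<in> D \<Longrightarrow> sym_on N (X k)"
begin

definition pencil :: "('k \<Rightarrow> real) \<Rightarrow> nat \<Rightarrow> nat \<Rightarrow> real" where
  "pencil b u v = A0 u v + (\<Sum>k\<in>D. b k * X k u v)"

definition ptrace :: "('k \<Rightarrow> real) \<Rightarrow> real" where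
  "ptrace b = rho * Im (\<Sum>x=1..N. res N w (pencil b) x x)"

text \<open>First partial derivative of \<open>ptrace\<close>: - rho Im Tr (X R^2) with X =
  \<open>X k\<close>.\<close>

definition ptrace1 :: "'k \<Rightarrow> ('k \<Rightarrow> real) \<Rightarrow> real" where
  "ptrace1 k b = - rho * Im (\<Sum>u=1..N. \<Sum>v=1..N. of_real (X k u v) * res2 N w (pencil b) v u)"

text \<open>Second partial derivative: rho Im Tr (X R X R^2 + X R^2 X R), by the product rule for
  R^2.\<close>

definition ptrace2 :: "'k \<Rightarrow> ('k \<Rightarrow> real) \<Rightarrow> real" where
  "ptrace2 k b = rho * Im (\<Sum>u=1..N. \<Sum>v=1..N. of_real (X k u v) * (\<Sum>i=1..N. \<Sum>j=1..N. of_real (X k i j) *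
     (res N w (pencil b) v i * res2 N w (pencil b) j u + res2 N w (pencil b) v i * res N w (pencil b) j u)))"

lemma sym_pencil: "sym_on N (pencil b)"
  using A0 X by (auto simp: sym_on_def pencil_def intro!: sum.cong)

lemma pencil_meas: "(\<lambda>b. pencil b u v) \<in> borel_measurable (gaussP D)"
proof -
  have [measurable]: "(\<lambda>b. b k) \<in> borel_measurable (gaussP D)" if "k \<in> D" for k
    using measurable_component_singleton[OF that, of "\<lambda>_. gauss"] by simp
  show ?thesis unfolding pencil_def by measurable
qed

lemma res_pencil_meas:
  "x \<in> {1..N} \<Longrightarrow> y \<in> {1..N} \<Longrightarrow> (\<lambda>b. res N w (pencil b) x y) \<in> borel_measurable (gaussP D)"
  "x \<in> {1..N} \<Longrightarrow> y \<in> {1..N} \<Longrightarrow> (\<lambda>b. res2 N w (pencil b) x y) \<in> borel_measurable (gaussP D)"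
  by (intro borel_measurable_res borel_measurable_res2 w sym_pencil pencil_meas; assumption)+

lemma pencil_cont:
  assumes "\<And>k. k \<in> D \<Longrightarrow> isCont (\<lambda>t. p t k) t"
  shows "isCont (\<lambda>t. pencil (p t) u v) t"
  unfolding pencil_def by (intro continuous_intros assms)

lemma cmod_weighted_sum_le:
  fixes c :: "nat \<Rightarrow> nat \<Rightarrow> real" and z :: "nat \<Rightarrow> nat \<Rightarrow> complex"
  assumes "\<And>u v. u \<in> {1..N} \<Longrightarrow> v \<in> {1..N} \<Longrightarrow> cmod (z u v) \<le> C"
  shows "cmod (\<Sum>u=1..N. \<Sum>v=1..N. of_real (c u v) * z u v) \<le> (\<Sum>u=1..N. \<Sum>v=1..N. \<bar>c u v\<bar>) * C"
  unfolding sum_distrib_right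
  by (intro order_trans[OF norm_sum] sum_mono) (auto simp: norm_mult intro!: mult_left_mono assms)

lemma smooth: "\<exists>B. gaussian_smooth D ptrace ptrace1 ptrace2 B"
proof -
  let ?S = "{1..N}"
  define e where "e = 1 / Im w"
  define nX where "nX k = (\<Sum>u\<in>?S. \<Sum>v\<in>?S. \<bar>X k u v\<bar>)" for k
  have nX: "0 \<le> nX k" for k by (auto simp: nX_def intro!: sum_nonneg)
  \<comment> \<open>The locale asks for one number, so the separate bounds on the function and on
    both derivatives are added up over all k.\<close>
  define B where "B = \<bar>rho\<bar> * (real N * e) + \<bar>rho\<bar> * (\<Sum>k\<in>D. nX k * (real N * e\<^sup>2) + nX k * (nX k * (2 * (e * (real N * e\<^sup>2)))))"
  have e: "0 \<le> e" using w by (simp add: e_def)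
  have R: "cmod (res N w (pencil b) x y) \<le> e" if "x \<in> ?S" "y \<in> ?S" for b x y
    unfolding e_def by (rule norm_res_le[OF w sym_pencil that])
  have R2: "cmod (res2 N w (pencil b) x y) \<le> real N * e\<^sup>2" if "x \<in> ?S" "y \<in> ?S" for b x y
    using norm_res2_le[OF w sym_pencil that] by (simp add: e_def power_divide)
  have part: "nX k * (real N * e\<^sup>2) + nX k * (nX k * (2 * (e * (real N * e\<^sup>2))))
     \<le> (\<Sum>k\<in>D. nX k * (real N * e\<^sup>2) + nX k * (nX k * (2 * (e * (real N * e\<^sup>2)))))" if "k \<in> D" for k
    using that nX e D by (intro member_le_sum) auto
  have "gaussian_smooth D ptrace ptrace1 ptrace2 B"
  proof
    show "finite D" by (rule D)
    show "ptrace \<in> borel_measurable (gaussP D)"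
      unfolding ptrace_def by (intro borel_measurable_times borel_measurable_const measurable_compose[OF _ borel_measurable_Im] borel_measurable_sum res_pencil_meas)
    show "ptrace1 k \<in> borel_measurable (gaussP D)" for k
      unfolding ptrace1_def by (intro borel_measurable_times borel_measurable_const measurable_compose[OF _ borel_measurable_Im] borel_measurable_sum res_pencil_meas)
    show "ptrace2 k \<in> borel_measurable (gaussP D)" for k
      unfolding ptrace2_def by (intro borel_measurable_times borel_measurable_add borel_measurable_const measurable_compose[OF _ borel_measurable_Im] borel_measurable_sum res_pencil_meas)
    show "\<bar>ptrace b\<bar> \<le> B" for b
    proof -
      have "\<bar>Im (\<Sum>x\<in>?S. res N w (pencil b) x x)\<bar> \<le> (\<Sum>x\<in>?S. e)"
        by (intro order_trans[OF abs_Im_le_cmod] order_trans[OF norm_sum] sum_mono R)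
      then have "\<bar>ptrace b\<bar> \<le> \<bar>rho\<bar> * (real N * e)"
        unfolding ptrace_def abs_mult by (intro mult_left_mono) auto
      also have "\<dots> \<le> B" unfolding B_def using nX e by (simp add: sum_nonneg)
      finally show ?thesis .
    qed
    show "\<bar>ptrace1 k b\<bar> \<le> B" if k: "k \<in> D" for k b
    proof -
      have "\<bar>ptrace1 k b\<bar> \<le> \<bar>rho\<bar> * (nX k * (real N * e\<^sup>2))"
        unfolding ptrace1_def abs_mult abs_minus nX_def
        by (intro mult_left_mono order_trans[OF abs_Im_le_cmod] cmod_weighted_sum_le R2) auto
      also have "\<dots> \<le> \<bar>rho\<bar> * (\<Sum>k\<in>D. nX k * (real N * e\<^sup>2) + nX k * (nX k * (2 * (e * (real N * e\<^sup>2)))))"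
        using part[OF k] nX[of k] e by (intro mult_left_mono order_trans[OF _ part[OF k]]) auto
      also have "\<dots> \<le> B" unfolding B_def using e by simp
      finally show ?thesis .
    qed
    show "\<bar>ptrace2 k b\<bar> \<le> B" if k: "k \<in> D" for k b
    proof -
      have "cmod (res N w (pencil b) v i * res2 N w (pencil b) j u + res2 N w (pencil b) v i * res N w (pencil b) j u)
          \<le> 2 * (e * (real N * e\<^sup>2))" if "u \<in> ?S" "v \<in> ?S" "i \<in> ?S" "j \<in> ?S" for u v i j
      proof -
        have "cmod (res N w (pencil b) v i * res2 N w (pencil b) j u) \<le> e * (real N * e\<^sup>2)"
          "cmod (res2 N w (pencil b) v i * res N w (pencil b) j u) \<le> (real N * e\<^sup>2) * e"
          unfolding norm_mult using R R2 that e by (intro mult_mono; simp)+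
        then show ?thesis by (intro order_trans[OF norm_triangle_ineq]) (simp add: mult_ac)
      qed
      then have "\<bar>ptrace2 k b\<bar> \<le> \<bar>rho\<bar> * (nX k * (nX k * (2 * (e * (real N * e\<^sup>2)))))"
        unfolding ptrace2_def abs_mult nX_def
        by (intro mult_left_mono order_trans[OF abs_Im_le_cmod] cmod_weighted_sum_le) auto
      also have "\<dots> \<le> \<bar>rho\<bar> * (\<Sum>k\<in>D. nX k * (real N * e\<^sup>2) + nX k * (nX k * (2 * (e * (real N * e\<^sup>2)))))"
        using nX[of k] e by (intro mult_left_mono order_trans[OF _ part[OF k]]) auto
      also have "\<dots> \<le> B" unfolding B_def using e by simp
      finally show ?thesis .
    qed
    show "((\<lambda>t. ptrace (p t)) has_real_derivative (\<Sum>k\<in>D. p' k * ptrace1 k (p t))) (at t)"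
      if p: "\<And>k. k \<in> D \<Longrightarrow> ((\<lambda>t. p t k) has_real_derivative p' k) (at t)" for p p' t
    proof -
      have dA: "((\<lambda>t. pencil (p t) u v) has_real_derivative (\<Sum>k\<in>D. p' k * X k u v)) (at t)" for u v
        unfolding pencil_def by (auto intro!: derivative_eq_intros p)
      have "((\<lambda>t. Im (\<Sum>x\<in>?S. res N w (pencil (p t)) x x)) has_vector_derivative
         Im (- (\<Sum>u\<in>?S. \<Sum>v\<in>?S. of_real (\<Sum>k\<in>D. p' k * X k u v) * res2 N w (pencil (p t)) v u))) (at t)"
        by (intro bounded_linear.has_vector_derivative[OF bounded_linear_Im] has_vector_derivative_trace_res w sym_pencil dA)
      then have "((\<lambda>t. ptrace (p t)) has_real_derivative
         rho * Im (- (\<Sum>u\<in>?S. \<Sum>v\<in>?S. of_real (\<Sum>k\<in>D. p' k * X k u v) * res2 N w (pencil (p t)) v u))) (at t)"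
        unfolding ptrace_def has_real_derivative_iff_has_vector_derivative[symmetric] by (rule DERIV_cmult)
      also have "(\<Sum>u\<in>?S. \<Sum>v\<in>?S. of_real (\<Sum>k\<in>D. p' k * X k u v) * res2 N w (pencil (p t)) v u)
         = (\<Sum>k\<in>D. of_real (p' k) * (\<Sum>u\<in>?S. \<Sum>v\<in>?S. of_real (X k u v) * res2 N w (pencil (p t)) v u))"
      proof -
        have "(\<Sum>u\<in>?S. \<Sum>v\<in>?S. of_real (\<Sum>k\<in>D. p' k * X k u v) * res2 N w (pencil (p t)) v u)
          = (\<Sum>u\<in>?S. \<Sum>v\<in>?S. \<Sum>k\<in>D. of_real (p' k) * (of_real (X k u v) * res2 N w (pencil (p t)) v u))"
          by (simp add: sum_distrib_right mult.assoc)
        also have "\<dots> = (\<Sum>u\<in>?S. \<Sum>k\<in>D. \<Sum>v\<in>?S. of_real (p' k) * (of_real (X k u v) * res2 N w (pencil (p t)) v u))"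
          by (rule sum.cong[OF refl], rule sum.swap)
        also have "\<dots> = (\<Sum>k\<in>D. \<Sum>u\<in>?S. \<Sum>v\<in>?S. of_real (p' k) * (of_real (X k u v) * res2 N w (pencil (p t)) v u))"
          by (rule sum.swap)
        finally show ?thesis by (simp only: sum_distrib_left)
      qed
      also have "rho * Im (- \<dots>) = (\<Sum>k\<in>D. p' k * ptrace1 k (p t))"
      proof -
        have "Im (complex_of_real r * z) = r * Im z" for r z by simp
        then have "rho * Im (- (\<Sum>k\<in>D. of_real (p' k) * z k)) = (\<Sum>k\<in>D. p' k * (- rho * Im (z k)))" for z
          by (simp add: Im_sum sum_distrib_left sum_negf mult_ac)
        then show ?thesis unfolding ptrace1_def .
      qed
      finally show ?thesis .
    qed
    show "((\<lambda>y. ptrace1 k (b(k := y))) has_real_derivative ptrace2 k (b(k := y))) (at y)" if k: "k \<in> D" for k b y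
    proof -
      have dA: "((\<lambda>t. pencil (b(k := t)) u v) has_real_derivative X k u v) (at y)" for u v
      proof -
        have "pencil (b(k := t)) u v = t * X k u v + (A0 u v + (\<Sum>j\<in>D - {k}. b j * X j u v))" for t
          unfolding pencil_def using D k by (subst sum.remove[of D k]) auto
        then show ?thesis by (auto intro!: derivative_eq_intros)
      qed
      let ?R = "res N w (pencil (b(k := y)))" and ?R2 = "res2 N w (pencil (b(k := y)))"
      have "((\<lambda>t. Im (\<Sum>u\<in>?S. \<Sum>v\<in>?S. of_real (X k u v) * res2 N w (pencil (b(k := t))) v u)) has_vector_derivative
         Im (\<Sum>u\<in>?S. \<Sum>v\<in>?S. of_real (X k u v) * (- (\<Sum>i\<in>?S. \<Sum>j\<in>?S. of_real (X k i j) *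
           (?R v i * ?R2 j u + ?R2 v i * ?R j u))))) (at y)"
        by (intro bounded_linear.has_vector_derivative[OF bounded_linear_Im] has_vector_derivative_sum
            bounded_linear.has_vector_derivative[OF bounded_linear_mult_right] has_vector_derivative_res2 w sym_pencil dA)
      then have "((\<lambda>t. ptrace1 k (b(k := t))) has_real_derivative
         - rho * Im (\<Sum>u\<in>?S. \<Sum>v\<in>?S. of_real (X k u v) * (- (\<Sum>i\<in>?S. \<Sum>j\<in>?S. of_real (X k i j) *
           (?R v i * ?R2 j u + ?R2 v i * ?R j u))))) (at y)"
        unfolding ptrace1_def has_real_derivative_iff_has_vector_derivative[symmetric] by (rule DERIV_cmult)
      then show ?thesis by (simp only: ptrace2_def mult_minus_right mult_minus_left sum_negf uminus_complex.sel minus_minus)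
    qed
    show "isCont (\<lambda>t. ptrace1 k (p t)) t" if "\<And>k. k \<in> D \<Longrightarrow> isCont (\<lambda>t. p t k) t" for k p and t :: real
      unfolding ptrace1_def by (intro continuous_intros continuous_Im isCont_res2 w sym_pencil pencil_cont that)
    show "isCont (\<lambda>t. ptrace2 k (p t)) t" if "\<And>k. k \<in> D \<Longrightarrow> isCont (\<lambda>t. p t k) t" for k p and t :: real
      unfolding ptrace2_def by (intro continuous_intros continuous_Im isCont_res isCont_res2 w sym_pencil pencil_cont that)
  qed
  then show ?thesis ..
qed

end

section \<open>The ultrametric ensemble\<close>

text \<open>The standard deviation of the level-r contribution to the entry (u, v), with the weight
  of the level included.\<close>

definition coef :: "real \<Rightarrow> nat \<Rightarrow> nat \<Rightarrow> nat \<Rightarrow> real" where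
  "coef c r u v = 2 powr (- (1 + c) * real r / 2) * sqrt (phi_var r u v)"

lemma hdist_sym: "hdist x y = hdist y x"
  by (simp add: hdist_def eq_commute)

lemma coef_sym: "coef c r u v = coef c r v u"
  by (simp add: coef_def phi_var_def hdist_sym eq_commute[of u v])

lemma coef_min_max: "coef c r (min u v) (max u v) = coef c r u v"
  by (cases "u \<le> v") (auto simp: min_def max_def coef_sym)

lemma phi_var_ge_0: "0 \<le> phi_var r x y"
  by (simp add: phi_var_def)

text \<open>The exponent 2 + c consists of 1 + c from the squared weight and 1 from the variance;
  the factor 2 is that of the diagonal.\<close>

lemma coef_square_le: "(coef c r u v)\<^sup>2 \<le> 2 * 2 powr (- (2 + c) * real r)"
proof -
  have "(coef c r u v)\<^sup>2 = (2 powr (- (1 + c) * real r / 2))\<^sup>2 * phi_var r u v"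
    using phi_var_ge_0 by (simp add: coef_def power_mult_distrib)
  also have "(2 powr (- (1 + c) * real r / 2))\<^sup>2 = 2 powr (- (1 + c) * real r)"
    by (simp add: powr_powr powr_realpow[symmetric] flip: powr_numeral)
  also have "2 powr (- (1 + c) * real r) * phi_var r u v \<le> 2 powr (- (1 + c) * real r) * (2 * 2 powr (- real r))"
    by (intro mult_left_mono) (auto simp: phi_var_def)
  also have "\<dots> = 2 * 2 powr (- (1 + c) * real r + - real r)" unfolding powr_add by simp
  also have "- (1 + c) * real r + - real r = - (2 + c) * real r" by (simp add: algebra_simps)
  finally show ?thesis .
qed

lemma coef_0_diag: "coef c 0 x x = sqrt 2"
  by (simp add: coef_def phi_var_def)

lemma Hnm_eq: "Hnm c m a u v = (\<Sum>r\<in>{0..m}. coef c r u v * a (r, min u v, max u v))"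
  by (simp add: Hnm_def Phi_def coef_def mult.assoc)

lemma sym_Hnm: "sym_on N (Hnm c m a)"
  by (auto simp: sym_on_def Hnm_eq coef_sym min.commute max.commute intro!: sum.cong)

text \<open>The Gaussian of index (0, x, x) acts as a rank-one bump, with \<open>sqrt 2\<close>
  because its variance is 2. Level 0 is present for every m, which provides the randomness for the
  averaging.\<close>

lemma Hnm_update_diag: "Hnm c m (a((0, x, x) := s)) = bump (Hnm c m (a((0, x, x) := 0))) x (sqrt 2 * s)"
proof (intro ext)
  fix u v
  have z: "(0::nat) \<in> {0..m}" "finite {0..m}" by auto
  have "(\<Sum>r\<in>{0..m} - {0}. coef c r u v * (a((0, x, x) := s)) (r, min u v, max u v))
     = (\<Sum>r\<in>{0..m} - {0}. coef c r u v * (a((0, x, x) := 0)) (r, min u v, max u v))"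
    by (intro sum.cong) auto
  then show "Hnm c m (a((0, x, x) := s)) u v = bump (Hnm c m (a((0, x, x) := 0))) x (sqrt 2 * s) u v"
    unfolding Hnm_eq bump_def sum.remove[OF z(2,1)]
    by (auto simp: coef_0_diag min_def max_def)
qed

section \<open>Splitting the Gaussians into the levels up to m and above m\<close>

definition gidx_hi :: "nat \<Rightarrow> nat \<Rightarrow> (nat \<times> nat \<times> nat) set" where
  "gidx_hi m n = {k \<in> gidx n. m < fst k}"

definition gidx_lo :: "nat \<Rightarrow> nat \<Rightarrow> (nat \<times> nat \<times> nat) set" where
  "gidx_lo m n = {k \<in> gidx n. fst k \<le> m}"

lemma finite_gidx: "finite (gidx n)"
proof (rule finite_subset)
  show "gidx n \<subseteq> {0..n} \<times> {1..2 ^ n} \<times> {1..2 ^ n}" by (auto simp: gidx_def)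
qed auto

lemma finite_gidx_parts: "finite (gidx_hi m n)" "finite (gidx_lo m n)"
  using finite_gidx[of n] by (auto simp: gidx_hi_def gidx_lo_def)

lemma gidx_split: "gidx_lo m n \<union> gidx_hi m n = gidx n" "gidx_lo m n \<inter> gidx_hi m n = {}"
  by (auto simp: gidx_hi_def gidx_lo_def)

text \<open>The symmetric coefficient matrix of the Gaussian with index k; its only possible nonzero
  entries are the mirror images (x, y) and (y, x).\<close>

definition gentry :: "real \<Rightarrow> nat \<times> nat \<times> nat \<Rightarrow> nat \<Rightarrow> nat \<Rightarrow> real" where
  "gentry c k u v = (case k of (r, x, y) \<Rightarrow> if min u v = x \<and> max u v = y then coef c r x y else 0)"

lemma sym_gentry: "sym_on N (gentry c k)"
  by (auto simp: sym_on_def gentry_def min.commute max.commute split: prod.splits)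

lemma min_max_in_gidx:
  assumes "u \<in> {1..2 ^ n}" "v \<in> {1..2 ^ n}" "r \<le> n"
  shows "(r, min u v, max u v) \<in> gidx n"
  using assms by (auto simp: gidx_def min_def max_def)

lemma sum_gentry:
  assumes uv: "u \<in> {1..2 ^ n}" "v \<in> {1..2 ^ n}"
  shows "(\<Sum>k\<in>gidx_hi m n. b k * gentry c k u v) = (\<Sum>r\<in>{m<..n}. coef c r u v * b (r, min u v, max u v))"
proof -
  let ?i = "\<lambda>r. (r, min u v, max u v)"
  have "(\<Sum>k\<in>gidx_hi m n. b k * gentry c k u v) = (\<Sum>k\<in>?i ` {m<..n}. b k * gentry c k u v)"
  proof (rule sum.mono_neutral_right[OF finite_gidx_parts(1)])
    show "?i ` {m<..n} \<subseteq> gidx_hi m n" using min_max_in_gidx[OF uv] by (auto simp: gidx_hi_def)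
    show "\<forall>k\<in>gidx_hi m n - ?i ` {m<..n}. b k * gentry c k u v = 0"
      by (auto simp: gidx_hi_def gentry_def gidx_def split: if_splits)
  qed
  also have "\<dots> = (\<Sum>r\<in>{m<..n}. b (?i r) * gentry c (?i r) u v)"
    by (subst sum.reindex) (auto simp: inj_on_def)
  finally show ?thesis by (simp add: gentry_def coef_min_max mult.commute)
qed

text \<open>An inequality because for x = y the single entry is counted twice on the right.\<close>

lemma weighted_gentry_sum_le:
  fixes f :: "nat \<Rightarrow> nat \<Rightarrow> real"
  assumes f: "\<And>u v. 0 \<le> f u v"
  shows "(\<Sum>u=1..N. \<Sum>v=1..N. \<bar>gentry c (r, x, y) u v\<bar> * f u v) \<le> \<bar>coef c r x y\<bar> * (f x y + f y x)"
proof -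
  have "(\<Sum>u=1..N. \<Sum>v=1..N. \<bar>gentry c (r, x, y) u v\<bar> * f u v)
     \<le> (\<Sum>u=1..N. \<Sum>v=1..N. (if u = x then if v = y then \<bar>coef c r x y\<bar> * f x y else 0 else 0)
          + (if u = y then if v = x then \<bar>coef c r x y\<bar> * f y x else 0 else 0))"
    using f by (intro sum_mono) (auto simp: gentry_def min_def max_def)
  also have "\<dots> = (\<Sum>u=1..N. (if u = x then \<Sum>v=1..N. if v = y then \<bar>coef c r x y\<bar> * f x y else 0 else 0))
      + (\<Sum>u=1..N. (if u = y then \<Sum>v=1..N. if v = x then \<bar>coef c r x y\<bar> * f y x else 0 else 0))"
    by (simp add: sum.distrib if_distrib[of "\<lambda>t. sum t _"] sum.If_cases if_distribR) (auto intro!: sum.cong)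
  also have "\<dots> \<le> \<bar>coef c r x y\<bar> * f x y + \<bar>coef c r x y\<bar> * f y x"
    using f by (intro add_mono) (auto simp: sum.delta)
  finally show ?thesis by (simp add: distrib_left)
qed

text \<open>Pairs with x <= y are enlarged to all ordered pairs, and the block structure of the
  variances is given up for the uniform bound \<open>coef_square_le\<close>.\<close>

lemma sum_gidx_hi_le:
  fixes f :: "nat \<Rightarrow> nat \<Rightarrow> real"
  assumes f: "\<And>x y. 0 \<le> f x y"
  shows "(\<Sum>k\<in>gidx_hi m n. case k of (r, x, y) \<Rightarrow> (coef c r x y)\<^sup>2 * f x y)
    \<le> (\<Sum>r\<in>{m<..n}. 2 * 2 powr (- (2 + c) * real r)) * (\<Sum>x=1..2 ^ n. \<Sum>y=1..2 ^ n. f x y)"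
proof -
  let ?t = "\<lambda>r::nat. 2 * 2 powr (- (2 + c) * real r)"
  have "(\<Sum>k\<in>gidx_hi m n. case k of (r, x, y) \<Rightarrow> (coef c r x y)\<^sup>2 * f x y)
     \<le> (\<Sum>k\<in>gidx_hi m n. case k of (r, x, y) \<Rightarrow> ?t r * f x y)"
    using f coef_square_le by (intro sum_mono) (auto intro!: mult_right_mono)
  also have "\<dots> \<le> (\<Sum>k\<in>{m<..n} \<times> ({1..2 ^ n} \<times> {1..2 ^ n}). case k of (r, x, y) \<Rightarrow> ?t r * f x y)"
    using f by (intro sum_mono2) (auto simp: gidx_hi_def gidx_def)
  also have "\<dots> = (\<Sum>r\<in>{m<..n}. \<Sum>x=1..2 ^ n. \<Sum>y=1..2 ^ n. ?t r * f x y)"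
    by (simp add: sum.cartesian_product)
  also have "\<dots> = (\<Sum>r\<in>{m<..n}. ?t r) * (\<Sum>x=1..2 ^ n. \<Sum>y=1..2 ^ n. f x y)"
    unfolding sum_distrib_right unfolding sum_distrib_left ..
  finally show ?thesis .
qed

text \<open>Telescoping: with t_r = 2^(-(2 + c) r) the step is 2 t_(r+1) <= t_r - t_(r+1), that is 3
  t_(r+1) <= t_r, and the ratio of successive terms is at most 1/4.\<close>

lemma variance_sum_le:
  assumes "0 \<le> c" "m \<le> n"
  shows "(\<Sum>r\<in>{m<..n}. 2 * 2 powr (- (2 + c) * real r)) \<le> 2 powr (- (2 + c) * real m) - 2 powr (- (2 + c) * real n)"
  using assms(2)
proof (induction n rule: dec_induct)
  case base
  show ?case by simp
next
  case (step n)
  have "2 powr (- (2 + c) * real (Suc n)) = 2 powr (- (2 + c) * real n) * 2 powr (- (2 + c))"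
    by (simp add: powr_add[symmetric] algebra_simps)
  also have "\<dots> \<le> 2 powr (- (2 + c) * real n) * 2 powr (- 2)"
    using assms(1) by (intro mult_left_mono) auto
  also have "2 powr (- 2) = (1 / 4 :: real)" by (simp add: powr_minus_divide)
  finally have "3 * 2 powr (- (2 + c) * real (Suc n)) \<le> 2 powr (- (2 + c) * real n)"
    using powr_ge_zero[of 2 "- (2 + c) * real n"] by linarith
  moreover have "{m<..Suc n} = insert (Suc n) {m<..n}" using step.hyps by auto
  ultimately show ?case using step.IH by simp
qed

section \<open>Row sums of the resolvent and of its square\<close>

context
  fixes N :: nat and w :: complex and A :: "nat \<Rightarrow> nat \<Rightarrow> real"
  assumes w: "Im w > 0" and A: "sym_on N A"
begin

text \<open>By symmetry the modulus of (R^2)_xx is at most the squared norm of row x of R, to which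
  the Ward identity applies.\<close>

lemma norm_res2_diag_le:
  "cmod (res2 N w A x x) \<le> cmod (res N w A x x) / Im w"
proof -
  have "cmod (res2 N w A x x) \<le> (\<Sum>z=1..N. (cmod (res N w A x z))\<^sup>2)"
    unfolding res2_def by (intro order_trans[OF norm_sum] sum_mono) (simp add: norm_mult power2_eq_square res_sym[of N w A _ x])
  also have "\<dots> = Im (res N w A x x) / Im w" by (rule res_ward[OF w A])
  also have "\<dots> \<le> cmod (res N w A x x) / Im w"
    using w abs_Im_le_cmod[of "res N w A x x"] by (intro divide_right_mono) auto
  finally show ?thesis .
qed

lemma res_row_le: "(\<Sum>y=1..N. (cmod (res N w A x y))\<^sup>2) \<le> cmod (res N w A x x) / Im w"
  unfolding res_ward[OF w A] using w abs_Im_le_cmod[of "res N w A x x"] by (intro divide_right_mono) auto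

lemma res2_row_le: "(\<Sum>y=1..N. (cmod (res2 N w A x y))\<^sup>2) \<le> cmod (res N w A x x) / (Im w)^3"
proof -
  have "(\<Sum>y=1..N. (cmod (res2 N w A x y))\<^sup>2) \<le> (\<Sum>y=1..N. (cmod (res N w A x y))\<^sup>2) / (Im w)\<^sup>2"
    by (rule res2_norm_sum_le[OF w A])
  also have "\<dots> \<le> (cmod (res N w A x x) / Im w) / (Im w)\<^sup>2"
    using w by (intro divide_right_mono res_row_le) auto
  finally show ?thesis by (simp add: power3_eq_cube power2_eq_square mult.assoc)
qed

text \<open>The arithmetic-geometric inequality with R^2 scaled by Im w, which balances the two row
  bounds: that for R^2 is larger by 1 / (Im w)^2.\<close>

lemma res_res2_row_le:
  "(\<Sum>y=1..N. cmod (res N w A x y) * cmod (res2 N w A x y)) \<le> cmod (res N w A x x) / (Im w)\<^sup>2"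
proof -
  have "cmod (res N w A x y) * cmod (res2 N w A x y) \<le>
      (cmod (res N w A x y))\<^sup>2 / (2 * Im w) + Im w / 2 * (cmod (res2 N w A x y))\<^sup>2" for y
  proof -
    have "0 \<le> (cmod (res N w A x y) - Im w * cmod (res2 N w A x y))\<^sup>2" by simp
    then have "2 * Im w * (cmod (res N w A x y) * cmod (res2 N w A x y))
       \<le> (cmod (res N w A x y))\<^sup>2 + (Im w)\<^sup>2 * (cmod (res2 N w A x y))\<^sup>2"
      by (simp add: power2_diff power_mult_distrib mult_ac)
    then show ?thesis using w by (simp add: field_simps power2_eq_square)
  qed
  then have "(\<Sum>y=1..N. cmod (res N w A x y) * cmod (res2 N w A x y))
     \<le> (\<Sum>y=1..N. (cmod (res N w A x y))\<^sup>2 / (2 * Im w) + Im w / 2 * (cmod (res2 N w A x y))\<^sup>2)"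
    by (intro sum_mono)
  also have "\<dots> = (\<Sum>y=1..N. (cmod (res N w A x y))\<^sup>2) / (2 * Im w) + Im w / 2 * (\<Sum>y=1..N. (cmod (res2 N w A x y))\<^sup>2)"
    by (simp add: sum.distrib sum_divide_distrib sum_distrib_left)
  also have "\<dots> \<le> (cmod (res N w A x x) / Im w) / (2 * Im w) + Im w / 2 * (cmod (res N w A x x) / (Im w)^3)"
    using w by (intro add_mono divide_right_mono mult_left_mono res_row_le res2_row_le) auto
  also have "\<dots> = cmod (res N w A x x) / (Im w)\<^sup>2"
    using w by (simp add: field_simps power2_eq_square power3_eq_cube)
  finally show ?thesis .
qed

text \<open>The left summand is, up to a factor, what Tr (X R X R^2 + X R^2 X R) yields for X
  supported at (x, y) and (y, x). Diagonal entries of R^2 are first traded for R_xx / Im w. Of the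
  constant 4, one 2 comes from the R_xy^2 part of R_xx R_yy and the other from the off-diagonal
  products; for x = y the minor vanishes.\<close>

lemma drift_integrand_le:
  "(\<Sum>x=1..N. \<Sum>y=1..N. cmod (res N w A y y) * cmod (res2 N w A x x) + cmod (res N w A x x) * cmod (res2 N w A y y)
      + 2 * (cmod (res N w A x y) * cmod (res2 N w A x y)))
    \<le> 2 / Im w * (\<Sum>x=1..N. \<Sum>y\<in>{1..N} - {x}. cmod (minor2 N w A x y)) + 4 / (Im w)\<^sup>2 * (\<Sum>x=1..N. cmod (res N w A x x))"
proof -
  let ?S = "{1..N}"
  let ?R = "\<lambda>x y. cmod (res N w A x y)" and ?M = "\<lambda>x y. cmod (minor2 N w A x y)"
  have pair: "?R x x * ?R y y \<le> (if x = y then 0 else ?M x y) + (?R x y)\<^sup>2" for x y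
  proof (cases "x = y")
    case False
    have "res N w A x x * res N w A y y = minor2 N w A x y + (res N w A x y)\<^sup>2" by (simp add: minor2_def)
    then have "?R x x * ?R y y \<le> ?M x y + (?R x y)\<^sup>2"
      by (metis norm_mult norm_power norm_triangle_ineq)
    then show ?thesis using False by simp
  qed (simp add: power2_eq_square)
  have "(\<Sum>y\<in>?S. ?R x x * ?R y y) \<le> (\<Sum>y\<in>?S - {x}. ?M x y) + ?R x x / Im w" if "x \<in> ?S" for x
  proof -
    have "(\<Sum>y\<in>?S. ?R x x * ?R y y) \<le> (\<Sum>y\<in>?S. (if x = y then 0 else ?M x y) + (?R x y)\<^sup>2)"
      by (intro sum_mono pair)
    also have "\<dots> = (\<Sum>y\<in>?S. if x = y then 0 else ?M x y) + (\<Sum>y\<in>?S. (?R x y)\<^sup>2)"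
      by (rule sum.distrib)
    also have "(\<Sum>y\<in>?S. if x = y then 0 else ?M x y) = (\<Sum>y\<in>?S - {x}. ?M x y)"
      using that by (subst sum.remove[of ?S x]) (auto intro!: sum.cong)
    finally show ?thesis using res_row_le[of x] by linarith
  qed
  then have P: "(\<Sum>x\<in>?S. \<Sum>y\<in>?S. ?R x x * ?R y y) \<le> (\<Sum>x\<in>?S. (\<Sum>y\<in>?S - {x}. ?M x y) + ?R x x / Im w)"
    by (intro sum_mono)
  have Q: "(\<Sum>x\<in>?S. \<Sum>y\<in>?S. ?R x y * cmod (res2 N w A x y)) \<le> (\<Sum>x\<in>?S. ?R x x / (Im w)\<^sup>2)"
    by (intro sum_mono res_res2_row_le)
  have "(\<Sum>x\<in>?S. \<Sum>y\<in>?S. ?R y y * cmod (res2 N w A x x) + ?R x x * cmod (res2 N w A y y) + 2 * (?R x y * cmod (res2 N w A x y)))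
     \<le> (\<Sum>x\<in>?S. \<Sum>y\<in>?S. ?R y y * (?R x x / Im w) + ?R x x * (?R y y / Im w) + 2 * (?R x y * cmod (res2 N w A x y)))"
    by (intro sum_mono add_mono mult_left_mono norm_res2_diag_le) auto
  also have "\<dots> = 2 / Im w * (\<Sum>x\<in>?S. \<Sum>y\<in>?S. ?R x x * ?R y y) + 2 * (\<Sum>x\<in>?S. \<Sum>y\<in>?S. ?R x y * cmod (res2 N w A x y))"
    by (simp add: sum.distrib sum_distrib_left mult_ac)
  also have "\<dots> \<le> 2 / Im w * (\<Sum>x\<in>?S. (\<Sum>y\<in>?S - {x}. ?M x y) + ?R x x / Im w) + 2 * (\<Sum>x\<in>?S. ?R x x / (Im w)\<^sup>2)"
    using P Q w by (intro add_mono mult_left_mono) auto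
  also have "\<dots> = 2 / Im w * (\<Sum>x\<in>?S. \<Sum>y\<in>?S - {x}. ?M x y) + 4 / (Im w)\<^sup>2 * (\<Sum>x\<in>?S. ?R x x)"
    unfolding sum.distrib sum_divide_distrib[symmetric] using w by (simp add: field_simps power2_eq_square)
  finally show ?thesis .
qed

end

section \<open>Gradient and Laplacian with respect to the levels above m\<close>

locale ultrametric =
  fixes c :: real and m n :: nat and w :: complex
  assumes c: "0 \<le> c" and mn: "m \<le> n" and w: "Im w > 0"
begin

abbreviation "N \<equiv> (2::nat) ^ n"
abbreviation "rho \<equiv> 2 powr (- real n)"
abbreviation "lo \<equiv> gidx_lo m n"
abbreviation "hi \<equiv> gidx_hi m n"
abbreviation "tau \<equiv> 2 powr (- (2 + c) * real m)"

text \<open>The parameter a freezes the levels up to m inside the constant term; the Gaussians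
  indexed by \<open>hi\<close> are the variables, and rho = 1 / N.\<close>

sublocale linear_pencil N w rho hi "Hnm c m a" "gentry c" for a
  by unfold_locales (auto simp: w finite_gidx_parts sym_Hnm sym_gentry)

lemma tau_ge: "(\<Sum>r\<in>{m<..n}. 2 * 2 powr (- (2 + c) * real r)) \<le> tau"
  using variance_sum_le[OF c mn] powr_ge_zero[of 2 "- (2 + c) * real n"] by linarith

lemma Hnm_merge:
  assumes uv: "u \<in> {1..N}" "v \<in> {1..N}"
  shows "Hnm c n (merge lo hi (a, b)) u v = pencil a b u v"
    and "Hnm c m (merge lo hi (a, b)) u v = pencil a (scale_on hi 0 b0) u v"
proof -
  have lo: "(r, min u v, max u v) \<in> lo" if "r \<le> m" for r
    using min_max_in_gidx[OF uv, of r] that mn by (simp add: gidx_lo_def)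
  have hi: "(r, min u v, max u v) \<in> hi" "(r, min u v, max u v) \<notin> lo" if "m < r" "r \<le> n" for r
    using min_max_in_gidx[OF uv, of r] that by (auto simp: gidx_hi_def gidx_lo_def)
  have low: "(\<Sum>r\<in>{0..m}. coef c r u v * merge lo hi (a, b) (r, min u v, max u v)) = Hnm c m a u v"
    unfolding Hnm_eq by (intro sum.cong refl) (simp add: lo merge_def)
  have "{0..n} = {0..m} \<union> {m<..n}" "{0..m} \<inter> {m<..n} = {}" using mn by auto
  then have "Hnm c n (merge lo hi (a, b)) u v =
     Hnm c m a u v + (\<Sum>r\<in>{m<..n}. coef c r u v * merge lo hi (a, b) (r, min u v, max u v))"
    unfolding Hnm_eq[of c n] by (simp add: sum.union_disjoint low)
  also have "(\<Sum>r\<in>{m<..n}. coef c r u v * merge lo hi (a, b) (r, min u v, max u v))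
     = (\<Sum>r\<in>{m<..n}. coef c r u v * b (r, min u v, max u v))"
    by (intro sum.cong refl) (simp add: hi merge_def)
  finally show "Hnm c n (merge lo hi (a, b)) u v = pencil a b u v"
    unfolding pencil_def sum_gentry[OF uv] .
  show "Hnm c m (merge lo hi (a, b)) u v = pencil a (scale_on hi 0 b0) u v"
    unfolding pencil_def using low by (simp add: Hnm_eq scale_on_def)
qed

text \<open>Identifies the difference of the two measures with the displacement of
  \<open>ptrace a\<close> from the origin, the form treated by
  \<open>expected_displacement_le\<close>.\<close>

lemma nu_merge:
  "nu_n c n (merge lo hi (a, b)) (poisson w) = ptrace a b"
  "nu_nm c n m (merge lo hi (a, b)) (poisson w) = ptrace a (scale_on hi 0 b0)"
  unfolding nu_n_def nu_nm_def mtrace_matfun_poisson[OF sym_Hnm] ptrace_def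
  using res_cong[of N "Hnm c n (merge lo hi (a, b))" "pencil a b" w]
    res_cong[of N "Hnm c m (merge lo hi (a, b))" "pencil a (scale_on hi 0 b0)" w] Hnm_merge
  by simp_all

text \<open>The two mirror entries of \<open>gentry c k\<close> give a factor 2, squared to 4; the
  entries of R^2 are then summed row by row with \<open>res2_row_le\<close>.\<close>

lemma gradient_le:
  "(\<Sum>k\<in>hi. (ptrace1 a k b)\<^sup>2) \<le> 4 * rho\<^sup>2 * tau / (Im w)^3 * (\<Sum>x=1..N. cmod (res N w (pencil a b) x x))"
proof -
  let ?S = "{1..N}"
  let ?A = "pencil a b"
  let ?f = "\<lambda>x y. (cmod (res2 N w ?A x y))\<^sup>2"
  have "(ptrace1 a k b)\<^sup>2 \<le> 4 * rho\<^sup>2 * (case k of (r, x, y) \<Rightarrow> (coef c r x y)\<^sup>2 * ?f x y)" for k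
  proof -
    obtain r x y where k: "k = (r, x, y)" by (cases k)
    have "\<bar>ptrace1 a k b\<bar> \<le> rho * (\<Sum>u\<in>?S. \<Sum>v\<in>?S. \<bar>gentry c k u v\<bar> * cmod (res2 N w ?A v u))"
      unfolding ptrace1_def abs_mult abs_minus_cancel abs_of_nonneg[OF powr_ge_zero]
      by (intro mult_left_mono order_trans[OF abs_Im_le_cmod] order_trans[OF norm_sum] sum_mono)
        (auto simp: norm_mult)
    also have "\<dots> \<le> rho * (\<bar>coef c r x y\<bar> * (cmod (res2 N w ?A y x) + cmod (res2 N w ?A x y)))"
      unfolding k by (intro mult_left_mono weighted_gentry_sum_le) auto
    also have "\<dots> = 2 * rho * \<bar>coef c r x y\<bar> * cmod (res2 N w ?A x y)"
      by (simp add: res2_sym[of N w ?A y x])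
    finally have "\<bar>ptrace1 a k b\<bar>\<^sup>2 \<le> (2 * rho * \<bar>coef c r x y\<bar> * cmod (res2 N w ?A x y))\<^sup>2"
      by (intro power_mono) auto
    then show ?thesis by (simp add: k power_mult_distrib mult_ac)
  qed
  then have "(\<Sum>k\<in>hi. (ptrace1 a k b)\<^sup>2) \<le> 4 * rho\<^sup>2 * (\<Sum>k\<in>hi. case k of (r, x, y) \<Rightarrow> (coef c r x y)\<^sup>2 * ?f x y)"
    unfolding sum_distrib_left by (intro sum_mono)
  also have "\<dots> \<le> 4 * rho\<^sup>2 * ((\<Sum>r\<in>{m<..n}. 2 * 2 powr (- (2 + c) * real r)) * (\<Sum>x\<in>?S. \<Sum>y\<in>?S. ?f x y))"
    by (intro mult_left_mono sum_gidx_hi_le) auto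
  also have "\<dots> \<le> 4 * rho\<^sup>2 * (tau * (\<Sum>x\<in>?S. cmod (res N w ?A x x) / (Im w)^3))"
    using tau_ge res2_row_le[OF w sym_pencil]
    by (intro mult_left_mono mult_mono sum_mono) (auto intro!: sum_nonneg)
  also have "\<dots> = 4 * rho\<^sup>2 * tau / (Im w)^3 * (\<Sum>x\<in>?S. cmod (res N w ?A x x))"
    by (simp add: sum_divide_distrib[symmetric])
  finally show ?thesis .
qed

lemma laplacian_le:
  "\<bar>\<Sum>k\<in>hi. ptrace2 a k b\<bar> \<le> 4 * rho * tau / Im w * (\<Sum>x=1..N. \<Sum>y\<in>{1..N} - {x}. cmod (minor2 N w (pencil a b) x y))
    + 8 * rho * tau / (Im w)\<^sup>2 * (\<Sum>x=1..N. cmod (res N w (pencil a b) x x))"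
proof -
  let ?S = "{1..N}"
  let ?A = "pencil a b"
  let ?R = "\<lambda>x y. cmod (res N w ?A x y)" and ?R2 = "\<lambda>x y. cmod (res2 N w ?A x y)"
  let ?f = "\<lambda>x y. ?R y y * ?R2 x x + ?R x x * ?R2 y y + 2 * (?R x y * ?R2 x y)"
  have "\<bar>ptrace2 a k b\<bar> \<le> 2 * rho * (case k of (r, x, y) \<Rightarrow> (coef c r x y)\<^sup>2 * ?f x y)" for k
  proof -
    obtain r x y where k: "k = (r, x, y)" by (cases k)
    let ?g = "\<lambda>u v i j. ?R v i * ?R2 j u + ?R2 v i * ?R j u"
    let ?C = "\<bar>coef c r x y\<bar>"
    have "\<bar>ptrace2 a k b\<bar> \<le> rho * (\<Sum>u\<in>?S. \<Sum>v\<in>?S. \<bar>gentry c k u v\<bar> *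
       (\<Sum>i\<in>?S. \<Sum>j\<in>?S. \<bar>gentry c k i j\<bar> * ?g u v i j))"
      unfolding ptrace2_def abs_mult abs_of_nonneg[OF powr_ge_zero]
    proof (intro mult_left_mono order_trans[OF abs_Im_le_cmod] order_trans[OF norm_sum] sum_mono)
      fix u v
      show "cmod (of_real (gentry c k u v) * (\<Sum>i\<in>?S. \<Sum>j\<in>?S. of_real (gentry c k i j) *
          (res N w ?A v i * res2 N w ?A j u + res2 N w ?A v i * res N w ?A j u)))
        \<le> \<bar>gentry c k u v\<bar> * (\<Sum>i\<in>?S. \<Sum>j\<in>?S. \<bar>gentry c k i j\<bar> * ?g u v i j)"
        unfolding norm_mult norm_of_real
        by (intro mult_left_mono order_trans[OF norm_sum] sum_mono)
          (auto simp: norm_mult intro!: mult_left_mono order_trans[OF norm_triangle_ineq])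
    qed auto
    also have "\<dots> \<le> rho * (\<Sum>u\<in>?S. \<Sum>v\<in>?S. \<bar>gentry c k u v\<bar> * (?C * (?g u v x y + ?g u v y x)))"
      unfolding k by (intro mult_left_mono sum_mono weighted_gentry_sum_le) auto
    \<comment> \<open>Both coefficient matrices are now reduced to their two entries. The four terms
      pair up by symmetry, which yields the factor 2 in front of \<open>?f\<close>.\<close>
    also have "\<dots> \<le> rho * (?C * (?C * (?g x y x y + ?g x y y x) + ?C * (?g y x x y + ?g y x y x)))"
      unfolding k by (intro mult_left_mono weighted_gentry_sum_le) auto
    also have "\<dots> = 2 * rho * (\<bar>coef c r x y\<bar> * \<bar>coef c r x y\<bar> * ?f x y)"
      by (simp add: res_sym[of N w ?A y x] res2_sym[of N w ?A y x] algebra_simps)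
    finally show ?thesis by (simp add: k power2_eq_square)
  qed
  then have "\<bar>\<Sum>k\<in>hi. ptrace2 a k b\<bar> \<le> 2 * rho * (\<Sum>k\<in>hi. case k of (r, x, y) \<Rightarrow> (coef c r x y)\<^sup>2 * ?f x y)"
    unfolding sum_distrib_left by (intro order_trans[OF sum_abs] sum_mono)
  also have "\<dots> \<le> 2 * rho * ((\<Sum>r\<in>{m<..n}. 2 * 2 powr (- (2 + c) * real r)) * (\<Sum>x\<in>?S. \<Sum>y\<in>?S. ?f x y))"
    by (intro mult_left_mono sum_gidx_hi_le) auto
  also have "\<dots> \<le> 2 * rho * (tau * (2 / Im w * (\<Sum>x\<in>?S. \<Sum>y\<in>?S - {x}. cmod (minor2 N w ?A x y))
      + 4 / (Im w)\<^sup>2 * (\<Sum>x\<in>?S. ?R x x)))"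
    by (intro mult_left_mono mult_mono tau_ge drift_integrand_le[OF w sym_pencil]) (auto intro!: sum_nonneg)
  also have "\<dots> = 4 * rho * tau / Im w * (\<Sum>x\<in>?S. \<Sum>y\<in>?S - {x}. cmod (minor2 N w ?A x y))
    + 8 * rho * tau / (Im w)\<^sup>2 * (\<Sum>x\<in>?S. ?R x x)"
    by (simp add: algebra_simps)
  finally show ?thesis .
qed

end

section \<open>Averaging over the low levels and the joint bound\<close>

context ultrametric
begin

abbreviation "P \<equiv> gaussP lo"
abbreviation "Q \<equiv> gaussP hi"
abbreviation "L \<equiv> 1 + 4 * ln (1 + sqrt 2 / Im w)"

definition S1 :: "(nat \<times> nat \<times> nat \<Rightarrow> real) \<Rightarrow> (nat \<times> nat \<times> nat \<Rightarrow> real) \<Rightarrow> real" where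
  "S1 a b = (\<Sum>x=1..N. cmod (res N w (pencil a b) x x))"

definition S2 :: "(nat \<times> nat \<times> nat \<Rightarrow> real) \<Rightarrow> (nat \<times> nat \<times> nat \<Rightarrow> real) \<Rightarrow> real" where
  "S2 a b = (\<Sum>x=1..N. \<Sum>y\<in>{1..N} - {x}. cmod (minor2 N w (pencil a b) x y))"

lemma S_ge_0: "0 \<le> S1 a b" "0 \<le> S2 a b"
  by (auto simp: S1_def S2_def intro!: sum_nonneg)

lemma L_ge_0: "0 \<le> L"
  using w by simp

lemma res_joint_meas:
  assumes a: "a \<in> measurable M P" and b: "b \<in> measurable M Q" and xy: "x \<in> {1..N}" "y \<in> {1..N}"
  shows "(\<lambda>p. res N w (pencil (a p) (b p)) x y) \<in> borel_measurable M"
proof (rule borel_measurable_res[OF w sym_pencil _ xy])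
  fix u v assume uv: "u \<in> {1..N}" "v \<in> {1..N}"
  have ma: "(\<lambda>p. a p k) \<in> borel_measurable M" if "k \<in> lo" for k
    using measurable_compose[OF a measurable_component_singleton[OF that]] by simp
  have mb: "(\<lambda>p. b p k) \<in> borel_measurable M" if "k \<in> hi" for k
    using measurable_compose[OF b measurable_component_singleton[OF that]] by simp
  have "(r, min u v, max u v) \<in> lo" if "r \<le> m" for r
    using min_max_in_gidx[OF uv, of r] that mn by (simp add: gidx_lo_def)
  then show "(\<lambda>p. pencil (a p) (b p) u v) \<in> borel_measurable M"
    unfolding pencil_def Hnm_eq
    by (intro borel_measurable_add borel_measurable_sum borel_measurable_times borel_measurable_const ma mb) auto
qed

lemma S1_meas:
  assumes "a \<in> measurable M P" "b \<in> measurable M Q"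
  shows "(\<lambda>p. S1 (a p) (b p)) \<in> borel_measurable M"
proof -
  have "(\<lambda>p. cmod (res N w (pencil (a p) (b p)) x x)) \<in> borel_measurable M" if "x \<in> {1..N}" for x
    using res_joint_meas[OF assms that that] by measurable
  then show ?thesis unfolding S1_def by (intro borel_measurable_sum)
qed

lemma S2_meas:
  assumes "a \<in> measurable M P" "b \<in> measurable M Q"
  shows "(\<lambda>p. S2 (a p) (b p)) \<in> borel_measurable M"
proof -
  have "(\<lambda>p. cmod (minor2 N w (pencil (a p) (b p)) x y)) \<in> borel_measurable M" if "x \<in> {1..N}" "y \<in> {1..N} - {x}" for x y
  proof -
    have y: "y \<in> {1..N}" using that by auto
    show ?thesis unfolding minor2_def
      using res_joint_meas[OF assms that(1) that(1)] res_joint_meas[OF assms that(1) y] res_joint_meas[OF assms y y]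
      by measurable
  qed
  then show ?thesis unfolding S2_def by (intro borel_measurable_sum)
qed

lemma pencil_update_diag: "pencil (a((0, x, x) := s)) b = bump (pencil (a((0, x, x) := 0)) b) x (sqrt 2 * s)"
proof (intro ext)
  fix u v
  show "pencil (a((0, x, x) := s)) b u v = bump (pencil (a((0, x, x) := 0)) b) x (sqrt 2 * s) u v"
    unfolding bump_def pencil_def fun_cong[OF fun_cong[OF Hnm_update_diag[of c m a x s]], of u v] by simp
qed

lemma diag_in_lo: "x \<in> {1..N} \<Longrightarrow> (0, x, x) \<in> lo"
  by (auto simp: gidx_lo_def gidx_def)

lemma pencil_meas_lo:
  assumes uv: "u \<in> {1..N}" "v \<in> {1..N}"
  shows "(\<lambda>a. pencil a b u v) \<in> borel_measurable P"
proof -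
  have ma: "(\<lambda>a. a k) \<in> borel_measurable P" if "k \<in> lo" for k
    using measurable_component_singleton[OF that, of "\<lambda>_. gauss"] by simp
  have "(r, min u v, max u v) \<in> lo" if "r \<le> m" for r
    using min_max_in_gidx[OF uv, of r] that mn by (simp add: gidx_lo_def)
  then show ?thesis
    unfolding pencil_def Hnm_eq
    by (intro borel_measurable_add borel_measurable_sum borel_measurable_times borel_measurable_const ma) auto
qed

text \<open>The variables (0, x, x) are low for every m, so b is arbitrary here. The bound is
  uniform in b and hence applies at the scaled points \<open>scale_on hi t b\<close> as
  well.\<close>

lemma average_S1: "(\<integral>\<^sup>+ a. ennreal (S1 a b) \<partial>P) \<le> ennreal (real N * L)"
proof -
  have m: "(\<lambda>a. ennreal (cmod (res N w (pencil a b) x x))) \<in> borel_measurable P" if "x \<in> {1..N}" for x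
    using borel_measurable_res[OF w sym_pencil pencil_meas_lo that that] by measurable
  have "(\<integral>\<^sup>+ a. ennreal (S1 a b) \<partial>P) = (\<integral>\<^sup>+ a. (\<Sum>x=1..N. ennreal (cmod (res N w (pencil a b) x x))) \<partial>P)"
    unfolding S1_def by (simp add: sum_ennreal)
  also have "\<dots> = (\<Sum>x=1..N. \<integral>\<^sup>+ a. ennreal (cmod (res N w (pencil a b) x x)) \<partial>P)"
    by (rule nn_integral_sum) (rule m)
  also have "\<dots> \<le> (\<Sum>x=1..N. ennreal L)"
    by (intro sum_mono average_res_diag[OF w _ sym_pencil pencil_meas_lo finite_gidx_parts(2) diag_in_lo _ pencil_update_diag]) auto
  also have "\<dots> = ennreal (real N * L)"
    using L_ge_0 by (simp add: ennreal_mult'' ennreal_of_nat_eq_real_of_nat)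
  finally show ?thesis .
qed

lemma average_S2: "(\<integral>\<^sup>+ a. ennreal (S2 a b) \<partial>P) \<le> ennreal ((real N)\<^sup>2 * L\<^sup>2)"
proof -
  have m: "(\<lambda>a. ennreal (cmod (minor2 N w (pencil a b) x y))) \<in> borel_measurable P"
    if x: "x \<in> {1..N}" and y: "y \<in> {1..N}" for x y
    unfolding minor2_def
    using borel_measurable_res[OF w sym_pencil pencil_meas_lo x x] borel_measurable_res[OF w sym_pencil pencil_meas_lo x y]
      borel_measurable_res[OF w sym_pencil pencil_meas_lo y y] by measurable
  have "(\<integral>\<^sup>+ a. ennreal (S2 a b) \<partial>P)
      = (\<integral>\<^sup>+ a. (\<Sum>x=1..N. \<Sum>y\<in>{1..N} - {x}. ennreal (cmod (minor2 N w (pencil a b) x y))) \<partial>P)"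
    unfolding S2_def by (simp add: sum_ennreal sum_nonneg)
  also have "\<dots> = (\<Sum>x=1..N. \<integral>\<^sup>+ a. (\<Sum>y\<in>{1..N} - {x}. ennreal (cmod (minor2 N w (pencil a b) x y))) \<partial>P)"
    by (rule nn_integral_sum) (intro borel_measurable_sum m; auto)
  also have "\<dots> = (\<Sum>x=1..N. \<Sum>y\<in>{1..N} - {x}. \<integral>\<^sup>+ a. ennreal (cmod (minor2 N w (pencil a b) x y)) \<partial>P)"
    by (intro sum.cong refl nn_integral_sum m) auto
  also have "\<dots> \<le> (\<Sum>x=1..N. \<Sum>y\<in>{1..N} - {x}. ennreal (L\<^sup>2))"
    by (intro sum_mono average_minor2[OF w _ sym_pencil pencil_meas_lo finite_gidx_parts(2) diag_in_lo _ pencil_update_diag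
        diag_in_lo _ _ _ pencil_update_diag]) auto
  also have "\<dots> \<le> (\<Sum>x=1..N. \<Sum>y=1..N. ennreal (L\<^sup>2))"
    by (intro sum_mono sum_mono2) auto
  also have "\<dots> = ennreal ((real N)\<^sup>2 * L\<^sup>2)"
    by (simp add: ennreal_mult'' ennreal_of_nat_eq_real_of_nat power2_eq_square mult.assoc)
  finally show ?thesis .
qed

lemma nu_meas:
  assumes "m' \<le> n"
  shows "(\<lambda>a. nu_nm c n m' a (poisson w)) \<in> borel_measurable (gaussP (gidx n))"
proof -
  have R: "(\<lambda>a. res N w (Hnm c m' a) x x) \<in> borel_measurable (gaussP (gidx n))" if x: "x \<in> {1..N}" for x
  proof (rule borel_measurable_res[OF w sym_Hnm _ x x])
    fix u v assume uv: "u \<in> {1..N}" "v \<in> {1..N}"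
    have "(\<lambda>a. a (r, min u v, max u v)) \<in> borel_measurable (gaussP (gidx n))" if "r \<in> {0..m'}" for r
      using measurable_component_singleton[OF min_max_in_gidx[OF uv, of r], of "\<lambda>_. gauss"] that assms by simp
    then show "(\<lambda>a. Hnm c m' a u v) \<in> borel_measurable (gaussP (gidx n))"
      unfolding Hnm_eq by (intro borel_measurable_sum borel_measurable_times borel_measurable_const)
  qed
  show ?thesis
    unfolding nu_nm_def mtrace_matfun_poisson[OF sym_Hnm]
    by (intro borel_measurable_times borel_measurable_const measurable_compose[OF _ borel_measurable_Im] borel_measurable_sum R)
qed

text \<open>At fixed a the displacement bound leaves integrals of \<open>S1\<close> and
  \<open>S2\<close> over b, not controlled for individual a. After exchanging the integrals the
  average over a comes first, where the logarithmic bounds hold for each b.\<close>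

lemma expected_difference_le:
  assumes al: "0 < al"
  shows "(\<integral>\<^sup>+ a. ennreal \<bar>nu_n c n a (poisson w) - nu_nm c n m a (poisson w)\<bar> \<partial>gspace n)
    \<le> ennreal (pi / 4 * (al + 1 / al * (4 * rho\<^sup>2 * tau / (Im w)^3 * (real N * L)))
      + (4 * rho * tau / Im w * ((real N)\<^sup>2 * L\<^sup>2) + 8 * rho * tau / (Im w)\<^sup>2 * (real N * L)))"
proof -
  let ?C1 = "4 * rho\<^sup>2 * tau / (Im w)^3" and ?C2 = "4 * rho * tau / Im w" and ?C3 = "8 * rho * tau / (Im w)\<^sup>2"
  let ?K = "\<lambda>a b. ennreal (?C2 * S2 a b + ?C3 * S1 a b)"
  let ?I = "\<lambda>a. \<integral>\<^sup>+ b. ennreal (?C1 * S1 a b) \<partial>Q"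
  let ?J = "\<lambda>a t. \<integral>\<^sup>+ b. ?K a (scale_on hi t b) \<partial>Q"
  let ?E = "?C2 * ((real N)\<^sup>2 * L\<^sup>2) + ?C3 * (real N * L)"
  let ?F = "?C1 * (real N * L)"
  have C: "0 \<le> ?C1" "0 \<le> ?C2" "0 \<le> ?C3" using w by auto
  interpret PQ: pair_prob_space P Q ..
  interpret PL: pair_sigma_finite P lborel ..
  have inner: "(\<integral>\<^sup>+ b. ennreal \<bar>ptrace a b - ptrace a (scale_on hi 0 b0)\<bar> \<partial>Q)
     \<le> ennreal (pi / 4) * (ennreal al + ennreal (1 / al) * ?I a)
      + (\<integral>\<^sup>+ t. ?J a t * indicator {0..1} t \<partial>lborel)" for a b0
  proof -
    obtain B where "gaussian_smooth hi (ptrace a) (ptrace1 a) (ptrace2 a) B" using smooth by blast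
    then interpret gaussian_smooth hi "ptrace a" "ptrace1 a" "ptrace2 a" B .
    have "(\<integral>\<^sup>+ b. ennreal \<bar>ptrace a b - ptrace a (scale_on hi 0 b0)\<bar> \<partial>Q)
     \<le> ennreal (pi / 4) * (ennreal al + ennreal (1 / al) * (\<integral>\<^sup>+ b. ennreal (\<Sum>k\<in>hi. (ptrace1 a k b)\<^sup>2) \<partial>Q))
      + (\<integral>\<^sup>+ t. (\<integral>\<^sup>+ b. ennreal \<bar>\<Sum>k\<in>hi. ptrace2 a k (scale_on hi t b)\<bar> \<partial>Q) * indicator {0..1} t \<partial>lborel)"
      by (rule expected_displacement_le[OF al])
    also have "\<dots> \<le> ennreal (pi / 4) * (ennreal al + ennreal (1 / al) * ?I a)
      + (\<integral>\<^sup>+ t. ?J a t * indicator {0..1} t \<partial>lborel)"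
      unfolding S1_def S2_def
      by (intro add_mono mult_left_mono mult_right_mono nn_integral_mono ennreal_leI gradient_le laplacian_le order_refl) auto
    finally show ?thesis .
  qed
  have m1: "(\<lambda>(a, b). ennreal (?C1 * S1 a b)) \<in> borel_measurable (P \<Otimes>\<^sub>M Q)"
    unfolding case_prod_beta using S1_meas[OF measurable_fst measurable_snd] by measurable
  have mK: "(\<lambda>p. ?K (a p) (scale_on hi (t p) (b p))) \<in> borel_measurable M"
    if "a \<in> measurable M P" "b \<in> measurable M Q" "t \<in> borel_measurable M" for M :: "'z measure" and a b t
    using S1_meas[OF that(1) measurable_scale_on[OF that(3,2)]] S2_meas[OF that(1) measurable_scale_on[OF that(3,2)]]
    by measurable
  have mKt: "(\<lambda>(a, b). ?K a (scale_on hi t b)) \<in> borel_measurable (P \<Otimes>\<^sub>M Q)" for t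
    unfolding case_prod_beta by (rule mK[OF measurable_fst measurable_snd borel_measurable_const])
  have "(\<lambda>(p, b). ?K (fst p) (scale_on hi (snd p) b)) \<in> borel_measurable ((P \<Otimes>\<^sub>M lborel) \<Otimes>\<^sub>M Q)"
    unfolding case_prod_beta
    by (rule mK[OF measurable_compose[OF measurable_fst measurable_fst] measurable_snd]) measurable
  then have "(\<lambda>p. \<integral>\<^sup>+ b. ?K (fst p) (scale_on hi (snd p) b) \<partial>Q) \<in> borel_measurable (P \<Otimes>\<^sub>M lborel)"
    by (rule gauss_prod.borel_measurable_nn_integral)
  then have m2: "(\<lambda>(a, t). ?J a t * indicator {0..1} t) \<in> borel_measurable (P \<Otimes>\<^sub>M lborel)"
    unfolding case_prod_beta by (rule borel_measurable_times_ennreal) measurable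
  have T1: "(\<integral>\<^sup>+ a. ?I a \<partial>P) \<le> ennreal ?F"
  proof -
    have "(\<integral>\<^sup>+ a. ?I a \<partial>P) = (\<integral>\<^sup>+ b. (\<integral>\<^sup>+ a. ennreal (?C1 * S1 a b) \<partial>P) \<partial>Q)"
      by (rule PQ.Fubini'[OF m1, symmetric])
    also have "\<dots> \<le> (\<integral>\<^sup>+ b. ennreal ?F \<partial>Q)"
    proof (intro nn_integral_mono)
      fix b
      assume "b \<in> space Q"
      have [measurable]: "(\<lambda>a. S1 a b) \<in> borel_measurable P" by (rule S1_meas) (use \<open>b \<in> space Q\<close> in auto)
      have "(\<integral>\<^sup>+ a. ennreal (?C1 * S1 a b) \<partial>P) = ennreal ?C1 * (\<integral>\<^sup>+ a. ennreal (S1 a b) \<partial>P)"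
        using C by (simp only: ennreal_mult') (rule nn_integral_cmult, measurable)
      also have "\<dots> \<le> ennreal ?C1 * ennreal (real N * L)" by (intro mult_left_mono average_S1) auto
      also have "\<dots> = ennreal ?F" using C by (simp only: ennreal_mult')
      finally show "(\<integral>\<^sup>+ a. ennreal (?C1 * S1 a b) \<partial>P) \<le> ennreal ?F" .
    qed
    also have "\<dots> = ennreal ?F" by (simp add: gauss_prod.emeasure_space_1)
    finally show ?thesis .
  qed
  \<comment> \<open>For each t the scaled vector is just another frozen b, so the bound does not
    involve t and the interval [0, 1] contributes a factor 1.\<close>
  have T2: "(\<integral>\<^sup>+ a. (\<integral>\<^sup>+ t. ?J a t * indicator {0..1} t \<partial>lborel) \<partial>P)
     \<le> ennreal ?E"
  proof -
    have "(\<integral>\<^sup>+ a. (\<integral>\<^sup>+ t. ?J a t * indicator {0..1} t \<partial>lborel) \<partial>P)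
      = (\<integral>\<^sup>+ t. (\<integral>\<^sup>+ a. ?J a t * indicator {0..1} t \<partial>P) \<partial>lborel)"
      by (rule PL.Fubini'[OF m2, symmetric])
    also have "\<dots> \<le> (\<integral>\<^sup>+ t. ennreal ?E * indicator {0..1::real} t \<partial>lborel)"
    proof (intro nn_integral_mono)
      fix t :: real
      have mX: "(\<lambda>a. ?J a t) \<in> borel_measurable P"
        using gauss_prod.borel_measurable_nn_integral[OF mKt[of t]] .
      have "(\<integral>\<^sup>+ a. ?J a t \<partial>P) = (\<integral>\<^sup>+ b. (\<integral>\<^sup>+ a. ?K a (scale_on hi t b) \<partial>P) \<partial>Q)"
        by (rule PQ.Fubini'[OF mKt, symmetric])
      also have "\<dots> \<le> (\<integral>\<^sup>+ b. ennreal ?E \<partial>Q)"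
      proof (intro nn_integral_mono)
        fix b
        let ?s = "scale_on hi t b"
        have "?s \<in> space Q" by (auto simp: scale_on_def space_PiM)
        then have [measurable]: "(\<lambda>a. S1 a ?s) \<in> borel_measurable P" "(\<lambda>a. S2 a ?s) \<in> borel_measurable P"
          by (auto intro!: S1_meas S2_meas)
        have "(\<integral>\<^sup>+ a. ?K a ?s \<partial>P)
          = (\<integral>\<^sup>+ a. ennreal ?C2 * ennreal (S2 a ?s) + ennreal ?C3 * ennreal (S1 a ?s) \<partial>P)"
          using C S_ge_0 by (intro nn_integral_cong) (simp only: ennreal_mult' ennreal_plus mult_nonneg_nonneg)
        also have "\<dots> = (\<integral>\<^sup>+ a. ennreal ?C2 * ennreal (S2 a ?s) \<partial>P)
            + (\<integral>\<^sup>+ a. ennreal ?C3 * ennreal (S1 a ?s) \<partial>P)"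
          by (rule nn_integral_add) measurable
        also have "(\<integral>\<^sup>+ a. ennreal ?C2 * ennreal (S2 a ?s) \<partial>P) = ennreal ?C2 * (\<integral>\<^sup>+ a. ennreal (S2 a ?s) \<partial>P)"
          by (rule nn_integral_cmult) measurable
        also have "(\<integral>\<^sup>+ a. ennreal ?C3 * ennreal (S1 a ?s) \<partial>P) = ennreal ?C3 * (\<integral>\<^sup>+ a. ennreal (S1 a ?s) \<partial>P)"
          by (rule nn_integral_cmult) measurable
        also have "ennreal ?C2 * (\<integral>\<^sup>+ a. ennreal (S2 a ?s) \<partial>P) + ennreal ?C3 * (\<integral>\<^sup>+ a. ennreal (S1 a ?s) \<partial>P)
          \<le> ennreal ?C2 * ennreal ((real N)\<^sup>2 * L\<^sup>2) + ennreal ?C3 * ennreal (real N * L)"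
          by (intro add_mono mult_left_mono average_S1 average_S2) auto
        also have "\<dots> = ennreal ?E"
          using C L_ge_0 by (simp only: ennreal_mult'[symmetric] ennreal_plus[symmetric] mult_nonneg_nonneg zero_le_power2 of_nat_0_le_iff)
        finally show "(\<integral>\<^sup>+ a. ?K a ?s \<partial>P) \<le> ennreal ?E" .
      qed
      also have "\<dots> = ennreal ?E" by (simp add: gauss_prod.emeasure_space_1)
      finally have "(\<integral>\<^sup>+ a. ?J a t \<partial>P) \<le> ennreal ?E" .
      then have "(\<integral>\<^sup>+ a. ?J a t \<partial>P) * indicator {0..1} t \<le> ennreal ?E * indicator {0..1} t"
        by (rule mult_right_mono) auto
      then show "(\<integral>\<^sup>+ a. ?J a t * indicator {0..1} t \<partial>P) \<le> ennreal ?E * indicator {0..1} t"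
        unfolding nn_integral_multc[OF mX] .
    qed
    also have "\<dots> = ennreal ?E" by (subst nn_integral_cmult) auto
    finally show ?thesis .
  qed
  have "(\<integral>\<^sup>+ a. ennreal \<bar>nu_n c n a (poisson w) - nu_nm c n m a (poisson w)\<bar> \<partial>gspace n)
    = (\<integral>\<^sup>+ a. ennreal \<bar>nu_n c n a (poisson w) - nu_nm c n m a (poisson w)\<bar> \<partial>gaussP (lo \<union> hi))"
    unfolding gidx_split gspace_def ..
  also have "\<dots> = (\<integral>\<^sup>+ a. (\<integral>\<^sup>+ b. ennreal \<bar>nu_n c n (merge lo hi (a, b)) (poisson w)
       - nu_nm c n m (merge lo hi (a, b)) (poisson w)\<bar> \<partial>Q) \<partial>P)"
  proof (rule gauss_prod.product_nn_integral_fold)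
    show "(\<lambda>a. ennreal \<bar>nu_n c n a (poisson w) - nu_nm c n m a (poisson w)\<bar>) \<in> borel_measurable (gaussP (lo \<union> hi))"
      unfolding gidx_split nu_n_def using nu_meas[of n] nu_meas[OF mn] by measurable
  qed (auto simp: gidx_split finite_gidx_parts)
  \<comment> \<open>Scaling by 0 ignores its argument, so \<open>undefined\<close> can stand for
    it.\<close>
  also have "\<dots> = (\<integral>\<^sup>+ a. (\<integral>\<^sup>+ b. ennreal \<bar>ptrace a b - ptrace a (scale_on hi 0 undefined)\<bar> \<partial>Q) \<partial>P)"
    unfolding nu_merge(1) nu_merge(2)[of _ _ undefined] ..
  also have "\<dots> \<le> (\<integral>\<^sup>+ a. ennreal (pi / 4) * (ennreal al + ennreal (1 / al) * ?I a)
      + (\<integral>\<^sup>+ t. ?J a t * indicator {0..1} t \<partial>lborel) \<partial>P)"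
    by (intro nn_integral_mono inner)
  also have "\<dots> = ennreal (pi / 4) * (ennreal al + ennreal (1 / al) * (\<integral>\<^sup>+ a. ?I a \<partial>P))
      + (\<integral>\<^sup>+ a. (\<integral>\<^sup>+ t. ?J a t * indicator {0..1} t \<partial>lborel) \<partial>P)"
  proof -
    let ?G = "\<lambda>a. \<integral>\<^sup>+ t. ?J a t * indicator {0..1} t \<partial>lborel"
    have mF: "?I \<in> borel_measurable P"
      using gauss_prod.borel_measurable_nn_integral[OF m1] .
    have mG: "?G \<in> borel_measurable P"
      using lborel.borel_measurable_nn_integral[OF m2] .
    have add: "(\<integral>\<^sup>+ a. ennreal (pi / 4) * (ennreal al + ennreal (1 / al) * f a) + g a \<partial>P)
      = ennreal (pi / 4) * (ennreal al + ennreal (1 / al) * (\<integral>\<^sup>+ a. f a \<partial>P)) + (\<integral>\<^sup>+ a. g a \<partial>P)"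
      if [measurable]: "f \<in> borel_measurable P" "g \<in> borel_measurable P" for f g
      by (simp add: nn_integral_add nn_integral_cmult gauss_prod.emeasure_space_1)
    show ?thesis by (rule add[OF mF mG])
  qed
  also have "\<dots> \<le> ennreal (pi / 4) * (ennreal al + ennreal (1 / al) * ennreal ?F)
      + ennreal ?E"
    by (intro add_mono mult_left_mono T1 T2) auto
  also have "\<dots> = ennreal (pi / 4 * (al + 1 / al * ?F) + ?E)"
  proof -
    have a: "0 \<le> ?F" "0 \<le> ?E"
      using mult_nonneg_nonneg[OF C(1) mult_nonneg_nonneg[OF of_nat_0_le_iff L_ge_0]]
        add_nonneg_nonneg[OF mult_nonneg_nonneg[OF C(2) mult_nonneg_nonneg[OF zero_le_power2 zero_le_power2]]
          mult_nonneg_nonneg[OF C(3) mult_nonneg_nonneg[OF of_nat_0_le_iff L_ge_0]]]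
      by blast+
    have b: "0 \<le> 1 / al * ?F" using al by (intro mult_nonneg_nonneg a(1)) simp
    have e1: "ennreal (1 / al) * ennreal ?F = ennreal (1 / al * ?F)"
      using al by (intro ennreal_mult'[symmetric]) simp
    have e2: "ennreal al + ennreal (1 / al * ?F) = ennreal (al + 1 / al * ?F)"
      by (rule ennreal_plus[symmetric, OF less_imp_le[OF al] b])
    have e3: "ennreal (pi / 4) * ennreal (al + 1 / al * ?F) = ennreal (pi / 4 * (al + 1 / al * ?F))"
      by (intro ennreal_mult'[symmetric]) simp
    have "0 \<le> pi / 4 * (al + 1 / al * ?F)"
      by (rule mult_nonneg_nonneg[OF _ add_nonneg_nonneg[OF less_imp_le[OF al] b]]) simp
    then show ?thesis unfolding e1 e2 e3 using a(2) by (rule ennreal_plus[symmetric])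
  qed
  finally show ?thesis .
qed

end

text \<open>Via ln u <= u^e / e the logarithm becomes an arbitrarily small power of 2^l, with a
  prefactor uniform in l.\<close>

lemma ln_one_plus_scaled_le:
  fixes y :: real
  assumes y: "0 < y" and e: "0 < e"
  shows "1 + 4 * ln (1 + sqrt 2 / (2 powr (- real l) * y))
    \<le> (1 + 4 / e * (1 + sqrt 2 / y) powr e) * 2 powr (e * real l)"
proof -
  let ?Z = "1 + sqrt 2 / y" and ?q = "2 powr real l"
  have q: "1 \<le> ?q" by (simp add: ge_one_powr_ge_zero)
  have Z: "1 \<le> ?Z" using y by simp
  have eq: "sqrt 2 / (2 powr (- real l) * y) = sqrt 2 / y * ?q" by (simp add: powr_minus field_simps)
  have "1 + sqrt 2 / (2 powr (- real l) * y) \<le> ?Z * ?q"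
    unfolding eq using q by (simp add: distrib_right)
  moreover have "0 < 1 + sqrt 2 / (2 powr (- real l) * y)" using y by (simp add: add_pos_nonneg)
  ultimately have "ln (1 + sqrt 2 / (2 powr (- real l) * y)) \<le> ln (?Z * ?q)" by (simp only: ln_mono)
  also have "\<dots> \<le> (?Z * ?q) powr e / e"
    using Z q e by (intro ln_powr_bound) (auto intro: mult_ge1_I)
  also have "(?Z * ?q) powr e = ?Z powr e * 2 powr (e * real l)"
    using Z by (simp add: powr_mult powr_powr mult.commute)
  finally have "1 + 4 * ln (1 + sqrt 2 / (2 powr (- real l) * y)) \<le> 1 + 4 * (?Z powr e * 2 powr (e * real l) / e)"
    by simp
  also have "\<dots> \<le> 2 powr (e * real l) + 4 * (?Z powr e * 2 powr (e * real l) / e)"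
    using e by (simp add: ge_one_powr_ge_zero)
  also have "\<dots> = (1 + 4 / e * ?Z powr e) * 2 powr (e * real l)" by (simp add: algebra_simps)
  finally show ?thesis .
qed

theorem theorem5p2:
  fixes c E :: real and z :: complex
  assumes "c > 0" and "Im z > 0"
  shows "\<exists>C::real. \<exists>\<delta>::real. \<delta> > 0 \<and>
    (\<forall>n m l :: nat. m \<le> n \<and> n \<le> l \<longrightarrow>
      (\<integral>\<^sup>+ \<omega>. ennreal \<bar>nu_n c n \<omega> (poisson (complex_of_real E + complex_of_real (2 powr (- real l)) * z))
                       - nu_nm c n m \<omega> (poisson (complex_of_real E + complex_of_real (2 powr (- real l)) * z))\<bar>
         \<partial>gspace n)
      \<le> ennreal (C * 2 powr (3 * (real l - (1 + \<delta>) * real m))))"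
proof -
  define y where "y = Im z"
  \<comment> \<open>The bound by c lets the gain 2^(- c m) pay for 2^(\<kappa> m); the bound by 1
    lets the surplus l - m pay for replacing \<kappa> l by \<kappa> m.\<close>
  define \<kappa> where "\<kappa> = min c 1"
  \<comment> \<open>The drift contains L^2 and hence 2^(2 e l), which spends half of \<kappa>
    l.\<close>
  define e where "e = \<kappa> / 4"
  \<comment> \<open>The fluctuation is compared with the square of the target, which costs 6
    \<delta> m = \<kappa> m / 2. With e l added, the total is at most 3/4 of \<kappa> m plus a
    quarter of l - m.\<close>
  define \<delta> where "\<delta> = \<kappa> / 12"
  define K where "K = 1 + 4 / e * (1 + sqrt 2 / y) powr e"
  define C where "C = pi / 4 * (1 + 4 * K / y^3) + (4 * K\<^sup>2 / y + 8 * K / y\<^sup>2)"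
  have y: "0 < y" using assms by (simp add: y_def)
  have \<kappa>: "0 < \<kappa>" "\<kappa> \<le> c" "\<kappa> \<le> 1" using assms by (auto simp: \<kappa>_def)
  have e: "0 < e" and \<delta>: "0 < \<delta>" using \<kappa> by (auto simp: e_def \<delta>_def)
  have K: "0 \<le> K" using e by (simp add: K_def)
  have "(\<integral>\<^sup>+ \<omega>. ennreal \<bar>nu_n c n \<omega> (poisson (complex_of_real E + complex_of_real (2 powr (- real l)) * z))
                       - nu_nm c n m \<omega> (poisson (complex_of_real E + complex_of_real (2 powr (- real l)) * z))\<bar>
         \<partial>gspace n)
      \<le> ennreal (C * 2 powr (3 * (real l - (1 + \<delta>) * real m)))" if mn: "m \<le> n" and nl: "n \<le> l" for n m l :: nat
  proof -
    define w where "w = complex_of_real E + complex_of_real (2 powr (- real l)) * z"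
    \<comment> \<open>The target bound without its constant, and at the same time the parameter
      \<open>al\<close> of \<open>expected_difference_le\<close>.\<close>
    define T where "T = 2 powr (3 * (real l - (1 + \<delta>) * real m))"
    have Imw: "Im w = 2 powr (- real l) * y" by (simp add: w_def y_def)
    interpret ultrametric c m n w
      by unfold_locales (use assms mn y in \<open>auto simp: Imw\<close>)
    have T: "0 < T" by (simp add: T_def)
    have Lb: "L \<le> K * 2 powr (e * real l)"
      unfolding Imw K_def by (rule ln_one_plus_scaled_le[OF y e])
    have L2: "L\<^sup>2 \<le> K\<^sup>2 * 2 powr (2 * e * real l)"
    proof -
      have "L\<^sup>2 \<le> (K * 2 powr (e * real l))\<^sup>2" by (rule power_mono[OF Lb L_ge_0])
      also have "\<dots> = K\<^sup>2 * 2 powr (2 * e * real l)"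
        by (simp add: power_mult_distrib powr_power mult_ac)
      finally show ?thesis .
    qed
    have N: "real N = 2 powr real n" by (simp add: powr_realpow)
    have f1: "\<kappa> * real m \<le> c * real m" using \<kappa> by (intro mult_right_mono) auto
    have f2: "\<kappa> * real l - \<kappa> * real m \<le> real l - real m"
    proof -
      have "\<kappa> * (real l - real m) \<le> 1 * (real l - real m)" using \<kappa> mn nl by (intro mult_right_mono) auto
      then show ?thesis by (simp add: algebra_simps)
    qed
    have f3: "0 \<le> \<kappa> * real m" using \<kappa> by simp
    have mn': "real m \<le> real n" "real n \<le> real l" using mn nl by auto
    \<comment> \<open>With \<open>al\<close> = T the mean-square fluctuation has to be of order T^2.
      The factor 2^(- n) left over from \<open>rho\<close> and N enters through n >= m.\<close>
    have A: "1 / T * (4 * rho\<^sup>2 * tau / (Im w)^3 * (real N * L)) \<le> 4 * K / y^3 * T"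
    proof -
      have alg: "1 / T * (4 * r * t / (q * Y) * (N' * L')) = 4 / Y * L' * (1 / T * (r * N') * t * (1 / q))"
        for r t q Y N' L' :: real by (simp add: mult_ac)
      have r: "rho\<^sup>2 * real N = 2 powr (- real n)"
        unfolding N by (simp add: powr_power powr_add[symmetric])
      have W: "(Im w)^3 = 2 powr (- 3 * real l) * y^3"
        by (simp add: Imw power_mult_distrib powr_power mult.commute)
      have "1 / T * (4 * rho\<^sup>2 * tau / (Im w)^3 * (real N * L))
          = 4 / y^3 * L * (1 / T * 2 powr (- real n) * tau * (1 / 2 powr (- 3 * real l)))"
        unfolding W alg r ..
      also have "1 / T * 2 powr (- real n) * tau * (1 / 2 powr (- 3 * real l))
          = 2 powr (- (3 * (real l - (1 + \<delta>) * real m)) + - real n + - (2 + c) * real m + 3 * real l)"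
      proof -
        have t: "1 / T = 2 powr (- (3 * (real l - (1 + \<delta>) * real m)))"
          unfolding T_def by (rule powr_minus_divide[symmetric])
        have q: "1 / 2 powr (- 3 * real l) = 2 powr (3 * real l)" by (simp add: powr_minus_divide)
        show ?thesis unfolding t q powr_add ..
      qed
      also have "4 / y^3 * L * \<dots> \<le> 4 / y^3 * (K * 2 powr (e * real l)) * \<dots>"
        using y by (intro mult_left_mono mult_right_mono Lb) auto
      also have "\<dots> = 4 * K / y^3 * 2 powr (e * real l + (- (3 * (real l - (1 + \<delta>) * real m)) + - real n + - (2 + c) * real m + 3 * real l))"
        by (simp add: powr_add)
      also have "\<dots> \<le> 4 * K / y^3 * T"
        unfolding T_def using K y
      proof (intro mult_left_mono powr_mono)
        show "e * real l + (- (3 * (real l - (1 + \<delta>) * real m)) + - real n + - (2 + c) * real m + 3 * real l)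
            \<le> 3 * (real l - (1 + \<delta>) * real m)"
          using f1 f2 f3 mn' unfolding e_def \<delta>_def by (simp add: algebra_simps)
      qed auto
      finally show ?thesis .
    qed
    \<comment> \<open>The minor part of the drift. Its factor 2^n is absorbed through n <=
      l.\<close>
    have B: "4 * rho * tau / Im w * ((real N)\<^sup>2 * L\<^sup>2) \<le> 4 * K\<^sup>2 / y * T"
    proof -
      have alg: "4 * r * t / (q * y) * (N' * L') = 4 / y * L' * ((r * N') * t * (1 / q))"
        for r t q N' L' :: real by (simp add: mult_ac)
      have r: "rho * (real N)\<^sup>2 = 2 powr real n"
        unfolding N by (simp add: powr_power powr_add[symmetric])
      have "4 * rho * tau / Im w * ((real N)\<^sup>2 * L\<^sup>2) = 4 / y * L\<^sup>2 * (2 powr real n * tau * (1 / 2 powr (- real l)))"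
        unfolding Imw alg r ..
      also have "2 powr real n * tau * (1 / 2 powr (- real l)) = 2 powr (real n + - (2 + c) * real m + real l)"
        unfolding powr_add by (simp add: powr_minus divide_inverse)
      also have "4 / y * L\<^sup>2 * \<dots> \<le> 4 / y * (K\<^sup>2 * 2 powr (2 * e * real l)) * \<dots>"
        using y by (intro mult_left_mono mult_right_mono L2) auto
      also have "\<dots> = 4 * K\<^sup>2 / y * 2 powr (2 * e * real l + (real n + - (2 + c) * real m + real l))"
        by (simp add: powr_add)
      also have "\<dots> \<le> 4 * K\<^sup>2 / y * T"
        unfolding T_def using K y
      proof (intro mult_left_mono powr_mono)
        show "2 * e * real l + (real n + - (2 + c) * real m + real l) \<le> 3 * (real l - (1 + \<delta>) * real m)"
          using f1 f2 f3 mn' unfolding e_def \<delta>_def by (simp add: algebra_simps)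
      qed auto
      finally show ?thesis .
    qed
    have D: "8 * rho * tau / (Im w)\<^sup>2 * (real N * L) \<le> 8 * K / y\<^sup>2 * T"
    proof -
      have alg: "8 * r * t / (q * Y) * (N' * L') = 8 / Y * L' * ((r * N') * t * (1 / q))"
        for r t q Y N' L' :: real by (simp add: mult_ac)
      have r: "rho * real N = 1" unfolding N by (simp add: powr_add[symmetric])
      have W: "(Im w)\<^sup>2 = 2 powr (- 2 * real l) * y\<^sup>2"
        by (simp add: Imw power_mult_distrib powr_power mult.commute)
      have "8 * rho * tau / (Im w)\<^sup>2 * (real N * L) = 8 / y\<^sup>2 * L * (1 * tau * (1 / 2 powr (- 2 * real l)))"
        unfolding W alg r ..
      also have "1 * tau * (1 / 2 powr (- 2 * real l)) = 2 powr (- (2 + c) * real m + 2 * real l)"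
        unfolding powr_add by (simp add: powr_minus divide_inverse)
      also have "8 / y\<^sup>2 * L * \<dots> \<le> 8 / y\<^sup>2 * (K * 2 powr (e * real l)) * \<dots>"
        using y by (intro mult_left_mono mult_right_mono Lb) auto
      also have "\<dots> = 8 * K / y\<^sup>2 * 2 powr (e * real l + (- (2 + c) * real m + 2 * real l))"
        by (simp add: powr_add)
      also have "\<dots> \<le> 8 * K / y\<^sup>2 * T"
        unfolding T_def using K y
      proof (intro mult_left_mono powr_mono)
        show "e * real l + (- (2 + c) * real m + 2 * real l) \<le> 3 * (real l - (1 + \<delta>) * real m)"
          using f1 f2 f3 mn' unfolding e_def \<delta>_def by (simp add: algebra_simps)
      qed auto
      finally show ?thesis .
    qed
    have "pi / 4 * (T + 1 / T * (4 * rho\<^sup>2 * tau / (Im w)^3 * (real N * L)))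
        + (4 * rho * tau / Im w * ((real N)\<^sup>2 * L\<^sup>2) + 8 * rho * tau / (Im w)\<^sup>2 * (real N * L))
      \<le> pi / 4 * (T + 4 * K / y^3 * T) + (4 * K\<^sup>2 / y * T + 8 * K / y\<^sup>2 * T)"
      by (intro add_mono mult_left_mono A B D) auto
    also have "\<dots> = C * T" by (simp add: C_def algebra_simps)
    finally show ?thesis
      using order_trans[OF expected_difference_le[OF T] ennreal_leI] unfolding w_def T_def by blast
  qed
  then show ?thesis using \<delta> by blast
qed

end
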